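(* Let $\Omega^1$ be an $A$-bimodule that is finitely generated projective as a right $A$-module. Then there is an isomorphism of categories $${}_{B(\Omega^1)}\mathcal{M}\;\cong\;{}_A\mathcal{M}_A^{\Omega^1}$$ between the category of left modules over the algebra $B(\Omega^1)$ and the category ${}_A\mathcal{M}_A^{\Omega^1}$ of $\Omega^1$-intertwined $A$-bimodules.
   Context: Conventions. $\mathbb{K}$ is a field, $A$ a unital associative $\mathbb{K}$-algebra, $\otimes$ means $\otimes_A$. $A^{op}=\{\overline{a}: a\in A\}$ with $\overline{a}\,\overline{b}=\overline{ba}$; $A^e=A\otimes_{\mathbb{K}}A^{op}$ with elements written $a\overline{b}$. $A$-bimodules are identified with left $A^e$-modules via $(a\overline{b})m=amb$. $T_{A^e}(V)$ is the tensor algebra of an $A^e$-bimodule $V$. Let $\mathfrak{X}^1=\mathrm{Hom}_A(\Omega^1,A)$ (right module maps), with $(axb)(\omega)=a\,x(b\omega)$, be the left dual bimodule of $\Omega^1$. The algebra $B(\Omega^1)$. Let $\mathfrak{M}=\mathfrak{X}^1\otimes_{\mathbb{K}}\Omega^1$, elements $x\otimes_{\mathbb{K}}\omega$ written $(x,\omega)$, with $A^e$-bimodule structure $a\overline{a'}(x,\omega)b\overline{b'}=(axb,b'\omega a')$. Put $B(\Omega^1)=T_{A^e}(\mathfrak{M})$ as an algebra. The category ${}_A\mathcal{M}_A^{\Omega^1}$. Objects are pairs $(M,\sigma_M)$ with $M$ an $A$-bimodule and $\sigma_M:M\otimes\Omega^1\to\Omega^1\otimes M$ a bimodule map. Morphisms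 $(M,\sigma_M)\to(N,\sigma_N)$ are bimodule maps $f:M\to N$ with $\sigma_N(f\otimes\mathrm{id}_{\Omega^1})=(\mathrm{id}_{\Omega^1}\otimes f)\sigma_M$. *)

theory Defs
  imports "HOL-Algebra.Module" "HOL-Algebra.Free_Abelian_Groups"
begin

section \<open>Categories and isomorphisms of categories\<close>

text \<open>Hom-sets are indexed by source and target and need not be disjoint, so composition carries
  the three objects as arguments: \<open>Comp C X Y Z g f\<close> is \<open>g \<circ> f\<close> for \<open>f : X \<rightarrow> Y\<close> and \<open>g : Y \<rightarrow> Z\<close>.\<close>

record ('o, 'h) cat =
  Obj :: "'o set"
  Hom :: "'o \<Rightarrow> 'o \<Rightarrow> 'h set"
  Id :: "'o \<Rightarrow> 'h"
  Comp :: "'o \<Rightarrow> 'o \<Rightarrow> 'o \<Rightarrow> 'h \<Rightarrow> 'h \<Rightarrow> 'h"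

locale category =
  fixes C :: "('o, 'h) cat"
  assumes Id_in_Hom: "X \<in> Obj C \<Longrightarrow> Id C X \<in> Hom C X X"
    and Comp_in_Hom:
      "\<lbrakk>X \<in> Obj C; Y \<in> Obj C; Z \<in> Obj C; f \<in> Hom C X Y; g \<in> Hom C Y Z\<rbrakk>
        \<Longrightarrow> Comp C X Y Z g f \<in> Hom C X Z"
    and Comp_Id_right:
      "\<lbrakk>X \<in> Obj C; Y \<in> Obj C; f \<in> Hom C X Y\<rbrakk> \<Longrightarrow> Comp C X X Y f (Id C X) = f"
    and Comp_Id_left:
      "\<lbrakk>X \<in> Obj C; Y \<in> Obj C; f \<in> Hom C X Y\<rbrakk> \<Longrightarrow> Comp C X Y Y (Id C Y) f = f"
    and Comp_assoc:
      "\<lbrakk>W \<in> Obj C; X \<in> Obj C; Y \<in> Obj C; Z \<in> Obj C;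
        f \<in> Hom C W X; g \<in> Hom C X Y; h \<in> Hom C Y Z\<rbrakk>
        \<Longrightarrow> Comp C W X Z (Comp C X Y Z h g) f = Comp C W Y Z h (Comp C W X Y g f)"

locale cat_functor = C: category C + D: category D
  for C :: "('o, 'h) cat" and D :: "('p, 'k) cat" +
  fixes F_obj :: "'o \<Rightarrow> 'p" and F_hom :: "'o \<Rightarrow> 'o \<Rightarrow> 'h \<Rightarrow> 'k"
  assumes F_Obj: "X \<in> Obj C \<Longrightarrow> F_obj X \<in> Obj D"
    and F_Hom:
      "\<lbrakk>X \<in> Obj C; Y \<in> Obj C; f \<in> Hom C X Y\<rbrakk> \<Longrightarrow> F_hom X Y f \<in> Hom D (F_obj X) (F_obj Y)"
    and F_Id: "X \<in> Obj C \<Longrightarrow> F_hom X X (Id C X) = Id D (F_obj X)"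
    and F_Comp:
      "\<lbrakk>X \<in> Obj C; Y \<in> Obj C; Z \<in> Obj C; f \<in> Hom C X Y; g \<in> Hom C Y Z\<rbrakk>
        \<Longrightarrow> F_hom X Z (Comp C X Y Z g f)
             = Comp D (F_obj X) (F_obj Y) (F_obj Z) (F_hom Y Z g) (F_hom X Y f)"

text \<open>Isomorphism (not merely equivalence): two functors whose composites are equal to the
  identity functors, on objects and on morphisms.\<close>

definition isomorphic_categories :: "('o, 'h) cat \<Rightarrow> ('p, 'k) cat \<Rightarrow> bool" where
  "isomorphic_categories C D \<longleftrightarrow>
    (\<exists>F_obj F_hom G_obj G_hom.
       cat_functor C D F_obj F_hom \<and> cat_functor D C G_obj G_hom \<and>
       (\<forall>X \<in> Obj C. G_obj (F_obj X) = X) \<and>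
       (\<forall>Y \<in> Obj D. F_obj (G_obj Y) = Y) \<and>
       (\<forall>X \<in> Obj C. \<forall>X' \<in> Obj C. \<forall>f \<in> Hom C X X'.
          G_hom (F_obj X) (F_obj X') (F_hom X X' f) = f) \<and>
       (\<forall>Y \<in> Obj D. \<forall>Y' \<in> Obj D. \<forall>g \<in> Hom D Y Y'.
          F_hom (G_obj Y) (G_obj Y') (G_hom Y Y' g) = g))"


section \<open>Algebras, modules and bimodules\<close>

text \<open>The library's locale \<open>module\<close> requires a commutative ring of scalars, and its locale
  \<open>algebra\<close> a commutative algebra. We keep the library's record \<open>module\<close>; as there, the
  multiplicative fields \<open>mult\<close> and \<open>one\<close> of the record are not used for modules.\<close>

locale left_module = R?: ring R + M?: abelian_group M
  for R :: "('r, 'x) ring_scheme" and M :: "('r, 'm, 'y) module_scheme" +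
  assumes smult_closed:
      "\<lbrakk>r \<in> carrier R; m \<in> carrier M\<rbrakk> \<Longrightarrow> r \<odot>\<^bsub>M\<^esub> m \<in> carrier M"
    and smult_l_distr:
      "\<lbrakk>r \<in> carrier R; s \<in> carrier R; m \<in> carrier M\<rbrakk>
        \<Longrightarrow> (r \<oplus>\<^bsub>R\<^esub> s) \<odot>\<^bsub>M\<^esub> m = r \<odot>\<^bsub>M\<^esub> m \<oplus>\<^bsub>M\<^esub> s \<odot>\<^bsub>M\<^esub> m"
    and smult_r_distr:
      "\<lbrakk>r \<in> carrier R; m \<in> carrier M; n \<in> carrier M\<rbrakk>
        \<Longrightarrow> r \<odot>\<^bsub>M\<^esub> (m \<oplus>\<^bsub>M\<^esub> n) = r \<odot>\<^bsub>M\<^esub> m \<oplus>\<^bsub>M\<^esub> r \<odot>\<^bsub>M\<^esub> n"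
    and smult_assoc:
      "\<lbrakk>r \<in> carrier R; s \<in> carrier R; m \<in> carrier M\<rbrakk>
        \<Longrightarrow> (r \<otimes>\<^bsub>R\<^esub> s) \<odot>\<^bsub>M\<^esub> m = r \<odot>\<^bsub>M\<^esub> (s \<odot>\<^bsub>M\<^esub> m)"
    and smult_one: "m \<in> carrier M \<Longrightarrow> \<one>\<^bsub>R\<^esub> \<odot>\<^bsub>M\<^esub> m = m"

locale assoc_algebra = module K A + A?: ring A
  for K :: "('k, 'x) ring_scheme" and A :: "('k, 'a, 'y) module_scheme" +
  assumes smult_mult_left:
      "\<lbrakk>k \<in> carrier K; a \<in> carrier A; b \<in> carrier A\<rbrakk>
        \<Longrightarrow> (k \<odot>\<^bsub>A\<^esub> a) \<otimes>\<^bsub>A\<^esub> b = k \<odot>\<^bsub>A\<^esub> (a \<otimes>\<^bsub>A\<^esub> b)"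
    and smult_mult_right:
      "\<lbrakk>k \<in> carrier K; a \<in> carrier A; b \<in> carrier A\<rbrakk>
        \<Longrightarrow> a \<otimes>\<^bsub>A\<^esub> (k \<odot>\<^bsub>A\<^esub> b) = k \<odot>\<^bsub>A\<^esub> (a \<otimes>\<^bsub>A\<^esub> b)"

text \<open>\<open>\<overline>a\<close> is represented by \<open>a\<close> itself.\<close>

definition op_ring :: "('a, 'x) ring_scheme \<Rightarrow> ('a, 'x) ring_scheme" where
  "op_ring A = A\<lparr>mult := (\<lambda>a b. b \<otimes>\<^bsub>A\<^esub> a)\<rparr>"

record ('r, 'm) bimodule = "('r, 'm) module" +
  rsmult :: "['m, 'r] \<Rightarrow> 'm"  (infixl \<open>\<triangleleft>\<index>\<close> 70)

text \<open>The right action of a bimodule, as a left module structure over the opposite ring.\<close>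

definition right_part :: "('r, 'm, 'y) bimodule_scheme \<Rightarrow> ('r, 'm) module" where
  "right_part M = \<lparr>carrier = carrier M, mult = mult M, one = \<one>\<^bsub>M\<^esub>, ring.zero = \<zero>\<^bsub>M\<^esub>, add = add M,
     smult = (\<lambda>r m. m \<triangleleft>\<^bsub>M\<^esub> r)\<rparr>"

text \<open>\<open>A\<close>-bimodules for a \<open>K\<close>-algebra \<open>A\<close>. They are to be the same thing as left modules over
  \<open>A \<otimes>\<^sub>K A\<^sup>o\<^sup>p\<close>, so the two induced actions of \<open>K\<close> agree.\<close>

locale algebra_bimodule =
  assoc_algebra K A + left: left_module A M + right: left_module "op_ring A" "right_part M"
  for K :: "('k, 'x) ring_scheme" and A :: "('k, 'a, 'y) module_scheme"
    and M :: "('a, 'm, 'z) bimodule_scheme" +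
  assumes actions_commute:
      "\<lbrakk>a \<in> carrier A; b \<in> carrier A; m \<in> carrier M\<rbrakk>
        \<Longrightarrow> (a \<odot>\<^bsub>M\<^esub> m) \<triangleleft>\<^bsub>M\<^esub> b = a \<odot>\<^bsub>M\<^esub> (m \<triangleleft>\<^bsub>M\<^esub> b)"
    and scalars_central:
      "\<lbrakk>k \<in> carrier K; m \<in> carrier M\<rbrakk>
        \<Longrightarrow> (k \<odot>\<^bsub>A\<^esub> \<one>\<^bsub>A\<^esub>) \<odot>\<^bsub>M\<^esub> m = m \<triangleleft>\<^bsub>M\<^esub> (k \<odot>\<^bsub>A\<^esub> \<one>\<^bsub>A\<^esub>)"

text \<open>Homomorphisms are extensional functions, so that equality of morphisms is equality on the
  carrier.\<close>

definition module_hom ::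
  "('r, 'x) ring_scheme \<Rightarrow> ('r, 'm, 'y) module_scheme \<Rightarrow> ('r, 'n, 'z) module_scheme
    \<Rightarrow> ('m \<Rightarrow> 'n) set" where
  "module_hom R M N = {f \<in> carrier M \<rightarrow>\<^sub>E carrier N.
     (\<forall>x \<in> carrier M. \<forall>y \<in> carrier M. f (x \<oplus>\<^bsub>M\<^esub> y) = f x \<oplus>\<^bsub>N\<^esub> f y) \<and>
     (\<forall>r \<in> carrier R. \<forall>x \<in> carrier M. f (r \<odot>\<^bsub>M\<^esub> x) = r \<odot>\<^bsub>N\<^esub> f x)}"

definition bimodule_hom ::
  "('r, 'x) ring_scheme \<Rightarrow> ('r, 'm, 'y) bimodule_scheme \<Rightarrow> ('r, 'n, 'z) bimodule_scheme
    \<Rightarrow> ('m \<Rightarrow> 'n) set" where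
  "bimodule_hom R M N = {f \<in> module_hom R M N.
     \<forall>x \<in> carrier M. \<forall>r \<in> carrier R. f (x \<triangleleft>\<^bsub>M\<^esub> r) = f x \<triangleleft>\<^bsub>N\<^esub> r}"

definition finitely_generated ::
  "('r, 'x) ring_scheme \<Rightarrow> ('r, 'm, 'y) module_scheme \<Rightarrow> bool" where
  "finitely_generated R M \<longleftrightarrow>
    (\<exists>S. finite S \<and> S \<subseteq> carrier M \<and>
      (\<forall>x \<in> carrier M. \<exists>c \<in> S \<rightarrow> carrier R. x = (\<Oplus>\<^bsub>M\<^esub>s\<in>S. c s \<odot>\<^bsub>M\<^esub> s)))"

text \<open>The lifting property. HOL cannot quantify over the carrier types of the test modules inside a
  definition; those chosen here lose nothing, since the free module on the elements of \<open>P\<close> is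
  carried by functions of type \<open>'p \<Rightarrow> 'r\<close>, and lifting the identity of \<open>P\<close> along its surjection
  onto \<open>P\<close> makes \<open>P\<close> a direct summand of a free module.\<close>

definition projective_module ::
  "('r, 'x) ring_scheme \<Rightarrow> ('r, 'p) module \<Rightarrow> bool" where
  "projective_module R P \<longleftrightarrow> left_module R P \<and>
    (\<forall>(N :: ('r, 'p \<Rightarrow> 'r) module) (Q :: ('r, 'p) module) g f.
       left_module R N \<and> left_module R Q \<and>
       g \<in> module_hom R N Q \<and> g ` carrier N = carrier Q \<and> f \<in> module_hom R P Q \<longrightarrow>
       (\<exists>h \<in> module_hom R P N. \<forall>x \<in> carrier P. g (h x) = f x))"


section \<open>Balanced tensor products\<close>

text \<open>\<open>M \<otimes>\<^sub>R N\<close> is the free abelian group on \<open>M \<times> N\<close> modulo the usual relations. Only the right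
  action on \<open>M\<close> and the left action on \<open>N\<close> enter.\<close>

definition tensor_relations ::
  "('r, 'x) ring_scheme \<Rightarrow> ('r, 'm, 'y) bimodule_scheme \<Rightarrow> ('r, 'n, 'z) module_scheme
    \<Rightarrow> ('m \<times> 'n \<Rightarrow>\<^sub>0 int) set" where
  "tensor_relations R M N =
     {frag_of (x \<oplus>\<^bsub>M\<^esub> y, z) - frag_of (x, z) - frag_of (y, z) | x y z.
        x \<in> carrier M \<and> y \<in> carrier M \<and> z \<in> carrier N} \<union>
     {frag_of (x, y \<oplus>\<^bsub>N\<^esub> z) - frag_of (x, y) - frag_of (x, z) | x y z.
        x \<in> carrier M \<and> y \<in> carrier N \<and> z \<in> carrier N} \<union>
     {frag_of (x \<triangleleft>\<^bsub>M\<^esub> r, z) - frag_of (x, r \<odot>\<^bsub>N\<^esub> z) | x r z.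
        x \<in> carrier M \<and> r \<in> carrier R \<and> z \<in> carrier N}"

definition tensor_null ::
  "('r, 'x) ring_scheme \<Rightarrow> ('r, 'm, 'y) bimodule_scheme \<Rightarrow> ('r, 'n, 'z) module_scheme
    \<Rightarrow> ('m \<times> 'n \<Rightarrow>\<^sub>0 int) set" where
  "tensor_null R M N =
     generate (free_Abelian_group (carrier M \<times> carrier N)) (tensor_relations R M N)"

definition tensor_group ::
  "('r, 'x) ring_scheme \<Rightarrow> ('r, 'm, 'y) bimodule_scheme \<Rightarrow> ('r, 'n, 'z) module_scheme
    \<Rightarrow> ('m \<times> 'n \<Rightarrow>\<^sub>0 int) set monoid" where
  "tensor_group R M N = free_Abelian_group (carrier M \<times> carrier N) Mod tensor_null R M N"

text \<open>Maps out of quotients of free abelian groups, given by their values on generators: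
  \<open>induced H f\<close> sends the class of a generator \<open>p\<close> to the class modulo \<open>H\<close> of the generator
  \<open>f p\<close>, and \<open>induced2 H f\<close> is the biadditive analogue. Each is the sum of \<open>H\<close> and the image of
  a coset, hence a single coset of \<open>H\<close> whenever \<open>f\<close> respects the relations.\<close>

definition induced ::
  "('q \<Rightarrow>\<^sub>0 int) set \<Rightarrow> ('p \<Rightarrow> 'q) \<Rightarrow> ('p \<Rightarrow>\<^sub>0 int) set \<Rightarrow> ('q \<Rightarrow>\<^sub>0 int) set" where
  "induced H f S = {h + frag_extend (\<lambda>p. frag_of (f p)) s | h s. h \<in> H \<and> s \<in> S}"

definition induced2 ::
  "('q \<Rightarrow>\<^sub>0 int) set \<Rightarrow> ('p \<Rightarrow> 'p' \<Rightarrow> 'q)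
    \<Rightarrow> ('p \<Rightarrow>\<^sub>0 int) set \<Rightarrow> ('p' \<Rightarrow>\<^sub>0 int) set \<Rightarrow> ('q \<Rightarrow>\<^sub>0 int) set" where
  "induced2 H f S T =
     {h + frag_extend (\<lambda>p. frag_extend (\<lambda>p'. frag_of (f p p')) t) s | h s t.
        h \<in> H \<and> s \<in> S \<and> t \<in> T}"

definition tensor_bimodule ::
  "('r, 'x) ring_scheme \<Rightarrow> ('r, 'm, 'y) bimodule_scheme \<Rightarrow> ('r, 'n, 'z) bimodule_scheme
    \<Rightarrow> ('r, ('m \<times> 'n \<Rightarrow>\<^sub>0 int) set) bimodule" where
  "tensor_bimodule R M N =
     \<lparr>carrier = carrier (tensor_group R M N), mult = undefined, one = undefined,
      ring.zero = \<one>\<^bsub>tensor_group R M N\<^esub>, add = mult (tensor_group R M N),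
      smult = (\<lambda>r. induced (tensor_null R M N) (\<lambda>(x, y). (r \<odot>\<^bsub>M\<^esub> x, y))),
      rsmult = (\<lambda>t r. induced (tensor_null R M N) (\<lambda>(x, y). (x, y \<triangleleft>\<^bsub>N\<^esub> r)) t)\<rparr>"

definition tensor_map ::
  "('r, 'x) ring_scheme \<Rightarrow> ('r, 'm, 'y) bimodule_scheme \<Rightarrow> ('r, 'n, 'z) bimodule_scheme
    \<Rightarrow> ('m0 \<Rightarrow> 'm) \<Rightarrow> ('n0 \<Rightarrow> 'n) \<Rightarrow> ('m0 \<times> 'n0 \<Rightarrow>\<^sub>0 int) set \<Rightarrow> ('m \<times> 'n \<Rightarrow>\<^sub>0 int) set" where
  \<comment> \<open>\<open>M\<close> and \<open>N\<close> are the targets of \<open>f\<close> and \<open>g\<close>\<close>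
  "tensor_map R M N f g = induced (tensor_null R M N) (\<lambda>(x, y). (f x, g y))"


section \<open>The enveloping algebra\<close>

definition central_bimodule :: "('k, 'm, 'y) module_scheme \<Rightarrow> ('k, 'm) bimodule" where
  "central_bimodule M =
     \<lparr>carrier = carrier M, mult = mult M, one = \<one>\<^bsub>M\<^esub>, ring.zero = \<zero>\<^bsub>M\<^esub>, add = add M,
      smult = smult M, rsmult = (\<lambda>m k. k \<odot>\<^bsub>M\<^esub> m)\<rparr>"

definition enveloping_algebra ::
  "('k, 'x) ring_scheme \<Rightarrow> ('k, 'a, 'y) module_scheme \<Rightarrow> ('a \<times> 'a \<Rightarrow>\<^sub>0 int) set ring" where
  "enveloping_algebra K A =
    (let A1 = central_bimodule A; A2 = central_bimodule (op_ring A);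
         G = tensor_group K A1 A2; H = tensor_null K A1 A2
     in \<lparr>carrier = carrier G,
         mult = induced2 H (\<lambda>(a, a') (b, b'). (a \<otimes>\<^bsub>A\<^esub> b, a' \<otimes>\<^bsub>op_ring A\<^esub> b')),
         one = H #>\<^bsub>free_Abelian_group (carrier A \<times> carrier A)\<^esub> frag_of (\<one>\<^bsub>A\<^esub>, \<one>\<^bsub>A\<^esub>),
         ring.zero = \<one>\<^bsub>G\<^esub>, add = mult G\<rparr>)"


section \<open>Tensor algebras\<close>

text \<open>For a ring \<open>R\<close> and an \<open>R\<close>-bimodule \<open>V\<close>, the tensor algebra is the direct sum of \<open>R\<close> and the
  balanced tensor powers of \<open>V\<close> of positive degree, with concatenation as product. The word
  \<open>[v\<^sub>1, \<dots>, v\<^sub>n]\<close> stands for the pure tensor of its letters. All relations are homogeneous in the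
  word length, so the quotient \<open>tensor_powers R V\<close> of the free abelian group on the nonempty words
  is the direct sum of the \<open>n\<close>-fold tensor powers for \<open>n \<ge> 1\<close>.\<close>

definition words :: "('r, 'v, 'y) bimodule_scheme \<Rightarrow> 'v list set" where
  "words V = lists (carrier V) - {[]}"

definition word_relations ::
  "('r, 'x) ring_scheme \<Rightarrow> ('r, 'v, 'y) bimodule_scheme \<Rightarrow> ('v list \<Rightarrow>\<^sub>0 int) set" where
  "word_relations R V =
     {frag_of (xs @ [v \<oplus>\<^bsub>V\<^esub> w] @ ys) - frag_of (xs @ [v] @ ys) - frag_of (xs @ [w] @ ys)
        | xs ys v w. xs \<in> lists (carrier V) \<and> ys \<in> lists (carrier V) \<and>
                     v \<in> carrier V \<and> w \<in> carrier V} \<union>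
     {frag_of (xs @ [v \<triangleleft>\<^bsub>V\<^esub> r, w] @ ys) - frag_of (xs @ [v, r \<odot>\<^bsub>V\<^esub> w] @ ys)
        | xs ys v w r. xs \<in> lists (carrier V) \<and> ys \<in> lists (carrier V) \<and>
                       v \<in> carrier V \<and> w \<in> carrier V \<and> r \<in> carrier R}"

definition word_null ::
  "('r, 'x) ring_scheme \<Rightarrow> ('r, 'v, 'y) bimodule_scheme \<Rightarrow> ('v list \<Rightarrow>\<^sub>0 int) set" where
  "word_null R V = generate (free_Abelian_group (words V)) (word_relations R V)"

definition tensor_powers ::
  "('r, 'x) ring_scheme \<Rightarrow> ('r, 'v, 'y) bimodule_scheme \<Rightarrow> ('r, ('v list \<Rightarrow>\<^sub>0 int) set) bimodule"
  where
  "tensor_powers R V =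
    (let H = word_null R V; G = free_Abelian_group (words V) Mod H
     in \<lparr>carrier = carrier G,
         mult = induced2 H (\<lambda>xs ys. xs @ ys), one = undefined,
         ring.zero = \<one>\<^bsub>G\<^esub>, add = mult G,
         smult = (\<lambda>r. induced H (\<lambda>xs. (r \<odot>\<^bsub>V\<^esub> hd xs) # tl xs)),
         rsmult = (\<lambda>t r. induced H (\<lambda>xs. butlast xs @ [last xs \<triangleleft>\<^bsub>V\<^esub> r]) t)\<rparr>)"

definition tensor_algebra ::
  "('r, 'x) ring_scheme \<Rightarrow> ('r, 'v, 'y) bimodule_scheme \<Rightarrow> ('r \<times> ('v list \<Rightarrow>\<^sub>0 int) set) ring"
  where
  "tensor_algebra R V =
    (let T = tensor_powers R V
     in \<lparr>carrier = carrier R \<times> carrier T,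
         mult = (\<lambda>(r, s) (r', s').
                   (r \<otimes>\<^bsub>R\<^esub> r', (r \<odot>\<^bsub>T\<^esub> s') \<oplus>\<^bsub>T\<^esub> (s \<triangleleft>\<^bsub>T\<^esub> r') \<oplus>\<^bsub>T\<^esub> (s \<otimes>\<^bsub>T\<^esub> s'))),
         one = (\<one>\<^bsub>R\<^esub>, \<zero>\<^bsub>T\<^esub>), ring.zero = (\<zero>\<^bsub>R\<^esub>, \<zero>\<^bsub>T\<^esub>),
         add = (\<lambda>(r, s) (r', s'). (r \<oplus>\<^bsub>R\<^esub> r', s \<oplus>\<^bsub>T\<^esub> s'))\<rparr>)"


section \<open>The algebra \<open>B(\<Omega>\<^sup>1)\<close>\<close>

definition dual_bimodule ::
  "('k, 'a, 'y) module_scheme \<Rightarrow> ('a, 'w, 'z) bimodule_scheme \<Rightarrow> ('a, 'w \<Rightarrow> 'a) bimodule" where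
  "dual_bimodule A \<Omega> =
     \<lparr>carrier = {x \<in> carrier \<Omega> \<rightarrow>\<^sub>E carrier A.
         (\<forall>v \<in> carrier \<Omega>. \<forall>w \<in> carrier \<Omega>. x (v \<oplus>\<^bsub>\<Omega>\<^esub> w) = x v \<oplus>\<^bsub>A\<^esub> x w) \<and>
         (\<forall>w \<in> carrier \<Omega>. \<forall>a \<in> carrier A. x (w \<triangleleft>\<^bsub>\<Omega>\<^esub> a) = x w \<otimes>\<^bsub>A\<^esub> a)},
      mult = undefined, one = undefined,
      ring.zero = (\<lambda>w \<in> carrier \<Omega>. \<zero>\<^bsub>A\<^esub>),
      add = (\<lambda>x y. \<lambda>w \<in> carrier \<Omega>. x w \<oplus>\<^bsub>A\<^esub> y w),
      smult = (\<lambda>a x. \<lambda>w \<in> carrier \<Omega>. a \<otimes>\<^bsub>A\<^esub> x w),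
      rsmult = (\<lambda>x b. \<lambda>w \<in> carrier \<Omega>. x (b \<odot>\<^bsub>\<Omega>\<^esub> w))\<rparr>"

text \<open>The \<open>K\<close>-module underlying an \<open>A\<close>-bimodule, viewed as a \<open>K\<close>-bimodule.\<close>

definition restrict_scalars ::
  "('k, 'a, 'y) module_scheme \<Rightarrow> ('a, 'm, 'z) bimodule_scheme \<Rightarrow> ('k, 'm) bimodule" where
  "restrict_scalars A M = central_bimodule
     \<lparr>carrier = carrier M, mult = mult M, one = \<one>\<^bsub>M\<^esub>, ring.zero = \<zero>\<^bsub>M\<^esub>, add = add M,
      smult = (\<lambda>k m. (k \<odot>\<^bsub>A\<^esub> \<one>\<^bsub>A\<^esub>) \<odot>\<^bsub>M\<^esub> m)\<rparr>"

definition dual_pair_bimodule ::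
  "('k, 'x) ring_scheme \<Rightarrow> ('k, 'a, 'y) module_scheme \<Rightarrow> ('a, 'w, 'z) bimodule_scheme
    \<Rightarrow> (('a \<times> 'a \<Rightarrow>\<^sub>0 int) set, (('w \<Rightarrow> 'a) \<times> 'w \<Rightarrow>\<^sub>0 int) set) bimodule" where
  "dual_pair_bimodule K A \<Omega> =
    (let X = dual_bimodule A \<Omega>;
         G = tensor_group K (restrict_scalars A X) (restrict_scalars A \<Omega>);
         H = tensor_null K (restrict_scalars A X) (restrict_scalars A \<Omega>)
     in \<lparr>carrier = carrier G, mult = undefined, one = undefined, ring.zero = \<one>\<^bsub>G\<^esub>, add = mult G,
         smult = induced2 H (\<lambda>(a, a') (x, w). (a \<odot>\<^bsub>X\<^esub> x, w \<triangleleft>\<^bsub>\<Omega>\<^esub> a')),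
         rsmult = induced2 H (\<lambda>(x, w) (b, b'). (x \<triangleleft>\<^bsub>X\<^esub> b, b' \<odot>\<^bsub>\<Omega>\<^esub> w))\<rparr>)"

definition B_algebra ::
  "('k, 'x) ring_scheme \<Rightarrow> ('k, 'a, 'y) module_scheme \<Rightarrow> ('a, 'w, 'z) bimodule_scheme
    \<Rightarrow> (('a \<times> 'a \<Rightarrow>\<^sub>0 int) set \<times> ((('w \<Rightarrow> 'a) \<times> 'w \<Rightarrow>\<^sub>0 int) set list \<Rightarrow>\<^sub>0 int) set) ring" where
  "B_algebra K A \<Omega> = tensor_algebra (enveloping_algebra K A) (dual_pair_bimodule K A \<Omega>)"


section \<open>The two categories\<close>

text \<open>The \<open>K\<close>-action on a left module over a \<open>K\<close>-algebra is induced by the unit of the algebra, so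
  these modules and their homomorphisms are those of the underlying ring.

  For equality of records to be equality of modules, the operations of an object take a fixed
  value outside the carrier, and the unused fields \<open>mult\<close> and \<open>one\<close> a fixed value throughout. Each
  module structure on a set has exactly one representative of this kind.\<close>

definition strict_module ::
  "('r, 'x) ring_scheme \<Rightarrow> ('r, 'm, 'y) module_scheme \<Rightarrow> bool" where
  "strict_module R M \<longleftrightarrow> mult M = undefined \<and> one M = undefined \<and>
     (\<lambda>(x, y). x \<oplus>\<^bsub>M\<^esub> y) \<in> extensional (carrier M \<times> carrier M) \<and>
     (\<lambda>(r, x). r \<odot>\<^bsub>M\<^esub> x) \<in> extensional (carrier R \<times> carrier M)"

definition left_module_category ::
  "('r, 'x) ring_scheme \<Rightarrow> (('r, 'm) module, 'm \<Rightarrow> 'm) cat" where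
  "left_module_category R =
     \<lparr>Obj = {M. left_module R M \<and> strict_module R M},
      Hom = module_hom R,
      Id = (\<lambda>M. \<lambda>x \<in> carrier M. x),
      Comp = (\<lambda>M N P g f. compose (carrier M) g f)\<rparr>"

definition intertwined_bimodules ::
  "('k, 'x) ring_scheme \<Rightarrow> ('k, 'a, 'y) module_scheme \<Rightarrow> ('a, 'w) bimodule
    \<Rightarrow> (('a, 'm) bimodule \<times> (('m \<times> 'w \<Rightarrow>\<^sub>0 int) set \<Rightarrow> ('w \<times> 'm \<Rightarrow>\<^sub>0 int) set)) set" where
  "intertwined_bimodules K A \<Omega> =
     {(M, \<sigma>). algebra_bimodule K A M \<and>
        strict_module A M \<and> (\<lambda>(x, r). x \<triangleleft>\<^bsub>M\<^esub> r) \<in> extensional (carrier M \<times> carrier A) \<and>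
        \<sigma> \<in> bimodule_hom A (tensor_bimodule A M \<Omega>) (tensor_bimodule A \<Omega> M)}"

definition intertwined_hom ::
  "('k, 'a, 'y) module_scheme \<Rightarrow> ('a, 'w) bimodule
    \<Rightarrow> ('a, 'm) bimodule \<times> (('m \<times> 'w \<Rightarrow>\<^sub>0 int) set \<Rightarrow> ('w \<times> 'm \<Rightarrow>\<^sub>0 int) set)
    \<Rightarrow> ('a, 'm) bimodule \<times> (('m \<times> 'w \<Rightarrow>\<^sub>0 int) set \<Rightarrow> ('w \<times> 'm \<Rightarrow>\<^sub>0 int) set)
    \<Rightarrow> ('m \<Rightarrow> 'm) set" where
  "intertwined_hom A \<Omega> = (\<lambda>(M, \<sigma>\<^sub>M) (N, \<sigma>\<^sub>N).
     {f \<in> bimodule_hom A M N.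
        \<forall>t \<in> carrier (tensor_bimodule A M \<Omega>).
          \<sigma>\<^sub>N (tensor_map A N \<Omega> f id t) = tensor_map A \<Omega> N id f (\<sigma>\<^sub>M t)})"

definition intertwined_category ::
  "('k, 'x) ring_scheme \<Rightarrow> ('k, 'a, 'y) module_scheme \<Rightarrow> ('a, 'w) bimodule
    \<Rightarrow> (('a, 'm) bimodule \<times> (('m \<times> 'w \<Rightarrow>\<^sub>0 int) set \<Rightarrow> ('w \<times> 'm \<Rightarrow>\<^sub>0 int) set), 'm \<Rightarrow> 'm) cat"
  where
  "intertwined_category K A \<Omega> =
     \<lparr>Obj = intertwined_bimodules K A \<Omega>,
      Hom = intertwined_hom A \<Omega>,
      Id = (\<lambda>(M, \<sigma>). \<lambda>x \<in> carrier M. x),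
      Comp = (\<lambda>(M, \<sigma>\<^sub>M) N P g f. compose (carrier M) g f)\<rparr>"

end

theory Submission
  imports Defs
begin

text \<open>A left \<open>B(\<Omega>\<^sup>1)\<close>-module is an abelian group \<open>M\<close> on which the generators \<open>a b\<^sup>o\<^sup>p\<close> and \<open>(x, \<omega>)\<close> act
  subject to the relations of the tensor algebra. The former make \<open>M\<close> an \<open>A\<close>-bimodule; the latter are a family
  of operators \<open>\<rho>(x, \<omega>)\<close> on \<open>M\<close>. For a dual basis \<open>(s, e\<^sub>s)\<close> of the right module \<open>\<Omega>\<^sup>1\<close>, the formulas
  \<open>\<sigma>(m \<otimes> \<omega>) = \<Sum>\<^sub>s s \<otimes> \<rho>(e\<^sub>s, \<omega>) m\<close> and \<open>\<rho>(x, \<omega>) m = (x \<otimes> id) \<sigma>(m \<otimes> \<omega>)\<close> are mutually inverse and translate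
  the relations on \<open>\<rho>\<close> into bilinearity of \<open>\<sigma>\<close>. On morphisms both functors are the identity, since a
  bimodule map commutes with all \<open>\<rho>(x, \<omega>)\<close> exactly when it intertwines the maps \<open>\<sigma>\<close>.\<close>

section \<open>Presented abelian groups\<close>

text \<open>The dual basis comes from lifting the identity of \<Omega> through the free module on a
  finite generating set: e_s is the s-th coordinate of the lift. It yields two expansions, x = sum
  of x(s) e_s in the dual and t = sum of s \<otimes> e_s(t) in \<Omega> \<otimes> M. By the second
  one the e_s separate the elements of \<Omega> \<otimes> M, so \<sigma> can be recovered from
  \<rho>. Left linearity of \<sigma> is the delicate point: a s need not lie in the generating set,
  so a \<sigma>(m \<otimes> w) has to be expanded anew.

  Tensor products are sets of cosets of formal integer combinations. Each structure map must be
  shown to send cosets to single cosets, and each identity is checked on generators; one treatment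
  of presented groups serves the balanced products, the enveloping algebra and the tensor powers
  alike.

  An isomorphism, as opposed to an equivalence, needs the composites to be equal as records. Both
  constructions therefore keep carrier, addition and zero, and return \<open>undefined\<close> off
  the carriers, as strict objects do.\<close>

text \<open>Maps are constrained only on the carrier, unlike in \<open>module_hom\<close>, so that
  lambda terms for composites and sums are additive without being restricted.\<close>

definition add_hom :: "('a, 'x) ring_scheme \<Rightarrow> ('b, 'y) ring_scheme \<Rightarrow> ('a \<Rightarrow> 'b) set" where
  "add_hom M N = {f \<in> carrier M \<rightarrow> carrier N.
     \<forall>x \<in> carrier M. \<forall>y \<in> carrier M. f (x \<oplus>\<^bsub>M\<^esub> y) = f x \<oplus>\<^bsub>N\<^esub> f y}"

lemma add_homI:
  assumes "\<And>x. x \<in> carrier M \<Longrightarrow> f x \<in> carrier N"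
    and "\<And>x y. \<lbrakk>x \<in> carrier M; y \<in> carrier M\<rbrakk> \<Longrightarrow> f (x \<oplus>\<^bsub>M\<^esub> y) = f x \<oplus>\<^bsub>N\<^esub> f y"
  shows "f \<in> add_hom M N"
  using assms by (auto simp: add_hom_def)

lemma add_hom_closed: "\<lbrakk>f \<in> add_hom M N; x \<in> carrier M\<rbrakk> \<Longrightarrow> f x \<in> carrier N"
  by (auto simp: add_hom_def)

lemma add_hom_add:
  "\<lbrakk>f \<in> add_hom M N; x \<in> carrier M; y \<in> carrier M\<rbrakk> \<Longrightarrow> f (x \<oplus>\<^bsub>M\<^esub> y) = f x \<oplus>\<^bsub>N\<^esub> f y"
  by (auto simp: add_hom_def)

lemma add_hom_group_hom:
  assumes "abelian_group M" "abelian_group N" "f \<in> add_hom M N"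
  shows "group_hom (add_monoid M) (add_monoid N) f"
proof -
  interpret M: abelian_group M by fact
  interpret N: abelian_group N by fact
  show ?thesis
    using assms(3) M.a_group N.a_group
    by (auto simp: group_hom_def group_hom_axioms_def hom_def add_hom_def)
qed

lemma add_hom_zero:
  assumes "abelian_group M" "abelian_group N" "f \<in> add_hom M N"
  shows "f \<zero>\<^bsub>M\<^esub> = \<zero>\<^bsub>N\<^esub>"
  using group_hom.hom_one [OF add_hom_group_hom [OF assms]] by simp

lemma add_hom_inv:
  assumes "abelian_group M" "abelian_group N" "f \<in> add_hom M N" "x \<in> carrier M"
  shows "f (\<ominus>\<^bsub>M\<^esub> x) = \<ominus>\<^bsub>N\<^esub> f x"
  using group_hom.hom_inv [OF add_hom_group_hom [OF assms(1-3)], of x] assms(4)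
  by (simp add: a_inv_def)

lemma add_hom_comp:
  "\<lbrakk>f \<in> add_hom M N; g \<in> add_hom N P\<rbrakk> \<Longrightarrow> (\<lambda>x. g (f x)) \<in> add_hom M P"
  by (auto simp: add_hom_def Pi_iff)

lemma add_hom_id: "(\<lambda>x. x) \<in> add_hom M M"
  by (auto simp: add_hom_def)

lemma add_hom_plus:
  assumes "abelian_group N" "f \<in> add_hom M N" "g \<in> add_hom M N"
  shows "(\<lambda>x. f x \<oplus>\<^bsub>N\<^esub> g x) \<in> add_hom M N"
proof -
  interpret N: abelian_group N by fact
  show ?thesis
    using assms(2,3) by (auto simp: add_hom_def Pi_iff N.a_ac)
qed

lemma add_hom_finsum:
  assumes "abelian_group N" and f: "\<And>i. i \<in> I \<Longrightarrow> f i \<in> add_hom M N"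
  shows "(\<lambda>x. \<Oplus>\<^bsub>N\<^esub>i\<in>I. f i x) \<in> add_hom M N"
proof -
  interpret N: abelian_group N by fact
  show ?thesis
  proof (rule add_homI)
    show "(\<Oplus>\<^bsub>N\<^esub>i\<in>I. f i x) \<in> carrier N" if "x \<in> carrier M" for x
      using that by (intro N.finsum_closed Pi_I add_hom_closed [OF f])
    show "(\<Oplus>\<^bsub>N\<^esub>i\<in>I. f i (x \<oplus>\<^bsub>M\<^esub> y)) = (\<Oplus>\<^bsub>N\<^esub>i\<in>I. f i x) \<oplus>\<^bsub>N\<^esub> (\<Oplus>\<^bsub>N\<^esub>i\<in>I. f i y)"
      if "x \<in> carrier M" "y \<in> carrier M" for x y
    proof -
      have "(\<Oplus>\<^bsub>N\<^esub>i\<in>I. f i (x \<oplus>\<^bsub>M\<^esub> y)) = (\<Oplus>\<^bsub>N\<^esub>i\<in>I. f i x \<oplus>\<^bsub>N\<^esub> f i y)"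
        using that
        by (intro N.finsum_cong' Pi_I N.add.m_closed add_hom_closed [OF f] add_hom_add [OF f] refl)
      also have "\<dots> = (\<Oplus>\<^bsub>N\<^esub>i\<in>I. f i x) \<oplus>\<^bsub>N\<^esub> (\<Oplus>\<^bsub>N\<^esub>i\<in>I. f i y)"
        using that by (intro N.finsum_addf Pi_I add_hom_closed [OF f])
      finally show ?thesis .
    qed
  qed
qed

lemma finsum_add_hom:
  assumes "abelian_group M" "abelian_group N" "f \<in> add_hom M N" and g: "g \<in> I \<rightarrow> carrier M"
  shows "f (\<Oplus>\<^bsub>M\<^esub>i\<in>I. g i) = (\<Oplus>\<^bsub>N\<^esub>i\<in>I. f (g i))"
proof -
  interpret M: abelian_group M by fact
  interpret N: abelian_group N by fact
  show ?thesis using g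
  proof (induction I rule: infinite_finite_induct)
    case (insert i I)
    then have "f (\<Oplus>\<^bsub>M\<^esub>i\<in>insert i I. g i) = f (g i \<oplus>\<^bsub>M\<^esub> (\<Oplus>\<^bsub>M\<^esub>i\<in>I. g i))"
      by (subst M.finsum_insert) auto
    also have "\<dots> = f (g i) \<oplus>\<^bsub>N\<^esub> f (\<Oplus>\<^bsub>M\<^esub>i\<in>I. g i)"
      using insert by (intro add_hom_add [OF assms(3)] M.finsum_closed) auto
    also have "\<dots> = (\<Oplus>\<^bsub>N\<^esub>i\<in>insert i I. f (g i))"
      using insert by (subst N.finsum_insert) (auto intro: add_hom_closed [OF assms(3)])
    finally show ?case .
  \<comment> \<open>Over an infinite index set both sums are zero by convention, so this case also
    rests on \<open>f\<close> preserving zero.\<close>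
  qed (auto simp: add_hom_zero [OF assms(1-3)])
qed

section \<open>Quotients of free abelian groups by relations\<close>

abbreviation relspan :: "'p set \<Rightarrow> ('p \<Rightarrow>\<^sub>0 int) set \<Rightarrow> ('p \<Rightarrow>\<^sub>0 int) set" where
  "relspan S Rel \<equiv> generate (free_Abelian_group S) Rel"

abbreviation coset ::
  "'p set \<Rightarrow> ('p \<Rightarrow>\<^sub>0 int) set \<Rightarrow> ('p \<Rightarrow>\<^sub>0 int) \<Rightarrow> ('p \<Rightarrow>\<^sub>0 int) set" where
  "coset S Rel c \<equiv> relspan S Rel #>\<^bsub>free_Abelian_group S\<^esub> c"

definition gen :: "'p set \<Rightarrow> ('p \<Rightarrow>\<^sub>0 int) set \<Rightarrow> 'p \<Rightarrow> ('p \<Rightarrow>\<^sub>0 int) set" where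
  "gen S Rel p =
     coset S Rel (frag_of p)"

text \<open>Only carrier, addition and zero are compared with the quotient. The products and actions
  in the other fields stay free, so one notion fits tensor products, the enveloping algebra and the
  tensor powers.\<close>

definition presents ::
  "(('p \<Rightarrow>\<^sub>0 int) set, 'x) ring_scheme \<Rightarrow> 'p set \<Rightarrow> ('p \<Rightarrow>\<^sub>0 int) set \<Rightarrow> bool" where
  "presents N S Rel \<longleftrightarrow> Rel \<subseteq> carrier (free_Abelian_group S) \<and>
     (let Q = free_Abelian_group S Mod relspan S Rel
      in carrier N = carrier Q \<and> add N = mult Q \<and> \<zero>\<^bsub>N\<^esub> = \<one>\<^bsub>Q\<^esub>)"

text \<open>A homomorphism on a free abelian group is determined by its values on generators, so the
  quantified \<open>h\<close> is just the additive extension of \<open>f\<close>. Quantifying avoids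
  a formula for that extension, whose target is an arbitrary group record.\<close>

definition compatible ::
  "'p set \<Rightarrow> ('p \<Rightarrow>\<^sub>0 int) set \<Rightarrow> ('b, 'y) ring_scheme \<Rightarrow> ('p \<Rightarrow> 'b) \<Rightarrow> bool" where
  "compatible S Rel G f \<longleftrightarrow> f \<in> S \<rightarrow> carrier G \<and>
     (\<forall>h \<in> hom (free_Abelian_group S) (add_monoid G).
        (\<forall>p \<in> S. h (frag_of p) = f p) \<longrightarrow> (\<forall>r \<in> Rel. h r = \<zero>\<^bsub>G\<^esub>))"

lemma keys_add_subset:
  "\<lbrakk>Poly_Mapping.keys c \<subseteq> S; Poly_Mapping.keys d \<subseteq> S\<rbrakk> \<Longrightarrow> Poly_Mapping.keys (c + d) \<subseteq> S"
  using keys_add [of c d] by blast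

lemma keys_diff_subset:
  "\<lbrakk>Poly_Mapping.keys c \<subseteq> S; Poly_Mapping.keys d \<subseteq> S\<rbrakk> \<Longrightarrow> Poly_Mapping.keys (c - d) \<subseteq> S"
  for c d :: "'a \<Rightarrow>\<^sub>0 int"
  using keys_diff [of c d] by blast

lemma keys_frag_extend_of:
  assumes "Poly_Mapping.keys c \<subseteq> S" "f \<in> S \<rightarrow> S'"
  shows "Poly_Mapping.keys (frag_extend (\<lambda>p. frag_of (f p)) c) \<subseteq> S'"
proof -
  have "(\<Union>p \<in> Poly_Mapping.keys c. Poly_Mapping.keys (frag_of (f p))) \<subseteq> S'"
    using assms by auto
  then show ?thesis using keys_frag_extend by (rule order_trans [rotated])
qed

context
  fixes N :: "(('p \<Rightarrow>\<^sub>0 int) set, 'x) ring_scheme" and S Rel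
  assumes N: "presents N S Rel"
begin

private abbreviation "FS \<equiv> free_Abelian_group S"
private abbreviation "H \<equiv> relspan S Rel"
private abbreviation "cls c \<equiv> coset S Rel c"

lemma presents_subgroup: "subgroup H FS"
  using N by (intro group.generate_is_subgroup) (auto simp: presents_def)

lemma null_keys: "r \<in> H \<Longrightarrow> Poly_Mapping.keys r \<subseteq> S"
  using subgroup.subset [OF presents_subgroup] by (metis carrier_free_Abelian_group_iff subsetD)

lemma presents_carrier: "carrier N = cls ` carrier FS"
  using N by (simp add: presents_def carrier_FactGroup)

lemma presents_cls_closed: "Poly_Mapping.keys c \<subseteq> S \<Longrightarrow> cls c \<in> carrier N"
  by (auto simp: presents_carrier)

lemma presents_cases:
  assumes "x \<in> carrier N"
  obtains c where "Poly_Mapping.keys c \<subseteq> S" "x = cls c"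
  using assms by (auto simp: presents_carrier)

lemma presents_normal: "H \<lhd> FS"
  using presents_subgroup comm_group.normal_iff_subgroup abelian_free_Abelian_group by blast

lemma presents_add:
  "\<lbrakk>Poly_Mapping.keys c \<subseteq> S; Poly_Mapping.keys d \<subseteq> S\<rbrakk> \<Longrightarrow> cls c \<oplus>\<^bsub>N\<^esub> cls d = cls (c + d)"
  using N normal.rcos_sum [OF presents_normal, of c d] by (simp add: presents_def)

lemma presents_zero: "\<zero>\<^bsub>N\<^esub> = cls 0"
proof -
  have "0 \<in> H"
    using subgroup.one_closed [OF presents_subgroup] by simp
  then have "cls 0 = H"
    using group.coset_join2 [OF group_free_Abelian_group _ presents_subgroup, of 0] by simp
  then show ?thesis
    using N by (simp add: presents_def)
qed

lemma presents_cls_eq: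
  assumes "Poly_Mapping.keys c \<subseteq> S"
  shows "cls c = \<zero>\<^bsub>N\<^esub> \<longleftrightarrow> c \<in> H"
proof
  assume "cls c = \<zero>\<^bsub>N\<^esub>"
  then have "cls c = H" using N by (simp add: presents_def)
  then show "c \<in> H"
    using group.coset_join1 [OF group_free_Abelian_group _ _ presents_subgroup] assms by auto
next
  assume "c \<in> H"
  then have "cls c = H"
    using group.coset_join2 [OF group_free_Abelian_group _ presents_subgroup, of c] assms by simp
  then show "cls c = \<zero>\<^bsub>N\<^esub>" using N by (simp add: presents_def)
qed

lemma presents_abelian_group: "abelian_group N"
proof (rule abelian_groupI)
  show "\<exists>y \<in> carrier N. y \<oplus>\<^bsub>N\<^esub> x = \<zero>\<^bsub>N\<^esub>" if x: "x \<in> carrier N" for x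
  proof -
    obtain c where "Poly_Mapping.keys c \<subseteq> S" "x = cls c"
      using x by (auto simp: presents_carrier)
    then have "cls (- c) \<in> carrier N" "cls (- c) \<oplus>\<^bsub>N\<^esub> x = \<zero>\<^bsub>N\<^esub>"
      by (auto simp: presents_cls_closed presents_add presents_zero)
    then show ?thesis by blast
  qed
  show "x \<oplus>\<^bsub>N\<^esub> y \<in> carrier N" if x: "x \<in> carrier N" and y: "y \<in> carrier N" for x y
  proof -
    obtain a where "Poly_Mapping.keys a \<subseteq> S" "x = cls a"
      using x by (rule presents_cases)
    moreover obtain b where "Poly_Mapping.keys b \<subseteq> S" "y = cls b"
      using y by (rule presents_cases)
    ultimately show ?thesis
      by (simp add: presents_add keys_add_subset presents_cls_closed)
  qed
  show "x \<oplus>\<^bsub>N\<^esub> y \<oplus>\<^bsub>N\<^esub> z = x \<oplus>\<^bsub>N\<^esub> (y \<oplus>\<^bsub>N\<^esub> z)"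
    if x: "x \<in> carrier N" and y: "y \<in> carrier N" and z: "z \<in> carrier N" for x y z
  proof -
    obtain a where "Poly_Mapping.keys a \<subseteq> S" "x = cls a"
      using x by (rule presents_cases)
    moreover obtain b where "Poly_Mapping.keys b \<subseteq> S" "y = cls b"
      using y by (rule presents_cases)
    moreover obtain c where "Poly_Mapping.keys c \<subseteq> S" "z = cls c"
      using z by (rule presents_cases)
    ultimately show ?thesis
      by (simp add: presents_add keys_add_subset add.assoc)
  qed
  show "x \<oplus>\<^bsub>N\<^esub> y = y \<oplus>\<^bsub>N\<^esub> x" if "x \<in> carrier N" "y \<in> carrier N" for x y
    using that by (auto simp: presents_carrier presents_add add.commute)
qed (auto simp: presents_zero presents_cls_closed presents_carrier presents_add)

lemma presents_inv:
  assumes "Poly_Mapping.keys c \<subseteq> S"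
  shows "cls (- c) = \<ominus>\<^bsub>N\<^esub> cls c"
proof -
  interpret N: abelian_group N by (rule presents_abelian_group)
  have "cls (- c) \<oplus>\<^bsub>N\<^esub> cls c = \<zero>\<^bsub>N\<^esub>"
    using assms by (simp add: presents_add presents_zero)
  then show ?thesis
    using assms by (simp add: N.minus_equality presents_cls_closed)
qed

lemma gen_closed: "p \<in> S \<Longrightarrow> gen S Rel p \<in> carrier N"
  by (simp add: gen_def presents_cls_closed)

text \<open>The induction rule for free abelian groups works with differences. Splitting these into
  sums and negatives suits the ring-style notation of the quotient.\<close>

lemma presents_induct [consumes 1, case_names zero gen add inv]:
  assumes "t \<in> carrier N" and "P \<zero>\<^bsub>N\<^esub>" and "\<And>p. p \<in> S \<Longrightarrow> P (gen S Rel p)"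
    and add: "\<And>s t. \<lbrakk>s \<in> carrier N; t \<in> carrier N; P s; P t\<rbrakk> \<Longrightarrow> P (s \<oplus>\<^bsub>N\<^esub> t)"
    and inv: "\<And>s. \<lbrakk>s \<in> carrier N; P s\<rbrakk> \<Longrightarrow> P (\<ominus>\<^bsub>N\<^esub> s)"
  shows "P t"
proof -
  obtain c where c: "Poly_Mapping.keys c \<subseteq> S" "t = cls c"
    using assms(1) by (auto simp: presents_carrier)
  have "P (cls c)"
    using c(1)
  proof (rule free_Abelian_group_induct)
    show "P (cls (x - y))"
      if "Poly_Mapping.keys x \<subseteq> S" "Poly_Mapping.keys y \<subseteq> S" "P (cls x)" "P (cls y)" for x y
    proof -
      have "cls (x - y) = cls x \<oplus>\<^bsub>N\<^esub> cls (- y)"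
        using that by (simp add: presents_add)
      also have "cls (- y) = \<ominus>\<^bsub>N\<^esub> cls y"
        using that by (simp add: presents_inv)
      finally show ?thesis
        using that
        by (simp add: add inv presents_cls_closed abelian_group.a_inv_closed [OF presents_abelian_group])
    qed
  qed (use assms in \<open>auto simp: presents_zero gen_def\<close>)
  then show ?thesis using c by simp
qed

text \<open>This is the uniqueness half of the universal property. Nearly every later identity
  between operations on tensor products or tensor powers is reduced by it to pure tensors or
  words.\<close>

lemma add_hom_eqI:
  assumes G: "abelian_group G" and f: "f \<in> add_hom N G" and g: "g \<in> add_hom N G"
    and eq: "\<And>p. p \<in> S \<Longrightarrow> f (gen S Rel p) = g (gen S Rel p)" and t: "t \<in> carrier N"
  shows "f t = g t"
  using t
proof (induction rule: presents_induct)
  case zero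
  then show ?case using add_hom_zero presents_abelian_group G f g by metis
next
  case (gen p)
  then show ?case by (rule eq)
next
  case (add s t)
  then show ?case by (simp add: add_hom_add [OF f] add_hom_add [OF g])
next
  case (inv s)
  then show ?case
    using f g by (simp add: add_hom_inv [OF presents_abelian_group G])
qed

text \<open>The kernel of \<open>h\<close> is a subgroup containing every relator, hence it contains
  the subgroup that they generate; the induction follows the generation of that subgroup.\<close>

lemma compatible_generate:
  assumes G: "abelian_group G" and f: "compatible S Rel G f"
    and h: "h \<in> hom FS (add_monoid G)" "\<And>p. p \<in> S \<Longrightarrow> h (frag_of p) = f p" and c: "c \<in> H"
  shows "h c = \<zero>\<^bsub>G\<^esub>"
proof -
  interpret G: abelian_group G by fact
  interpret h: group_hom FS "add_monoid G" h
    using h(1) G.a_group by (simp add: group_hom_def group_hom_axioms_def)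
  have Rel: "Rel \<subseteq> carrier FS"
    using N by (simp add: presents_def)
  have r: "h r = \<zero>\<^bsub>G\<^esub>" if "r \<in> Rel" for r
    using f h that by (auto simp: compatible_def)
  show ?thesis using c
  proof (induction rule: generate.induct)
    case one
    then show ?case using h.hom_one by simp
  next
    case (incl r)
    then show ?case by (rule r)
  next
    case (inv r)
    have "h (inv\<^bsub>FS\<^esub> r) = inv\<^bsub>add_monoid G\<^esub> h r"
      using inv Rel by (intro h.hom_inv) (rule subsetD)
    then show ?case
      using r [OF inv] G.add.inv_one by simp
  next
    case (eng a b)
    have "a \<in> carrier FS" "b \<in> carrier FS"
      using eng null_keys by auto
    then have "h (a \<otimes>\<^bsub>FS\<^esub> b) = h a \<oplus>\<^bsub>G\<^esub> h b"
      using h.hom_mult [of a b] by simp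
    then show ?case using eng by simp
  qed
qed

text \<open>Existence half of the universal property: freeness extends \<open>f\<close> to
  \<open>h\<close>, two representatives of one coset differ by an element that \<open>h\<close>
  kills, and so \<open>h\<close> descends to the quotient.\<close>

lemma lift_exists:
  assumes G: "abelian_group G" and f: "compatible S Rel G f"
  shows "\<exists>g \<in> add_hom N G. \<forall>p \<in> S. g (gen S Rel p) = f p"
proof -
  interpret G: abelian_group G by fact
  obtain h where h: "h \<in> hom FS (add_monoid G)" "\<And>p. p \<in> S \<Longrightarrow> h (frag_of p) = f p"
    using comm_group.free_Abelian_group_universal [OF G.a_comm_group, of f S] f
    by (auto simp: compatible_def)
  interpret h: group_hom FS "add_monoid G" h
    using h(1) G.a_group by (simp add: group_hom_def group_hom_axioms_def)
  have eq: "h x = h y"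
    if x: "Poly_Mapping.keys x \<subseteq> S" and y: "Poly_Mapping.keys y \<subseteq> S" and xy: "cls x = cls y" for x y
  proof -
    have "cls (x - y) = cls x \<oplus>\<^bsub>N\<^esub> cls (- y)"
      using x y by (simp add: presents_add)
    also have "\<dots> = cls (y + - y)"
      unfolding xy using y by (intro presents_add) auto
    also have "\<dots> = \<zero>\<^bsub>N\<^esub>"
      by (simp add: presents_zero)
    finally have "x - y \<in> H"
      using x y by (simp add: presents_cls_eq keys_diff_subset)
    then have *: "h (x - y) = \<zero>\<^bsub>G\<^esub>"
      by (rule compatible_generate [OF G f h(1), rotated]) (rule h(2))
    have "h x = h ((x - y) + y)" by simp
    also have "\<dots> = h (x - y) \<oplus>\<^bsub>G\<^esub> h y"
      using h.hom_mult [of "x - y" y] that by (simp add: keys_diff_subset)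
    finally show ?thesis
      using * h.hom_closed [of y] that by simp
  qed
  obtain g where g: "g \<in> hom (FS Mod H) (add_monoid G)" "\<And>x. x \<in> carrier FS \<Longrightarrow> g (cls x) = h x"
    using FactGroup_universal [OF h(1) presents_normal] eq by (metis carrier_free_Abelian_group_iff)
  have "g \<in> add_hom N G"
    using g(1) N by (simp add: presents_def add_hom_def hom_def)
  moreover have "g (gen S Rel p) = f p" if "p \<in> S" for p
    using that g(2) [of "frag_of p"] h(2) by (simp add: gen_def)
  ultimately show ?thesis by blast
qed

end

text \<open>The choice is harmless: on the carrier the map is unique by \<open>add_hom_eqI\<close>,
  and off the carrier its values are never consulted.\<close>

definition lift ::
  "'p set \<Rightarrow> ('p \<Rightarrow>\<^sub>0 int) set \<Rightarrow> (('p \<Rightarrow>\<^sub>0 int) set, 'x) ring_scheme \<Rightarrow> ('b, 'y) ring_scheme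
    \<Rightarrow> ('p \<Rightarrow> 'b) \<Rightarrow> ('p \<Rightarrow>\<^sub>0 int) set \<Rightarrow> 'b" where
  "lift S Rel N G f = (SOME g. g \<in> add_hom N G \<and> (\<forall>p \<in> S. g (gen S Rel p) = f p))"

lemma
  assumes "presents N S Rel" "abelian_group G" "compatible S Rel G f"
  shows lift_add_hom: "lift S Rel N G f \<in> add_hom N G"
    and lift_gen: "p \<in> S \<Longrightarrow> lift S Rel N G f (gen S Rel p) = f p"
proof -
  have "\<exists>g. g \<in> add_hom N G \<and> (\<forall>p \<in> S. g (gen S Rel p) = f p)"
    using lift_exists [OF assms] by blast
  then have "lift S Rel N G f \<in> add_hom N G \<and> (\<forall>p \<in> S. lift S Rel N G f (gen S Rel p) = f p)"
    unfolding lift_def by (rule someI_ex)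
  then show "lift S Rel N G f \<in> add_hom N G" "p \<in> S \<Longrightarrow> lift S Rel N G f (gen S Rel p) = f p"
    by auto
qed

section \<open>Maps between quotients induced by maps of generators\<close>

lemma frag_extend_gen:
  assumes N: "presents N S Rel" and N': "presents N' S' Rel'" and f: "f \<in> S \<rightarrow> S'"
  defines "h \<equiv> \<lambda>c. coset S' Rel' (frag_extend (\<lambda>p. frag_of (f p)) c)"
  shows "h \<in> hom (free_Abelian_group S) (add_monoid N')"
    and "h (frag_of p) = gen S' Rel' (f p)"
proof -
  note k = keys_frag_extend_of [OF _ f]
  show "h \<in> hom (free_Abelian_group S) (add_monoid N')"
    by (auto simp: hom_def h_def frag_extend_add presents_add [OF N'] k intro!: presents_cls_closed [OF N'] del: subsetI)
  show "h (frag_of p) = gen S' Rel' (f p)"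
    by (simp add: h_def gen_def)
qed

text \<open>The extension of \<open>f\<close> followed by the projection onto \<open>N'\<close> is a
  homomorphism with the prescribed values on generators, so compatibility makes it vanish on the
  span of the relators.\<close>

lemma frag_extend_null:
  assumes N: "presents N S Rel" and N': "presents N' S' Rel'" and f: "f \<in> S \<rightarrow> S'"
    and c: "compatible S Rel N' (\<lambda>p. gen S' Rel' (f p))"
    and r: "r \<in> relspan S Rel"
  shows "frag_extend (\<lambda>p. frag_of (f p)) r \<in> relspan S' Rel'"
proof -
  have "Poly_Mapping.keys r \<subseteq> S"
    using N r by (rule null_keys)
  then have "Poly_Mapping.keys (frag_extend (\<lambda>p. frag_of (f p)) r) \<subseteq> S'"
    using f by (rule keys_frag_extend_of)
  moreover have "coset S' Rel' (frag_extend (\<lambda>p. frag_of (f p)) r) = \<zero>\<^bsub>N'\<^esub>"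
    using compatible_generate [OF N presents_abelian_group [OF N'] c frag_extend_gen [OF N N' f] r] .
  ultimately show ?thesis
    using presents_cls_eq [OF N'] by blast
qed

text \<open>Shaped for \<open>induced\<close> and \<open>induced2\<close>, whose values are sets of
  sums: all members must differ from \<open>c\<close> by relators, and all translates of
  \<open>c\<close> by relators must occur.\<close>

lemma coset_eqI:
  assumes N: "presents N S Rel" and c: "Poly_Mapping.keys c \<subseteq> S"
    and sub: "\<And>x. x \<in> T \<Longrightarrow> x - c \<in> relspan S Rel"
    and all: "\<And>h. h \<in> relspan S Rel \<Longrightarrow> h + c \<in> T"
  shows "T = coset S Rel c"
proof -
  have "x \<in> coset S Rel c" if "x \<in> T" for x
    using sub [OF that] unfolding r_coset_def by (auto intro!: bexI [of _ "x - c"])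
  then show ?thesis
    using all by (auto simp: r_coset_def)
qed

lemma null_closed:
  assumes N: "presents N S Rel" and "a \<in> relspan S Rel"
    "b \<in> relspan S Rel"
  shows "a + b \<in> relspan S Rel" "0 \<in> relspan S Rel"
  using subgroup.m_closed [OF presents_subgroup [OF N], of a b] assms
    subgroup.one_closed [OF presents_subgroup [OF N]] by auto

text \<open>\<open>induced\<close> gathers the images of all representatives. They differ by images
  of relators, which are relators of the target and are absorbed by the summand from the target's
  relation subgroup; a single coset remains.\<close>

lemma induced_cls:
  assumes N: "presents N S Rel" and N': "presents N' S' Rel'" and f: "f \<in> S \<rightarrow> S'"
    and c: "compatible S Rel N' (\<lambda>p. gen S' Rel' (f p))" and k: "Poly_Mapping.keys c \<subseteq> S"
  shows "induced (relspan S' Rel') f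
           (coset S Rel c) =
         coset S' Rel' (frag_extend (\<lambda>p. frag_of (f p)) c)"
proof (rule coset_eqI [OF N'])
  show "Poly_Mapping.keys (frag_extend (\<lambda>p. frag_of (f p)) c) \<subseteq> S'"
    using k f by (rule keys_frag_extend_of)
  show "x - frag_extend (\<lambda>p. frag_of (f p)) c \<in> relspan S' Rel'"
    if x: "x \<in> induced (relspan S' Rel') f
       (coset S Rel c)" for x
  proof -
    obtain h r where hr: "h \<in> relspan S' Rel'"
      "r \<in> relspan S Rel"
      "x = h + frag_extend (\<lambda>p. frag_of (f p)) (r + c)"
      using x by (fastforce simp: induced_def r_coset_def)
    then show ?thesis
      using null_closed(1) [OF N' _ frag_extend_null [OF N N' f c]] by (simp add: frag_extend_add)
  qed
  show "h + frag_extend (\<lambda>p. frag_of (f p)) c \<in> induced (relspan S' Rel') f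
       (coset S Rel c)"
    if "h \<in> relspan S' Rel'" for h
  proof -
    have "0 \<in> relspan S Rel"
      using generate.one [of "free_Abelian_group S" Rel] by simp
    then have "c \<in> coset S Rel c"
      by (force simp: r_coset_def)
    then show ?thesis
      using that unfolding induced_def by blast
  qed
qed

lemma
  assumes N: "presents N S Rel" and N': "presents N' S' Rel'" and f: "f \<in> S \<rightarrow> S'"
    and c: "compatible S Rel N' (\<lambda>p. gen S' Rel' (f p))"
  shows induced_add_hom: "induced (relspan S' Rel') f \<in> add_hom N N'"
    and induced_gen: "p \<in> S \<Longrightarrow> induced (relspan S' Rel') f (gen S Rel p)
                        = gen S' Rel' (f p)"
proof -
  note k = keys_frag_extend_of [OF _ f]
  show "induced (relspan S' Rel') f \<in> add_hom N N'"
    by (rule add_homI)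
      (auto simp: presents_carrier [OF N] induced_cls [OF assms] k presents_add [OF N] keys_add_subset
         presents_add [OF N'] frag_extend_add intro!: presents_cls_closed [OF N'] del: subsetI)
  show "p \<in> S \<Longrightarrow> induced (relspan S' Rel') f (gen S Rel p) = gen S' Rel' (f p)"
    using induced_cls [OF assms, of "frag_of p"] by (simp add: gen_def)
qed

section \<open>Biadditive operations on quotients\<close>

text \<open>Either variable may be extended first. A relator in one slot can thus be handled by
  fixing a generator in the other slot and using the one-variable theory.\<close>

lemma frag_extend_swap:
  "frag_extend (\<lambda>p. frag_extend (\<lambda>q. f p q) d) c = frag_extend (\<lambda>q. frag_extend (\<lambda>p. f p q) c) d"
proof -
  have c: "Poly_Mapping.keys c \<subseteq> UNIV" by simp
  show ?thesis using c
  proof (induction c rule: frag_induction)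
    case zero
    then show ?case by (simp add: frag_extend_eq_0)
  next
    case (diff a b)
    have d: "Poly_Mapping.keys d \<subseteq> UNIV" by simp
    have "frag_extend (\<lambda>q. frag_extend (\<lambda>p. f p q) a - frag_extend (\<lambda>p. f p q) b) d =
      frag_extend (\<lambda>q. frag_extend (\<lambda>p. f p q) a) d - frag_extend (\<lambda>q. frag_extend (\<lambda>p. f p q) b) d"
      using d by (induction d rule: frag_induction) (simp_all add: frag_extend_diff)
    then show ?case using diff by (simp add: frag_extend_diff)
  qed simp
qed

context
  fixes N :: "(('p \<Rightarrow>\<^sub>0 int) set, 'x) ring_scheme" and S Rel
    and N' :: "(('q \<Rightarrow>\<^sub>0 int) set, 'y) ring_scheme" and S' Rel'
    and N'' :: "(('r \<Rightarrow>\<^sub>0 int) set, 'z) ring_scheme" and S'' Rel'' and f :: "'p \<Rightarrow> 'q \<Rightarrow> 'r"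
  assumes N: "presents N S Rel" and N': "presents N' S' Rel'" and N'': "presents N'' S'' Rel''"
    and f: "\<And>p q. \<lbrakk>p \<in> S; q \<in> S'\<rbrakk> \<Longrightarrow> f p q \<in> S''"
    and cl: "\<And>q. q \<in> S' \<Longrightarrow> compatible S Rel N'' (\<lambda>p. gen S'' Rel'' (f p q))"
    and cr: "\<And>p. p \<in> S \<Longrightarrow> compatible S' Rel' N'' (\<lambda>q. gen S'' Rel'' (f p q))"
begin

private abbreviation "null1 \<equiv> relspan S Rel"
private abbreviation "null2 \<equiv> relspan S' Rel'"
private abbreviation "null3 \<equiv> relspan S'' Rel''"
private definition "ext c d = frag_extend (\<lambda>p. frag_extend (\<lambda>q. frag_of (f p q)) d) c"

private lemma ext_add_left: "ext (a + b) d = ext a d + ext b d"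
  by (simp add: ext_def frag_extend_add)

private lemma ext_swap: "ext c d = frag_extend (\<lambda>q. frag_extend (\<lambda>p. frag_of (f p q)) c) d"
  unfolding ext_def by (rule frag_extend_swap)

private lemma ext_add_right: "ext c (a + b) = ext c a + ext c b"
  by (simp add: ext_swap frag_extend_add)

private lemma null_diff: "\<lbrakk>a \<in> null3; b \<in> null3\<rbrakk> \<Longrightarrow> a - b \<in> null3"
  using subgroup.m_inv_closed [OF presents_subgroup [OF N''], of b]
    null_closed(1) [OF N'', of a "- b"] null_keys [OF N'', of b]
  by simp

text \<open>With a generator \<open>q\<close> in the second slot this is
  \<open>frag_extend_null\<close> for the map \<open>p \<mapsto> f p q\<close>; closure of the
  relation subgroup under differences extends it to every \<open>d\<close>.\<close>

private lemma ext_null_left: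
  assumes c: "c \<in> null1" and d: "Poly_Mapping.keys d \<subseteq> S'"
  shows "ext c d \<in> null3"
  using d unfolding ext_swap
proof (induction d rule: frag_induction)
  case (one q)
  have "(\<lambda>p. f p q) \<in> S \<rightarrow> S''" using f one by auto
  from frag_extend_null [OF N N'' this cl [OF one] c] show ?case by simp
qed (auto simp: frag_extend_diff null_diff generate.one [where G="free_Abelian_group S''", simplified])

private lemma ext_null_right:
  assumes d: "d \<in> null2" and c: "Poly_Mapping.keys c \<subseteq> S"
  shows "ext c d \<in> null3"
  using c unfolding ext_def
proof (induction c rule: frag_induction)
  case (one p)
  have "f p \<in> S' \<rightarrow> S''" using f one by auto
  from frag_extend_null [OF N' N'' this cr [OF one] d] show ?case by simp
qed (auto simp: frag_extend_diff null_diff generate.one [where G="free_Abelian_group S''", simplified])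

private lemma ext_keys:
  "\<lbrakk>Poly_Mapping.keys c \<subseteq> S; Poly_Mapping.keys d \<subseteq> S'\<rbrakk> \<Longrightarrow> Poly_Mapping.keys (ext c d) \<subseteq> S''"
  unfolding ext_def
  by (rule order_trans [OF keys_frag_extend]) (use f in \<open>fastforce dest: subsetD [OF keys_frag_extend]\<close>)

text \<open>Changing representatives to \<open>a + c\<close> and \<open>b + d\<close> gives four
  terms, of which all but \<open>ext c d\<close> contain one of the relators \<open>a\<close>,
  \<open>b\<close> and so vanish in the quotient.\<close>

private lemma induced2_cls:
  assumes c: "Poly_Mapping.keys c \<subseteq> S" and d: "Poly_Mapping.keys d \<subseteq> S'"
  shows "induced2 null3 f (coset S Rel c) (coset S' Rel' d) =
         coset S'' Rel'' (ext c d)"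
proof (rule coset_eqI [OF N''])
  show "Poly_Mapping.keys (ext c d) \<subseteq> S''" using assms by (rule ext_keys)
  show "h + ext c d \<in> induced2 null3 f (coset S Rel c) (coset S' Rel' d)"
    if "h \<in> null3" for h
  proof -
    have "0 \<in> null1" "0 \<in> null2"
      using generate.one [of "free_Abelian_group S" Rel] generate.one [of "free_Abelian_group S'" Rel'] by auto
    then have "c \<in> coset S Rel c" "d \<in> coset S' Rel' d"
      by (force simp: r_coset_def)+
    then show ?thesis
      using that unfolding induced2_def ext_def by blast
  qed
  show "x - ext c d \<in> null3"
    if x: "x \<in> induced2 null3 f (coset S Rel c) (coset S' Rel' d)" for x
  proof -
    obtain h a b where hab: "h \<in> null3" "a \<in> null1" "b \<in> null2" "x = h + ext (a + c) (b + d)"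
      using x unfolding induced2_def ext_def by (fastforce simp: r_coset_def)
    have "Poly_Mapping.keys a \<subseteq> S" "Poly_Mapping.keys b \<subseteq> S'"
      using null_keys [OF N] null_keys [OF N'] hab by auto
    then have "h + ext a b + ext a d + ext c b \<in> null3"
      using null_closed(1) [OF N''] ext_null_left ext_null_right hab(1-3) c d by metis
    moreover have "h + ext (a + c) (b + d) = h + ext a b + ext a d + ext c b + ext c d"
      unfolding ext_add_left ext_add_right by (simp only: ac_simps)
    ultimately show ?thesis
      unfolding hab(4) by (simp only: add_diff_cancel_right')
  qed
qed

private lemma cls_ext_add_left:
  assumes "Poly_Mapping.keys c \<subseteq> S" "Poly_Mapping.keys c' \<subseteq> S" "Poly_Mapping.keys d \<subseteq> S'"
  shows "coset S'' Rel'' (ext (c + c') d) =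
      (coset S'' Rel'' (ext c d)) \<oplus>\<^bsub>N''\<^esub> (coset S'' Rel'' (ext c' d))"
  using assms by (simp add: presents_add [OF N''] ext_keys ext_add_left)

private lemma cls_ext_add_right:
  assumes "Poly_Mapping.keys c \<subseteq> S" "Poly_Mapping.keys d \<subseteq> S'" "Poly_Mapping.keys d' \<subseteq> S'"
  shows "coset S'' Rel'' (ext c (d + d')) =
      (coset S'' Rel'' (ext c d)) \<oplus>\<^bsub>N''\<^esub> (coset S'' Rel'' (ext c d'))"
  using assms by (simp add: presents_add [OF N''] ext_keys ext_add_right)

lemma induced2_closed:
  assumes "s \<in> carrier N" "t \<in> carrier N'"
  shows "induced2 null3 f s t \<in> carrier N''"
proof -
  obtain c where "Poly_Mapping.keys c \<subseteq> S" "s = coset S Rel c"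
    using presents_cases [OF N assms(1)] .
  moreover obtain d where "Poly_Mapping.keys d \<subseteq> S'" "t = coset S' Rel' d"
    using presents_cases [OF N' assms(2)] .
  ultimately show ?thesis
    by (simp add: induced2_cls presents_cls_closed [OF N''] ext_keys)
qed

lemma induced2_add_hom_left:
  assumes "t \<in> carrier N'"
  shows "(\<lambda>s. induced2 null3 f s t) \<in> add_hom N N''"
proof (rule add_homI)
  fix x y assume x: "x \<in> carrier N" and y: "y \<in> carrier N"
  obtain c where "Poly_Mapping.keys c \<subseteq> S" "x = coset S Rel c"
    using presents_cases [OF N x] .
  moreover obtain c' where "Poly_Mapping.keys c' \<subseteq> S" "y = coset S Rel c'"
    using presents_cases [OF N y] .
  moreover obtain d where "Poly_Mapping.keys d \<subseteq> S'" "t = coset S' Rel' d"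
    using presents_cases [OF N' assms] .
  ultimately show "induced2 null3 f (x \<oplus>\<^bsub>N\<^esub> y) t = induced2 null3 f x t \<oplus>\<^bsub>N''\<^esub> induced2 null3 f y t"
    by (simp add: induced2_cls presents_add [OF N] keys_add_subset cls_ext_add_left)
qed (simp add: induced2_closed assms)

lemma induced2_add_hom_right:
  assumes "s \<in> carrier N"
  shows "induced2 null3 f s \<in> add_hom N' N''"
proof (rule add_homI)
  fix x y assume x: "x \<in> carrier N'" and y: "y \<in> carrier N'"
  obtain c where "Poly_Mapping.keys c \<subseteq> S'" "x = coset S' Rel' c"
    using presents_cases [OF N' x] .
  moreover obtain c' where "Poly_Mapping.keys c' \<subseteq> S'" "y = coset S' Rel' c'"
    using presents_cases [OF N' y] .
  moreover obtain d where "Poly_Mapping.keys d \<subseteq> S" "s = coset S Rel d"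
    using presents_cases [OF N assms] .
  ultimately show "induced2 null3 f s (x \<oplus>\<^bsub>N'\<^esub> y) = induced2 null3 f s x \<oplus>\<^bsub>N''\<^esub> induced2 null3 f s y"
    by (simp add: induced2_cls presents_add [OF N'] keys_add_subset cls_ext_add_right)
qed (simp add: induced2_closed assms)

lemma induced2_gen:
  "\<lbrakk>p \<in> S; q \<in> S'\<rbrakk> \<Longrightarrow> induced2 null3 f (gen S Rel p) (gen S' Rel' q) = gen S'' Rel'' (f p q)"
  using induced2_cls [of "frag_of p" "frag_of q"] by (simp add: gen_def ext_def)

end

section \<open>Balanced tensor products\<close>

text \<open>The relators of balanced products and of tensor powers come in two shapes only: three
  terms for additivity in one place, two terms for balancing.\<close>

lemma hom_frag_relation:
  assumes "abelian_group G" "h \<in> hom (free_Abelian_group S) (add_monoid G)"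
  shows "\<lbrakk>a \<in> S; b \<in> S; c \<in> S; h (frag_of a) = h (frag_of b) \<oplus>\<^bsub>G\<^esub> h (frag_of c)\<rbrakk>
           \<Longrightarrow> h (frag_of a - frag_of b - frag_of c) = \<zero>\<^bsub>G\<^esub>"
    and "\<lbrakk>a \<in> S; b \<in> S; h (frag_of a) = h (frag_of b)\<rbrakk> \<Longrightarrow> h (frag_of a - frag_of b) = \<zero>\<^bsub>G\<^esub>"
proof -
  interpret G: abelian_group G by fact
  interpret h: group_hom "free_Abelian_group S" "add_monoid G" h
    using assms(2) G.a_group by (simp add: group_hom_def group_hom_axioms_def)
  have h_add: "h (x + y) = h x \<oplus>\<^bsub>G\<^esub> h y" if "Poly_Mapping.keys x \<subseteq> S" "Poly_Mapping.keys y \<subseteq> S" for x y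
    using that h.hom_mult [of x y] by simp
  have h_closed: "h x \<in> carrier G" if "Poly_Mapping.keys x \<subseteq> S" for x
    using that h.hom_closed [of x] by simp
  have h_diff: "h (x - y) = h x \<ominus>\<^bsub>G\<^esub> h y" if x: "Poly_Mapping.keys x \<subseteq> S" and y: "Poly_Mapping.keys y \<subseteq> S" for x y
  proof -
    have "h (- y) = \<ominus>\<^bsub>G\<^esub> h y"
      using h.hom_inv [of y] y by (simp add: a_inv_def)
    then show ?thesis
      using h_add [of x "- y"] x y by (simp add: G.minus_eq)
  qed
  show "h (frag_of a - frag_of b - frag_of c) = \<zero>\<^bsub>G\<^esub>"
    if "a \<in> S" "b \<in> S" "c \<in> S" "h (frag_of a) = h (frag_of b) \<oplus>\<^bsub>G\<^esub> h (frag_of c)"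
  proof -
    have "h (frag_of a - frag_of b - frag_of c) = h (frag_of a) \<ominus>\<^bsub>G\<^esub> h (frag_of b) \<ominus>\<^bsub>G\<^esub> h (frag_of c)"
      using that by (simp add: h_diff keys_diff_subset)
    also have "\<dots> = (h (frag_of b) \<oplus>\<^bsub>G\<^esub> h (frag_of c)) \<oplus>\<^bsub>G\<^esub> \<ominus>\<^bsub>G\<^esub> (h (frag_of b) \<oplus>\<^bsub>G\<^esub> h (frag_of c))"
      using that h_closed [of "frag_of b"] h_closed [of "frag_of c"]
      by (simp add: G.minus_eq G.a_assoc G.minus_add)
    also have "\<dots> = \<zero>\<^bsub>G\<^esub>"
      using that h_closed [of "frag_of b"] h_closed [of "frag_of c"] by (intro G.r_neg G.a_closed) auto
    finally show ?thesis .
  qed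
  show "h (frag_of a - frag_of b) = \<zero>\<^bsub>G\<^esub>" if "a \<in> S" "b \<in> S" "h (frag_of a) = h (frag_of b)"
    using that h_closed [of "frag_of b"] by (simp add: h_diff G.minus_eq G.r_neg)
qed

text \<open>A relator has zero class; adding the class of the two subtracted generators to it turns
  the relator into an equation between classes.\<close>

lemma gen_relation_add:
  assumes N: "presents N S Rel" and S: "a \<in> S" "b \<in> S" "c \<in> S"
    and r: "frag_of a - frag_of b - frag_of c \<in> Rel"
  shows "gen S Rel a = gen S Rel b \<oplus>\<^bsub>N\<^esub> gen S Rel c"
proof -
  let ?F = "free_Abelian_group S" let ?H = "generate ?F Rel" let ?r = "frag_of a - frag_of b - frag_of c"
  have "?r \<in> ?H" using r by (rule generate.incl)
  then have z: "?H #>\<^bsub>?F\<^esub> ?r = \<zero>\<^bsub>N\<^esub>"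
    using presents_cls_eq [OF N null_keys [OF N]] by blast
  interpret N: abelian_group N by (rule presents_abelian_group [OF N])
  have "gen S Rel a = ?H #>\<^bsub>?F\<^esub> (?r + (frag_of b + frag_of c))"
    by (simp add: gen_def)
  also have "\<dots> = (?H #>\<^bsub>?F\<^esub> ?r) \<oplus>\<^bsub>N\<^esub> (?H #>\<^bsub>?F\<^esub> (frag_of b + frag_of c))"
    using S by (intro presents_add [OF N, symmetric]) (simp_all add: keys_add_subset keys_diff_subset)
  also have "?H #>\<^bsub>?F\<^esub> (frag_of b + frag_of c) = gen S Rel b \<oplus>\<^bsub>N\<^esub> gen S Rel c"
    unfolding gen_def using S by (intro presents_add [OF N, symmetric]) simp_all
  finally show ?thesis
    using S by (simp add: z gen_closed [OF N])
qed

lemma gen_relation_eq: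
  assumes N: "presents N S Rel" and S: "a \<in> S" "b \<in> S"
    and r: "frag_of a - frag_of b \<in> Rel"
  shows "gen S Rel a = gen S Rel b"
proof -
  let ?F = "free_Abelian_group S" let ?H = "generate ?F Rel" let ?r = "frag_of a - frag_of b"
  have "?r \<in> ?H" using r by (rule generate.incl)
  then have z: "?H #>\<^bsub>?F\<^esub> ?r = \<zero>\<^bsub>N\<^esub>"
    using presents_cls_eq [OF N null_keys [OF N]] by blast
  interpret N: abelian_group N by (rule presents_abelian_group [OF N])
  have "gen S Rel a = ?H #>\<^bsub>?F\<^esub> (?r + frag_of b)"
    by (simp add: gen_def)
  also have "\<dots> = (?H #>\<^bsub>?F\<^esub> ?r) \<oplus>\<^bsub>N\<^esub> gen S Rel b"
    unfolding gen_def
    using S by (intro presents_add [OF N, symmetric]) (simp_all add: keys_add_subset keys_diff_subset)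
  finally show ?thesis
    using S by (simp add: z gen_closed [OF N])
qed

section \<open>Biadditive maps and the universal property of balanced tensor products\<close>

definition biadditive ::
  "('m, 'x) ring_scheme \<Rightarrow> ('n, 'y) ring_scheme \<Rightarrow> ('g, 'z) ring_scheme \<Rightarrow> ('m \<Rightarrow> 'n \<Rightarrow> 'g) \<Rightarrow> bool" where
  "biadditive M N G f \<longleftrightarrow> (\<forall>x \<in> carrier M. f x \<in> add_hom N G) \<and> (\<forall>y \<in> carrier N. (\<lambda>x. f x y) \<in> add_hom M G)"

lemma biadditiveI:
  assumes "\<And>x y. \<lbrakk>x \<in> carrier M; y \<in> carrier N\<rbrakk> \<Longrightarrow> f x y \<in> carrier G"
    and "\<And>x x' y. \<lbrakk>x \<in> carrier M; x' \<in> carrier M; y \<in> carrier N\<rbrakk> \<Longrightarrow> f (x \<oplus>\<^bsub>M\<^esub> x') y = f x y \<oplus>\<^bsub>G\<^esub> f x' y"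
    and "\<And>x y y'. \<lbrakk>x \<in> carrier M; y \<in> carrier N; y' \<in> carrier N\<rbrakk> \<Longrightarrow> f x (y \<oplus>\<^bsub>N\<^esub> y') = f x y \<oplus>\<^bsub>G\<^esub> f x y'"
  shows "biadditive M N G f"
  using assms by (auto simp: biadditive_def intro!: add_homI)

lemma
  assumes "biadditive M N G f"
  shows biadditive_closed: "\<lbrakk>x \<in> carrier M; y \<in> carrier N\<rbrakk> \<Longrightarrow> f x y \<in> carrier G"
    and biadditive_left: "\<lbrakk>x \<in> carrier M; x' \<in> carrier M; y \<in> carrier N\<rbrakk> \<Longrightarrow> f (x \<oplus>\<^bsub>M\<^esub> x') y = f x y \<oplus>\<^bsub>G\<^esub> f x' y"
    and biadditive_right: "\<lbrakk>x \<in> carrier M; y \<in> carrier N; y' \<in> carrier N\<rbrakk> \<Longrightarrow> f x (y \<oplus>\<^bsub>N\<^esub> y') = f x y \<oplus>\<^bsub>G\<^esub> f x y'"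
    and biadditive_hom_left: "y \<in> carrier N \<Longrightarrow> (\<lambda>x. f x y) \<in> add_hom M G"
    and biadditive_hom_right: "x \<in> carrier M \<Longrightarrow> f x \<in> add_hom N G"
  using assms by (auto simp: biadditive_def add_hom_def)

lemma biadditive_comp:
  assumes p: "biadditive M' N' G p" and f: "f \<in> add_hom M M'" and g: "g \<in> add_hom N N'"
  shows "biadditive M N G (\<lambda>x z. p (f x) (g z))"
  unfolding biadditive_def
proof (intro conjI ballI)
  show "(\<lambda>z. p (f x) (g z)) \<in> add_hom N G" if "x \<in> carrier M" for x
    using that by (intro add_hom_comp [OF g] biadditive_hom_right [OF p] add_hom_closed [OF f])
  show "(\<lambda>x. p (f x) (g z)) \<in> add_hom M G" if "z \<in> carrier N" for z
    using that by (intro add_hom_comp [OF f] biadditive_hom_left [OF p] add_hom_closed [OF g])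
qed

text \<open>Only the underlying group of \<open>T\<close> is prescribed, which makes
  \<open>tensor_bimodule\<close>, \<open>enveloping_algebra\<close> and
  \<open>dual_pair_bimodule\<close> instances alike. Closure of the two actions puts the balancing
  relators into the free group.\<close>

definition is_tensor ::
  "('r, 'x) ring_scheme \<Rightarrow> ('r, 'm, 'y) bimodule_scheme \<Rightarrow> ('r, 'n, 'z) module_scheme
    \<Rightarrow> (('m \<times> 'n \<Rightarrow>\<^sub>0 int) set, 't) ring_scheme \<Rightarrow> bool" where
  "is_tensor R M N T \<longleftrightarrow> abelian_group M \<and> abelian_group N \<and>
     (\<forall>x \<in> carrier M. \<forall>r \<in> carrier R. x \<triangleleft>\<^bsub>M\<^esub> r \<in> carrier M) \<and>
     (\<forall>z \<in> carrier N. \<forall>r \<in> carrier R. r \<odot>\<^bsub>N\<^esub> z \<in> carrier N) \<and>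
     carrier T = carrier (tensor_group R M N) \<and> add T = mult (tensor_group R M N) \<and>
     \<zero>\<^bsub>T\<^esub> = \<one>\<^bsub>tensor_group R M N\<^esub>"

definition pure ::
  "('r, 'x) ring_scheme \<Rightarrow> ('r, 'm, 'y) bimodule_scheme \<Rightarrow> ('r, 'n, 'z) module_scheme
    \<Rightarrow> 'm \<Rightarrow> 'n \<Rightarrow> ('m \<times> 'n \<Rightarrow>\<^sub>0 int) set" where
  "pure R M N x z = gen (carrier M \<times> carrier N) (tensor_relations R M N) (x, z)"

definition tensor_lift ::
  "('r, 'x) ring_scheme \<Rightarrow> ('r, 'm, 'y) bimodule_scheme \<Rightarrow> ('r, 'n, 'z) module_scheme
    \<Rightarrow> (('m \<times> 'n \<Rightarrow>\<^sub>0 int) set, 't) ring_scheme \<Rightarrow> ('g, 'u) ring_scheme \<Rightarrow> ('m \<Rightarrow> 'n \<Rightarrow> 'g)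
    \<Rightarrow> ('m \<times> 'n \<Rightarrow>\<^sub>0 int) set \<Rightarrow> 'g" where
  "tensor_lift R M N T G f =
     lift (carrier M \<times> carrier N) (tensor_relations R M N) T G (\<lambda>p. f (fst p) (snd p))"

context
  fixes R :: "('r, 'x) ring_scheme" and M :: "('r, 'm, 'y) bimodule_scheme"
    and N :: "('r, 'n, 'z) module_scheme" and T :: "(('m \<times> 'n \<Rightarrow>\<^sub>0 int) set, 't) ring_scheme"
  assumes T: "is_tensor R M N T"
begin

private abbreviation "S \<equiv> carrier M \<times> carrier N"
private abbreviation "Rel \<equiv> tensor_relations R M N"

lemma is_tensor_presents: "presents T S Rel"
proof -
  interpret M: abelian_group M using T by (simp add: is_tensor_def)
  interpret N: abelian_group N using T by (simp add: is_tensor_def)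
  have "Rel \<subseteq> carrier (free_Abelian_group S)"
  proof
    fix r assume "r \<in> Rel"
    then show "r \<in> carrier (free_Abelian_group S)"
      unfolding tensor_relations_def
      using T by (elim UnE CollectE exE conjE) (simp_all add: keys_diff_subset is_tensor_def)
  qed
  then show ?thesis
    using T by (simp add: presents_def is_tensor_def tensor_group_def tensor_null_def)
qed

lemmas is_tensor_abelian_group = presents_abelian_group [OF is_tensor_presents]

lemma pure_closed: "\<lbrakk>x \<in> carrier M; z \<in> carrier N\<rbrakk> \<Longrightarrow> pure R M N x z \<in> carrier T"
  unfolding pure_def by (rule gen_closed [OF is_tensor_presents]) simp

lemma pure_biadditive: "biadditive M N T (pure R M N)"
proof (rule biadditiveI)
  interpret M: abelian_group M using T by (simp add: is_tensor_def)
  interpret N: abelian_group N using T by (simp add: is_tensor_def)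
  show "pure R M N (x \<oplus>\<^bsub>M\<^esub> x') y = pure R M N x y \<oplus>\<^bsub>T\<^esub> pure R M N x' y"
    if "x \<in> carrier M" "x' \<in> carrier M" "y \<in> carrier N" for x x' y
    unfolding pure_def using that
    by (intro gen_relation_add [OF is_tensor_presents]) (auto simp: tensor_relations_def)
  show "pure R M N x (y \<oplus>\<^bsub>N\<^esub> y') = pure R M N x y \<oplus>\<^bsub>T\<^esub> pure R M N x y'"
    if "x \<in> carrier M" "y \<in> carrier N" "y' \<in> carrier N" for x y y'
    unfolding pure_def using that
    by (intro gen_relation_add [OF is_tensor_presents]) (auto simp: tensor_relations_def)
qed (rule pure_closed)

lemma pure_balanced:
  "\<lbrakk>x \<in> carrier M; r \<in> carrier R; z \<in> carrier N\<rbrakk> \<Longrightarrow> pure R M N (x \<triangleleft>\<^bsub>M\<^esub> r) z = pure R M N x (r \<odot>\<^bsub>N\<^esub> z)"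
  unfolding pure_def using T
  by (intro gen_relation_eq [OF is_tensor_presents]) (auto simp: tensor_relations_def is_tensor_def)

lemma tensor_hom_eqI:
  assumes "abelian_group G" "f \<in> add_hom T G" "g \<in> add_hom T G"
    and "\<And>x z. \<lbrakk>x \<in> carrier M; z \<in> carrier N\<rbrakk> \<Longrightarrow> f (pure R M N x z) = g (pure R M N x z)"
    and "t \<in> carrier T"
  shows "f t = g t"
  using add_hom_eqI [OF is_tensor_presents assms(1-3) _ assms(5)] assms(4) by (auto simp: pure_def)

text \<open>The three families of relators match additivity in the left variable, additivity in the
  right variable, and balancedness.\<close>

lemma tensor_compatible:
  assumes G: "abelian_group G" and f: "biadditive M N G f"
    and b: "\<And>x r z. \<lbrakk>x \<in> carrier M; r \<in> carrier R; z \<in> carrier N\<rbrakk> \<Longrightarrow> f (x \<triangleleft>\<^bsub>M\<^esub> r) z = f x (r \<odot>\<^bsub>N\<^esub> z)"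
  shows "compatible S Rel G (\<lambda>p. f (fst p) (snd p))"
  unfolding compatible_def
proof (intro conjI ballI impI)
  interpret M: abelian_group M using T by (simp add: is_tensor_def)
  interpret N: abelian_group N using T by (simp add: is_tensor_def)
  show "(\<lambda>p. f (fst p) (snd p)) \<in> S \<rightarrow> carrier G"
    using biadditive_closed [OF f] by auto
  fix h r
  assume h: "h \<in> hom (free_Abelian_group S) (add_monoid G)"
    and hf: "\<forall>p \<in> S. h (frag_of p) = f (fst p) (snd p)" and r: "r \<in> Rel"
  from r consider (left) x y z where "x \<in> carrier M" "y \<in> carrier M" "z \<in> carrier N"
      "r = frag_of (x \<oplus>\<^bsub>M\<^esub> y, z) - frag_of (x, z) - frag_of (y, z)"
    | (right) x y z where "x \<in> carrier M" "y \<in> carrier N" "z \<in> carrier N"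
      "r = frag_of (x, y \<oplus>\<^bsub>N\<^esub> z) - frag_of (x, y) - frag_of (x, z)"
    | (middle) x a z where "x \<in> carrier M" "a \<in> carrier R" "z \<in> carrier N"
      "r = frag_of (x \<triangleleft>\<^bsub>M\<^esub> a, z) - frag_of (x, a \<odot>\<^bsub>N\<^esub> z)"
    unfolding tensor_relations_def by (elim UnE CollectE exE conjE) metis+
  then show "h r = \<zero>\<^bsub>G\<^esub>"
  proof cases
    case left
    then show ?thesis
      unfolding left(4) using hf by (intro hom_frag_relation(1) [OF G h]) (simp_all add: biadditive_left [OF f])
  next
    case right
    then show ?thesis
      unfolding right(4) using hf by (intro hom_frag_relation(1) [OF G h]) (simp_all add: biadditive_right [OF f])
  next
    case middle
    then have "x \<triangleleft>\<^bsub>M\<^esub> a \<in> carrier M" "a \<odot>\<^bsub>N\<^esub> z \<in> carrier N"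
      using T by (auto simp: is_tensor_def)
    with middle show ?thesis
      unfolding middle(4) using hf b by (intro hom_frag_relation(2) [OF G h]) simp_all
  qed
qed

lemma
  assumes G: "abelian_group G" and f: "biadditive M N G f"
    and b: "\<And>x r z. \<lbrakk>x \<in> carrier M; r \<in> carrier R; z \<in> carrier N\<rbrakk> \<Longrightarrow> f (x \<triangleleft>\<^bsub>M\<^esub> r) z = f x (r \<odot>\<^bsub>N\<^esub> z)"
  shows tensor_lift_hom: "tensor_lift R M N T G f \<in> add_hom T G"
    and tensor_lift_pure: "\<lbrakk>x \<in> carrier M; z \<in> carrier N\<rbrakk> \<Longrightarrow> tensor_lift R M N T G f (pure R M N x z) = f x z"
  using lift_add_hom [OF is_tensor_presents G tensor_compatible [OF assms]]
    lift_gen [OF is_tensor_presents G tensor_compatible [OF assms], of "(x, z)"]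
  by (auto simp: tensor_lift_def pure_def)

end

text \<open>Balancedness is demanded only after passing to pure tensors of the target, since moving
  a scalar across there may use the balancing of the target itself. The base rings of source and
  target are independent.\<close>

lemma
  fixes M :: "('r, 'm, 'y) bimodule_scheme" and N :: "('r, 'n, 'z) module_scheme"
    and M' :: "('s, 'm', 'y') bimodule_scheme" and N' :: "('s, 'n', 'z') module_scheme"
  assumes T: "is_tensor R M N T" and T': "is_tensor R' M' N' T'"
    and f: "f \<in> add_hom M M'" and g: "g \<in> add_hom N N'"
    and b: "\<And>x r z. \<lbrakk>x \<in> carrier M; r \<in> carrier R; z \<in> carrier N\<rbrakk>
              \<Longrightarrow> pure R' M' N' (f (x \<triangleleft>\<^bsub>M\<^esub> r)) (g z) = pure R' M' N' (f x) (g (r \<odot>\<^bsub>N\<^esub> z))"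
  shows tensor_induced_hom: "induced (tensor_null R' M' N') (\<lambda>(x, z). (f x, g z)) \<in> add_hom T T'"
    and tensor_induced_pure: "\<lbrakk>x \<in> carrier M; z \<in> carrier N\<rbrakk>
      \<Longrightarrow> induced (tensor_null R' M' N') (\<lambda>(x, z). (f x, g z)) (pure R M N x z) = pure R' M' N' (f x) (g z)"
proof -
  let ?f = "\<lambda>(x, z). (f x, g z)"
  have b': "biadditive M N T' (\<lambda>x z. pure R' M' N' (f x) (g z))"
    by (rule biadditive_comp [OF pure_biadditive [OF T'] f g])
  have *: "?f \<in> carrier M \<times> carrier N \<rightarrow> carrier M' \<times> carrier N'"
    using f g by (auto simp: add_hom_def)
  have c: "compatible (carrier M \<times> carrier N) (tensor_relations R M N) T'
      (\<lambda>p. gen (carrier M' \<times> carrier N') (tensor_relations R' M' N') (?f p))"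
    using tensor_compatible [OF T is_tensor_abelian_group [OF T'] b' b]
    by (simp add: pure_def case_prod_unfold)
  show "induced (tensor_null R' M' N') ?f \<in> add_hom T T'"
    using induced_add_hom [OF is_tensor_presents [OF T] is_tensor_presents [OF T'] * c]
    by (simp add: tensor_null_def)
  show "induced (tensor_null R' M' N') ?f (pure R M N x z) = pure R' M' N' (f x) (g z)"
    if "x \<in> carrier M" "z \<in> carrier N"
    using induced_gen [OF is_tensor_presents [OF T] is_tensor_presents [OF T'] * c, of "(x, z)"] that
    by (simp add: tensor_null_def pure_def)
qed

text \<open>One statement serves the factorwise product of the enveloping algebra and its left and
  right actions on dual pairs. The two balancing conditions say that the operation respects the
  relations of its first and of its second argument.\<close>

lemma
  fixes M :: "('r, 'm, 'y) bimodule_scheme" and N :: "('r, 'n, 'z) module_scheme"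
    and M' :: "('s, 'm', 'y') bimodule_scheme" and N' :: "('s, 'n', 'z') module_scheme"
    and M'' :: "('t, 'm'', 'y'') bimodule_scheme" and N'' :: "('t, 'n'', 'z'') module_scheme"
  assumes T: "is_tensor R M N T" and T': "is_tensor R' M' N' T'" and T'': "is_tensor R'' M'' N'' T''"
    and f: "biadditive M M' M'' f" and g: "biadditive N N' N'' g"
    and b: "\<And>x r z x' z'. \<lbrakk>x \<in> carrier M; r \<in> carrier R; z \<in> carrier N; x' \<in> carrier M'; z' \<in> carrier N'\<rbrakk>
      \<Longrightarrow> pure R'' M'' N'' (f (x \<triangleleft>\<^bsub>M\<^esub> r) x') (g z z') = pure R'' M'' N'' (f x x') (g (r \<odot>\<^bsub>N\<^esub> z) z')"
    and b': "\<And>x r z x' z'. \<lbrakk>x \<in> carrier M; r \<in> carrier R'; z \<in> carrier N; x' \<in> carrier M'; z' \<in> carrier N'\<rbrakk>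
      \<Longrightarrow> pure R'' M'' N'' (f x (x' \<triangleleft>\<^bsub>M'\<^esub> r)) (g z z') = pure R'' M'' N'' (f x x') (g z (r \<odot>\<^bsub>N'\<^esub> z'))"
  shows tensor_induced2_biadditive:
      "biadditive T T' T'' (induced2 (tensor_null R'' M'' N'') (\<lambda>(x, z) (x', z'). (f x x', g z z')))"
    and tensor_induced2_pure: "\<lbrakk>x \<in> carrier M; z \<in> carrier N; x' \<in> carrier M'; z' \<in> carrier N'\<rbrakk>
      \<Longrightarrow> induced2 (tensor_null R'' M'' N'') (\<lambda>(x, z) (x', z'). (f x x', g z z'))
            (pure R M N x z) (pure R' M' N' x' z') = pure R'' M'' N'' (f x x') (g z z')"
proof -
  let ?f = "\<lambda>(x, z) (x', z'). (f x x', g z z')"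
  let ?g = "gen (carrier M'' \<times> carrier N'') (tensor_relations R'' M'' N'')"
  have 0: "?f p q \<in> carrier M'' \<times> carrier N''" if "p \<in> carrier M \<times> carrier N" "q \<in> carrier M' \<times> carrier N'" for p q
    using that biadditive_closed [OF f] biadditive_closed [OF g] by auto
  have 1: "compatible (carrier M \<times> carrier N) (tensor_relations R M N) T'' (\<lambda>p. ?g (?f p q))"
    if q: "q \<in> carrier M' \<times> carrier N'" for q
  proof -
    obtain x' z' where q': "q = (x', z')" "x' \<in> carrier M'" "z' \<in> carrier N'" using q by auto
    have "biadditive M N T'' (\<lambda>x z. pure R'' M'' N'' (f x x') (g z z'))"
      by (rule biadditive_comp [OF pure_biadditive [OF T'']
            biadditive_hom_left [OF f q'(2)] biadditive_hom_left [OF g q'(3)]])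
    from tensor_compatible [OF T is_tensor_abelian_group [OF T''] this b] show ?thesis
      using q' by (simp add: pure_def case_prod_unfold)
  qed
  have 2: "compatible (carrier M' \<times> carrier N') (tensor_relations R' M' N') T'' (\<lambda>q. ?g (?f p q))"
    if p: "p \<in> carrier M \<times> carrier N" for p
  proof -
    obtain x z where p': "p = (x, z)" "x \<in> carrier M" "z \<in> carrier N" using p by auto
    have "biadditive M' N' T'' (\<lambda>x' z'. pure R'' M'' N'' (f x x') (g z z'))"
      by (rule biadditive_comp [OF pure_biadditive [OF T'']
            biadditive_hom_right [OF f p'(2)] biadditive_hom_right [OF g p'(3)]])
    from tensor_compatible [OF T' is_tensor_abelian_group [OF T''] this b'] show ?thesis
      using p' by (simp add: pure_def case_prod_unfold)
  qed
  note * = is_tensor_presents [OF T] is_tensor_presents [OF T'] is_tensor_presents [OF T''] 0 1 2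
  show "biadditive T T' T'' (induced2 (tensor_null R'' M'' N'') ?f)"
    unfolding biadditive_def tensor_null_def
    by (intro conjI ballI induced2_add_hom_left [OF *] induced2_add_hom_right [OF *])
  show "induced2 (tensor_null R'' M'' N'') ?f (pure R M N x z) (pure R' M' N' x' z') =
      pure R'' M'' N'' (f x x') (g z z')"
    if "x \<in> carrier M" "z \<in> carrier N" "x' \<in> carrier M'" "z' \<in> carrier N'"
  proof -
    have "induced2 (relspan (carrier M'' \<times> carrier N'') (tensor_relations R'' M'' N''))
        ?f (gen (carrier M \<times> carrier N) (tensor_relations R M N) (x, z))
        (gen (carrier M' \<times> carrier N') (tensor_relations R' M' N') (x', z')) = ?g (?f (x, z) (x', z'))"
      by (rule induced2_gen [OF *]) (use that in auto)
    then show ?thesis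
      by (simp add: tensor_null_def pure_def)
  qed
qed

text \<open>Uniqueness is applied once per variable: the second argument is reduced to pure tensors
  while the first is already pure, then the first is reduced.\<close>

lemma biadditive_eqI:
  assumes T: "is_tensor R M N T" and T': "is_tensor R' M' N' T'" and G: "abelian_group G"
    and f: "biadditive T T' G f" and g: "biadditive T T' G g"
    and eq: "\<And>x z x' z'. \<lbrakk>x \<in> carrier M; z \<in> carrier N; x' \<in> carrier M'; z' \<in> carrier N'\<rbrakk>
      \<Longrightarrow> f (pure R M N x z) (pure R' M' N' x' z') = g (pure R M N x z) (pure R' M' N' x' z')"
    and t: "t \<in> carrier T" "t' \<in> carrier T'"
  shows "f t t' = g t t'"
proof -
  have "f (pure R M N x z) t' = g (pure R M N x z) t'" if x: "x \<in> carrier M" and z: "z \<in> carrier N" for x z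
    by (rule tensor_hom_eqI [OF T' G biadditive_hom_right [OF f] biadditive_hom_right [OF g]])
      (fact pure_closed [OF T x z] eq [OF x z] t(2))+
  then show ?thesis
    by (intro tensor_hom_eqI [OF T G biadditive_hom_left [OF f t(2)] biadditive_hom_left [OF g t(2)] _ t(1)])
qed

section \<open>Modules and tensor powers\<close>

text \<open>The action is a function and not a record field, so that it can be built and its laws
  proved before it is put into a module record.\<close>

definition is_action ::
  "('r, 'x) ring_scheme \<Rightarrow> ('n, 'y) ring_scheme \<Rightarrow> ('r \<Rightarrow> 'n \<Rightarrow> 'n) \<Rightarrow> bool" where
  "is_action R N f \<longleftrightarrow> biadditive R N N f \<and>
     (\<forall>r \<in> carrier R. \<forall>s \<in> carrier R. \<forall>n \<in> carrier N. f (r \<otimes>\<^bsub>R\<^esub> s) n = f r (f s n)) \<and>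
     (\<forall>n \<in> carrier N. f \<one>\<^bsub>R\<^esub> n = n)"

lemma left_module_iff:
  "left_module R M \<longleftrightarrow> ring R \<and> abelian_group M \<and> is_action R M (smult M)"
proof
  assume "left_module R M"
  then interpret left_module R M .
  show "ring R \<and> abelian_group M \<and> is_action R M (smult M)"
    unfolding is_action_def
    by (intro conjI ballI biadditiveI smult_closed smult_l_distr smult_r_distr smult_assoc smult_one
        R.ring_axioms M.abelian_group_axioms)
next
  assume *: "ring R \<and> abelian_group M \<and> is_action R M (smult M)"
  then interpret R: ring R by simp
  interpret M: abelian_group M using * by simp
  have b: "biadditive R M M (smult M)" using * by (simp add: is_action_def)
  show "left_module R M"
    by unfold_locales (use * biadditive_closed [OF b] biadditive_left [OF b] biadditive_right [OF b]
        in \<open>simp_all add: is_action_def\<close>)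
qed

lemma op_ring_simps [simp]:
  "carrier (op_ring R) = carrier R" "add (op_ring R) = add R" "\<zero>\<^bsub>op_ring R\<^esub> = \<zero>\<^bsub>R\<^esub>"
  "\<one>\<^bsub>op_ring R\<^esub> = \<one>\<^bsub>R\<^esub>" "a \<otimes>\<^bsub>op_ring R\<^esub> b = b \<otimes>\<^bsub>R\<^esub> a"
  by (simp_all add: op_ring_def)

lemma right_part_simps [simp]:
  "carrier (right_part M) = carrier M" "add (right_part M) = add M" "\<zero>\<^bsub>right_part M\<^esub> = \<zero>\<^bsub>M\<^esub>"
  "r \<odot>\<^bsub>right_part M\<^esub> m = m \<triangleleft>\<^bsub>M\<^esub> r"
  by (simp_all add: right_part_def)

text \<open>Moves the group axioms between records of different types that share carrier, addition
  and zero, such as a bimodule and its \<open>right_part\<close> or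
  \<open>restrict_scalars\<close>.\<close>

lemma abelian_group_cong:
  assumes "carrier M = carrier N" "add M = add N" "\<zero>\<^bsub>M\<^esub> = \<zero>\<^bsub>N\<^esub>" "abelian_group M"
  shows "abelian_group N"
proof -
  interpret M: abelian_group M by fact
  show ?thesis
    by (rule abelian_groupI; unfold assms(1-3) [symmetric])
      (auto simp: M.a_ac intro: bexI [where P = "\<lambda>y. y \<oplus>\<^bsub>M\<^esub> x = \<zero>\<^bsub>M\<^esub>" for x, OF M.l_neg])
qed

lemma ring_op_ring:
  assumes "ring R" shows "ring (op_ring R)"
proof -
  interpret R: ring R by fact
  show ?thesis
  proof (rule ringI)
    show "abelian_group (op_ring R)"
      by (rule abelian_group_cong [OF _ _ _ R.abelian_group_axioms]) simp_all
    show "monoid (op_ring R)"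
      by unfold_locales (simp_all add: R.m_assoc)
  qed (simp_all add: R.l_distr R.r_distr)
qed

text \<open>The two actions are treated symmetrically over a bare ring. This covers bimodules over
  \<open>A\<close> as well as the dual pairs, whose base ring is the enveloping algebra, given
  without scalars as a plain ring record.\<close>

locale ring_bimodule = R?: ring R + V?: abelian_group V
  for R :: "('r, 'x) ring_scheme" and V :: "('r, 'v, 'y) bimodule_scheme" +
  assumes l_biadd: "biadditive R V V (smult V)" and r_biadd: "biadditive V R V (rsmult V)"
    and l_assoc: "\<lbrakk>r \<in> carrier R; s \<in> carrier R; v \<in> carrier V\<rbrakk> \<Longrightarrow> (r \<otimes>\<^bsub>R\<^esub> s) \<odot>\<^bsub>V\<^esub> v = r \<odot>\<^bsub>V\<^esub> (s \<odot>\<^bsub>V\<^esub> v)"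
    and l_one: "v \<in> carrier V \<Longrightarrow> \<one>\<^bsub>R\<^esub> \<odot>\<^bsub>V\<^esub> v = v"
    and r_assoc: "\<lbrakk>r \<in> carrier R; s \<in> carrier R; v \<in> carrier V\<rbrakk> \<Longrightarrow> (v \<triangleleft>\<^bsub>V\<^esub> r) \<triangleleft>\<^bsub>V\<^esub> s = v \<triangleleft>\<^bsub>V\<^esub> (r \<otimes>\<^bsub>R\<^esub> s)"
    and r_one: "v \<in> carrier V \<Longrightarrow> v \<triangleleft>\<^bsub>V\<^esub> \<one>\<^bsub>R\<^esub> = v"
    and lr_comm: "\<lbrakk>r \<in> carrier R; s \<in> carrier R; v \<in> carrier V\<rbrakk> \<Longrightarrow> (r \<odot>\<^bsub>V\<^esub> v) \<triangleleft>\<^bsub>V\<^esub> s = r \<odot>\<^bsub>V\<^esub> (v \<triangleleft>\<^bsub>V\<^esub> s)"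
begin

lemmas l_closed = biadditive_closed [OF l_biadd]
lemmas r_closed = biadditive_closed [OF r_biadd]
lemmas l_add = biadditive_left [OF l_biadd]
lemmas l_add_right = biadditive_right [OF l_biadd]
lemmas r_add = biadditive_right [OF r_biadd]
lemmas r_add_left = biadditive_left [OF r_biadd]
lemmas l_hom = biadditive_hom_right [OF l_biadd]
lemmas r_hom = biadditive_hom_left [OF r_biadd]

end

lemma ring_bimodule_iff:
  "ring_bimodule R V \<longleftrightarrow> left_module R V \<and> left_module (op_ring R) (right_part V) \<and>
     (\<forall>r \<in> carrier R. \<forall>s \<in> carrier R. \<forall>v \<in> carrier V. (r \<odot>\<^bsub>V\<^esub> v) \<triangleleft>\<^bsub>V\<^esub> s = r \<odot>\<^bsub>V\<^esub> (v \<triangleleft>\<^bsub>V\<^esub> s))"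
  (is "?L \<longleftrightarrow> ?R")
proof -
  have b: "biadditive (op_ring R) (right_part V) (right_part V) (smult (right_part V)) \<longleftrightarrow>
      biadditive V R V (rsmult V)"
    by (auto simp: biadditive_def add_hom_def Pi_iff)
  have a: "abelian_group (right_part V)" if "abelian_group V"
    by (rule abelian_group_cong [OF _ _ _ that]) simp_all
  show ?thesis
    unfolding ring_bimodule_def ring_bimodule_axioms_def left_module_iff is_action_def b
    using a ring_op_ring by auto
qed

lemma algebra_bimodule_ring_bimodule:
  assumes "algebra_bimodule K A M" shows "ring_bimodule A M"
proof -
  interpret algebra_bimodule K A M by fact
  show ?thesis
    unfolding ring_bimodule_iff
    using left.left_module_axioms right.left_module_axioms actions_commute by blast
qed

lemma algebra_bimoduleI:
  assumes "assoc_algebra K A" "ring_bimodule A M"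
    and "\<And>k m. \<lbrakk>k \<in> carrier K; m \<in> carrier M\<rbrakk>
        \<Longrightarrow> (k \<odot>\<^bsub>A\<^esub> \<one>\<^bsub>A\<^esub>) \<odot>\<^bsub>M\<^esub> m = m \<triangleleft>\<^bsub>M\<^esub> (k \<odot>\<^bsub>A\<^esub> \<one>\<^bsub>A\<^esub>)"
  shows "algebra_bimodule K A M"
  using assms unfolding algebra_bimodule_def algebra_bimodule_axioms_def ring_bimodule_iff by blast

section \<open>Positive tensor powers of a bimodule\<close>

context ring_bimodule
begin

abbreviation T where "T \<equiv> tensor_powers R V"
abbreviation Vs where "Vs \<equiv> lists (carrier V)"
definition wgen where "wgen = gen (words V) (word_relations R V)"

lemma words_iff: "xs \<in> words V \<longleftrightarrow> xs \<noteq> [] \<and> xs \<in> Vs"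
  by (auto simp: words_def)

lemma T_presents: "presents T (words V) (word_relations R V)"
proof -
  have "word_relations R V \<subseteq> carrier (free_Abelian_group (words V))"
  proof
    fix r assume "r \<in> word_relations R V"
    then show "r \<in> carrier (free_Abelian_group (words V))"
      unfolding word_relations_def
      by (elim UnE CollectE exE conjE) (simp_all add: keys_diff_subset words_iff l_closed r_closed)
  qed
  then show ?thesis
    by (simp add: presents_def tensor_powers_def word_null_def Let_def)
qed

sublocale T: abelian_group T
  by (rule presents_abelian_group [OF T_presents])

lemma wgen_closed: "\<lbrakk>xs \<noteq> []; xs \<in> Vs\<rbrakk> \<Longrightarrow> wgen xs \<in> carrier T"
  unfolding wgen_def by (rule gen_closed [OF T_presents]) (simp add: words_iff)

lemma wgen_add:
  assumes "xs \<in> Vs" "ys \<in> Vs" "v \<in> carrier V" "w \<in> carrier V"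
  shows "wgen (xs @ [v \<oplus>\<^bsub>V\<^esub> w] @ ys) = wgen (xs @ [v] @ ys) \<oplus>\<^bsub>T\<^esub> wgen (xs @ [w] @ ys)"
  unfolding wgen_def
proof (rule gen_relation_add [OF T_presents])
  show "frag_of (xs @ [v \<oplus>\<^bsub>V\<^esub> w] @ ys) - frag_of (xs @ [v] @ ys) - frag_of (xs @ [w] @ ys) \<in> word_relations R V"
    unfolding word_relations_def using assms by blast
qed (use assms in \<open>simp_all add: words_iff\<close>)

lemma wgen_balanced:
  assumes "xs \<in> Vs" "ys \<in> Vs" "v \<in> carrier V" "w \<in> carrier V" "r \<in> carrier R"
  shows "wgen (xs @ [v \<triangleleft>\<^bsub>V\<^esub> r, w] @ ys) = wgen (xs @ [v, r \<odot>\<^bsub>V\<^esub> w] @ ys)"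
  unfolding wgen_def
proof (rule gen_relation_eq [OF T_presents])
  show "frag_of (xs @ [v \<triangleleft>\<^bsub>V\<^esub> r, w] @ ys) - frag_of (xs @ [v, r \<odot>\<^bsub>V\<^esub> w] @ ys) \<in> word_relations R V"
    unfolding word_relations_def using assms by blast
qed (use assms in \<open>simp_all add: words_iff l_closed r_closed\<close>)

lemma word_hom_eqI:
  assumes "abelian_group G" "f \<in> add_hom T G" "g \<in> add_hom T G"
    and "\<And>xs. \<lbrakk>xs \<noteq> []; xs \<in> Vs\<rbrakk> \<Longrightarrow> f (wgen xs) = g (wgen xs)"
    and "t \<in> carrier T"
  shows "f t = g t"
  by (rule add_hom_eqI [OF T_presents assms(1-3) _ assms(5)])
    (simp add: assms(4) words_iff flip: wgen_def)

text \<open>A function on words descends to the tensor powers once it is additive in each letter and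
  balanced between neighbouring letters, these being the two families of word relators.\<close>

lemma word_compatible:
  assumes G: "abelian_group G"
    and f: "\<And>xs. \<lbrakk>xs \<noteq> []; xs \<in> Vs\<rbrakk> \<Longrightarrow> f xs \<in> carrier G"
    and a: "\<And>xs ys v w. \<lbrakk>xs \<in> Vs; ys \<in> Vs; v \<in> carrier V; w \<in> carrier V\<rbrakk>
      \<Longrightarrow> f (xs @ [v \<oplus>\<^bsub>V\<^esub> w] @ ys) = f (xs @ [v] @ ys) \<oplus>\<^bsub>G\<^esub> f (xs @ [w] @ ys)"
    and b: "\<And>xs ys v w r. \<lbrakk>xs \<in> Vs; ys \<in> Vs; v \<in> carrier V; w \<in> carrier V;
        r \<in> carrier R\<rbrakk> \<Longrightarrow> f (xs @ [v \<triangleleft>\<^bsub>V\<^esub> r, w] @ ys) = f (xs @ [v, r \<odot>\<^bsub>V\<^esub> w] @ ys)"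
  shows "compatible (words V) (word_relations R V) G f"
  unfolding compatible_def
proof (intro conjI ballI impI)
  show "f \<in> words V \<rightarrow> carrier G" using f by (auto simp: words_iff)
  fix h r
  assume h: "h \<in> hom (free_Abelian_group (words V)) (add_monoid G)"
    and hf: "\<forall>p \<in> words V. h (frag_of p) = f p" and r: "r \<in> word_relations R V"
  show "h r = \<zero>\<^bsub>G\<^esub>"
    using r unfolding word_relations_def
  proof (elim UnE CollectE exE conjE)
    fix xs ys v w
    assume *: "xs \<in> Vs" "ys \<in> Vs" "v \<in> carrier V" "w \<in> carrier V"
      and r: "r = frag_of (xs @ [v \<oplus>\<^bsub>V\<^esub> w] @ ys) - frag_of (xs @ [v] @ ys) - frag_of (xs @ [w] @ ys)"
    have "xs @ [v \<oplus>\<^bsub>V\<^esub> w] @ ys \<in> words V" "xs @ [v] @ ys \<in> words V" "xs @ [w] @ ys \<in> words V"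
      using * by (simp_all add: words_iff)
    then show "h r = \<zero>\<^bsub>G\<^esub>"
      unfolding r using hf a [OF *] by (intro hom_frag_relation(1) [OF G h]) metis+
  next
    fix xs ys v w s
    assume *: "xs \<in> Vs" "ys \<in> Vs" "v \<in> carrier V" "w \<in> carrier V" "s \<in> carrier R"
      and r: "r = frag_of (xs @ [v \<triangleleft>\<^bsub>V\<^esub> s, w] @ ys) - frag_of (xs @ [v, s \<odot>\<^bsub>V\<^esub> w] @ ys)"
    have "xs @ [v \<triangleleft>\<^bsub>V\<^esub> s, w] @ ys \<in> words V" "xs @ [v, s \<odot>\<^bsub>V\<^esub> w] @ ys \<in> words V"
      using * by (simp_all add: words_iff l_closed r_closed)
    then show "h r = \<zero>\<^bsub>G\<^esub>"
      unfolding r using hf b [OF *] by (intro hom_frag_relation(2) [OF G h]) metis+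
  qed
qed

lemma
  assumes "abelian_group G"
    and "\<And>xs. \<lbrakk>xs \<noteq> []; xs \<in> Vs\<rbrakk> \<Longrightarrow> f xs \<in> carrier G"
    and "\<And>xs ys v w. \<lbrakk>xs \<in> Vs; ys \<in> Vs; v \<in> carrier V; w \<in> carrier V\<rbrakk>
      \<Longrightarrow> f (xs @ [v \<oplus>\<^bsub>V\<^esub> w] @ ys) = f (xs @ [v] @ ys) \<oplus>\<^bsub>G\<^esub> f (xs @ [w] @ ys)"
    and "\<And>xs ys v w r. \<lbrakk>xs \<in> Vs; ys \<in> Vs; v \<in> carrier V; w \<in> carrier V;
        r \<in> carrier R\<rbrakk> \<Longrightarrow> f (xs @ [v \<triangleleft>\<^bsub>V\<^esub> r, w] @ ys) = f (xs @ [v, r \<odot>\<^bsub>V\<^esub> w] @ ys)"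
  shows word_lift_hom: "lift (words V) (word_relations R V) T G f \<in> add_hom T G"
    and word_lift_wgen: "\<lbrakk>xs \<noteq> []; xs \<in> Vs\<rbrakk>
      \<Longrightarrow> lift (words V) (word_relations R V) T G f (wgen xs) = f xs"
proof -
  have c: "compatible (words V) (word_relations R V) G f"
    by (rule word_compatible) fact+
  show "lift (words V) (word_relations R V) T G f \<in> add_hom T G"
    by (rule lift_add_hom [OF T_presents assms(1) c])
  show "lift (words V) (word_relations R V) T G f (wgen xs) = f xs" if "xs \<noteq> []" "xs \<in> Vs"
    unfolding wgen_def by (rule lift_gen [OF T_presents assms(1) c]) (use that in \<open>simp add: words_iff\<close>)
qed

lemma
  assumes "\<And>xs. \<lbrakk>xs \<noteq> []; xs \<in> Vs\<rbrakk> \<Longrightarrow> f xs \<noteq> [] \<and> f xs \<in> Vs"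
    and "\<And>xs ys v w. \<lbrakk>xs \<in> Vs; ys \<in> Vs; v \<in> carrier V; w \<in> carrier V\<rbrakk>
      \<Longrightarrow> wgen (f (xs @ [v \<oplus>\<^bsub>V\<^esub> w] @ ys)) = wgen (f (xs @ [v] @ ys)) \<oplus>\<^bsub>T\<^esub> wgen (f (xs @ [w] @ ys))"
    and "\<And>xs ys v w r. \<lbrakk>xs \<in> Vs; ys \<in> Vs; v \<in> carrier V; w \<in> carrier V;
        r \<in> carrier R\<rbrakk> \<Longrightarrow> wgen (f (xs @ [v \<triangleleft>\<^bsub>V\<^esub> r, w] @ ys)) = wgen (f (xs @ [v, r \<odot>\<^bsub>V\<^esub> w] @ ys))"
  shows word_induced_hom: "induced (word_null R V) f \<in> add_hom T T"
    and word_induced_wgen: "\<lbrakk>xs \<noteq> []; xs \<in> Vs\<rbrakk>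
      \<Longrightarrow> induced (word_null R V) f (wgen xs) = wgen (f xs)"
proof -
  have c: "compatible (words V) (word_relations R V) T (\<lambda>xs. gen (words V) (word_relations R V) (f xs))"
    unfolding wgen_def [symmetric]
    by (rule word_compatible [OF T.abelian_group_axioms wgen_closed])
      (simp_all add: assms del: append_Cons append.simps)
  have f: "f \<in> words V \<rightarrow> words V" using assms(1) by (auto simp: words_iff)
  show "induced (word_null R V) f \<in> add_hom T T"
    unfolding word_null_def by (rule induced_add_hom [OF T_presents T_presents f c])
  show "induced (word_null R V) f (wgen xs) = wgen (f xs)" if "xs \<noteq> []" "xs \<in> Vs"
    unfolding word_null_def wgen_def
    by (rule induced_gen [OF T_presents T_presents f c]) (use that in \<open>simp add: words_iff\<close>)
qed

lemma T_smult_def: "r \<odot>\<^bsub>T\<^esub> t = induced (word_null R V) (\<lambda>xs. (r \<odot>\<^bsub>V\<^esub> hd xs) # tl xs) t"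
  by (simp add: tensor_powers_def Let_def)

lemma T_rsmult_def: "t \<triangleleft>\<^bsub>T\<^esub> r = induced (word_null R V) (\<lambda>xs. butlast xs @ [last xs \<triangleleft>\<^bsub>V\<^esub> r]) t"
  by (simp add: tensor_powers_def Let_def)

lemma T_mult_def: "s \<otimes>\<^bsub>T\<^esub> t = induced2 (word_null R V) (\<lambda>xs ys. xs @ ys) s t"
  by (simp add: tensor_powers_def Let_def)

text \<open>The left action touches only the first letter. A relator with nonempty prefix therefore
  becomes a relator with another prefix; a relator at the head needs distributivity, or the
  commutation of the two actions on \<open>V\<close>.\<close>

lemma
  assumes r: "r \<in> carrier R"
  shows T_smult_hom: "smult T r \<in> add_hom T T"
    and T_smult_wgen: "\<lbrakk>x \<in> carrier V; xs \<in> Vs\<rbrakk> \<Longrightarrow> r \<odot>\<^bsub>T\<^esub> wgen (x # xs) = wgen ((r \<odot>\<^bsub>V\<^esub> x) # xs)"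
proof -
  let ?f = "\<lambda>xs. (r \<odot>\<^bsub>V\<^esub> hd xs) # tl xs"
  have 1: "?f xs \<noteq> [] \<and> ?f xs \<in> Vs" if "xs \<noteq> []" "xs \<in> Vs" for xs
    using that r by (cases xs) (auto simp: l_closed)
  have 2: "wgen (?f (xs @ [v \<oplus>\<^bsub>V\<^esub> w] @ ys)) = wgen (?f (xs @ [v] @ ys)) \<oplus>\<^bsub>T\<^esub> wgen (?f (xs @ [w] @ ys))"
    if "xs \<in> Vs" "ys \<in> Vs" "v \<in> carrier V" "w \<in> carrier V" for xs ys v w
  proof (cases xs)
    case Nil
    then show ?thesis
      using wgen_add [of "[]" ys "r \<odot>\<^bsub>V\<^esub> v" "r \<odot>\<^bsub>V\<^esub> w"] that r by (simp add: l_add_right l_closed)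
  next
    case (Cons x xs')
    then show ?thesis
      using wgen_add [of "(r \<odot>\<^bsub>V\<^esub> x) # xs'" ys v w] that r by (simp add: l_closed)
  qed
  have 3: "wgen (?f (xs @ [v \<triangleleft>\<^bsub>V\<^esub> s, w] @ ys)) = wgen (?f (xs @ [v, s \<odot>\<^bsub>V\<^esub> w] @ ys))"
    if "xs \<in> Vs" "ys \<in> Vs" "v \<in> carrier V" "w \<in> carrier V" "s \<in> carrier R"
    for xs ys v w s
  proof (cases xs)
    case Nil
    then show ?thesis
      using wgen_balanced [of "[]" ys "r \<odot>\<^bsub>V\<^esub> v" w s] that r by (simp add: lr_comm l_closed)
  next
    case (Cons x xs')
    then show ?thesis
      using wgen_balanced [of "(r \<odot>\<^bsub>V\<^esub> x) # xs'" ys v w s] that r by (simp add: l_closed)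
  qed
  show "smult T r \<in> add_hom T T"
    using word_induced_hom [of ?f, OF 1 2 3] by (simp add: add_hom_def T_smult_def Pi_iff)
  show "r \<odot>\<^bsub>T\<^esub> wgen (x # xs) = wgen ((r \<odot>\<^bsub>V\<^esub> x) # xs)" if "x \<in> carrier V" "xs \<in> Vs"
    using word_induced_wgen [of ?f "x # xs", OF 1 2 3] that by (simp add: T_smult_def)
qed

text \<open>Mirror image of the left action: the last letter is changed, so the case distinction is
  on the end of the suffix.\<close>

lemma
  assumes r: "r \<in> carrier R"
  shows T_rsmult_hom: "(\<lambda>t. t \<triangleleft>\<^bsub>T\<^esub> r) \<in> add_hom T T"
    and T_rsmult_wgen: "\<lbrakk>x \<in> carrier V; xs \<in> Vs\<rbrakk> \<Longrightarrow> wgen (xs @ [x]) \<triangleleft>\<^bsub>T\<^esub> r = wgen (xs @ [x \<triangleleft>\<^bsub>V\<^esub> r])"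
proof -
  let ?f = "\<lambda>xs. butlast xs @ [last xs \<triangleleft>\<^bsub>V\<^esub> r]"
  have 1: "?f xs \<noteq> [] \<and> ?f xs \<in> Vs" if "xs \<noteq> []" "xs \<in> Vs" for xs
    using that r by (cases xs rule: rev_cases) (auto simp: r_closed)
  have 2: "wgen (?f (xs @ [v \<oplus>\<^bsub>V\<^esub> w] @ ys)) = wgen (?f (xs @ [v] @ ys)) \<oplus>\<^bsub>T\<^esub> wgen (?f (xs @ [w] @ ys))"
    if "xs \<in> Vs" "ys \<in> Vs" "v \<in> carrier V" "w \<in> carrier V" for xs ys v w
  proof (cases ys rule: rev_cases)
    case Nil
    then show ?thesis
      using wgen_add [of xs "[]" "v \<triangleleft>\<^bsub>V\<^esub> r" "w \<triangleleft>\<^bsub>V\<^esub> r"] that r by (simp add: r_add_left r_closed butlast_append)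
  next
    case (snoc ys' y)
    then show ?thesis
      using wgen_add [of xs "ys' @ [y \<triangleleft>\<^bsub>V\<^esub> r]" v w] that r by (simp add: r_closed butlast_append)
  qed
  have 3: "wgen (?f (xs @ [v \<triangleleft>\<^bsub>V\<^esub> s, w] @ ys)) = wgen (?f (xs @ [v, s \<odot>\<^bsub>V\<^esub> w] @ ys))"
    if "xs \<in> Vs" "ys \<in> Vs" "v \<in> carrier V" "w \<in> carrier V" "s \<in> carrier R"
    for xs ys v w s
  proof (cases ys rule: rev_cases)
    case Nil
    then show ?thesis
      using wgen_balanced [of xs "[]" v "w \<triangleleft>\<^bsub>V\<^esub> r" s] that r by (simp add: lr_comm r_closed butlast_append)
  next
    case (snoc ys' y)
    then show ?thesis
      using wgen_balanced [of xs "ys' @ [y \<triangleleft>\<^bsub>V\<^esub> r]" v w s] that r by (simp add: r_closed butlast_append)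
  qed
  show "(\<lambda>t. t \<triangleleft>\<^bsub>T\<^esub> r) \<in> add_hom T T"
    using word_induced_hom [of ?f, OF 1 2 3] by (simp add: add_hom_def T_rsmult_def)
  show "wgen (xs @ [x]) \<triangleleft>\<^bsub>T\<^esub> r = wgen (xs @ [x \<triangleleft>\<^bsub>V\<^esub> r])" if "x \<in> carrier V" "xs \<in> Vs"
    using word_induced_wgen [of ?f "xs @ [x]", OF 1 2 3] that by (simp add: T_rsmult_def)
qed

text \<open>Concatenation with a fixed word merely lengthens the prefix or the suffix of a relator,
  so it sends relators to relators in each argument.\<close>

lemma
  shows T_mult_biadditive: "biadditive T T T (mult T)"
    and T_mult_wgen: "\<lbrakk>xs \<noteq> []; ys \<noteq> []; xs \<in> Vs; ys \<in> Vs\<rbrakk>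
      \<Longrightarrow> wgen xs \<otimes>\<^bsub>T\<^esub> wgen ys = wgen (xs @ ys)"
proof -
  have 0: "xs @ ys \<in> words V" if "xs \<in> words V" "ys \<in> words V" for xs ys
    using that by (simp add: words_iff)
  have 1: "compatible (words V) (word_relations R V) T (\<lambda>xs. gen (words V) (word_relations R V) (xs @ zs))"
    if zs: "zs \<in> words V" for zs
    unfolding wgen_def [symmetric]
  proof (rule word_compatible [OF T.abelian_group_axioms])
    show "wgen ((xs @ [v \<oplus>\<^bsub>V\<^esub> w] @ ys) @ zs) = wgen ((xs @ [v] @ ys) @ zs) \<oplus>\<^bsub>T\<^esub> wgen ((xs @ [w] @ ys) @ zs)"
      if "xs \<in> Vs" "ys \<in> Vs" "v \<in> carrier V" "w \<in> carrier V" for xs ys v w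
      using wgen_add [of xs "ys @ zs" v w] that zs by (simp add: words_iff)
    show "wgen ((xs @ [v \<triangleleft>\<^bsub>V\<^esub> s, w] @ ys) @ zs) = wgen ((xs @ [v, s \<odot>\<^bsub>V\<^esub> w] @ ys) @ zs)"
      if "xs \<in> Vs" "ys \<in> Vs" "v \<in> carrier V" "w \<in> carrier V" "s \<in> carrier R"
      for xs ys v w s
      using wgen_balanced [of xs "ys @ zs" v w s] that zs by (simp add: words_iff)
  qed (use zs in \<open>simp add: words_iff wgen_closed\<close>)
  have 2: "compatible (words V) (word_relations R V) T (\<lambda>xs. gen (words V) (word_relations R V) (zs @ xs))"
    if zs: "zs \<in> words V" for zs
    unfolding wgen_def [symmetric]
  proof (rule word_compatible [OF T.abelian_group_axioms])
    show "wgen (zs @ (xs @ [v \<oplus>\<^bsub>V\<^esub> w] @ ys)) = wgen (zs @ (xs @ [v] @ ys)) \<oplus>\<^bsub>T\<^esub> wgen (zs @ (xs @ [w] @ ys))"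
      if "xs \<in> Vs" "ys \<in> Vs" "v \<in> carrier V" "w \<in> carrier V" for xs ys v w
      using wgen_add [of "zs @ xs" ys v w] that zs by (simp add: words_iff)
    show "wgen (zs @ (xs @ [v \<triangleleft>\<^bsub>V\<^esub> s, w] @ ys)) = wgen (zs @ (xs @ [v, s \<odot>\<^bsub>V\<^esub> w] @ ys))"
      if "xs \<in> Vs" "ys \<in> Vs" "v \<in> carrier V" "w \<in> carrier V" "s \<in> carrier R"
      for xs ys v w s
      using wgen_balanced [of "zs @ xs" ys v w s] that zs by (simp add: words_iff)
  qed (use zs in \<open>simp add: words_iff wgen_closed\<close>)
  note * = T_presents T_presents T_presents 0 1 2
  have T: "mult T = induced2 (word_null R V) (\<lambda>xs ys. xs @ ys)"
    by (simp add: fun_eq_iff T_mult_def)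
  show "biadditive T T T (mult T)"
    unfolding biadditive_def T word_null_def
    by (intro conjI ballI induced2_add_hom_left [OF *] induced2_add_hom_right [OF *])
  show "wgen xs \<otimes>\<^bsub>T\<^esub> wgen ys = wgen (xs @ ys)"
    if "xs \<noteq> []" "ys \<noteq> []" "xs \<in> Vs" "ys \<in> Vs"
    unfolding T word_null_def wgen_def
    by (rule induced2_gen [OF *]) (use that in \<open>simp_all add: words_iff\<close>)
qed

end

section \<open>The tensor algebra and its actions\<close>

lemma biadditive_post:
  assumes p: "biadditive M N G p" and h: "h \<in> add_hom G G'"
  shows "biadditive M N G' (\<lambda>x y. h (p x y))"
  unfolding biadditive_def
  by (intro conjI ballI add_hom_comp [OF _ h] biadditive_hom_right [OF p] biadditive_hom_left [OF p])

context ring_bimodule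
begin

text \<open>Additivity in the scalar is not built into the definition, where \<open>r\<close> is a
  parameter of the induced map. On a word it is additivity in the first letter.\<close>

lemma T_smult_biadditive: "biadditive R T T (smult T)"
  unfolding biadditive_def
proof (intro conjI ballI)
  show "smult T r \<in> add_hom T T" if "r \<in> carrier R" for r
    using that by (rule T_smult_hom)
  fix t assume t: "t \<in> carrier T"
  show "(\<lambda>r. r \<odot>\<^bsub>T\<^esub> t) \<in> add_hom R T"
  proof (rule add_homI)
    show "r \<odot>\<^bsub>T\<^esub> t \<in> carrier T" if "r \<in> carrier R" for r
      using T_smult_hom [OF that] t by (rule add_hom_closed)
    fix r s assume r: "r \<in> carrier R" and s: "s \<in> carrier R"
    show "(r \<oplus>\<^bsub>R\<^esub> s) \<odot>\<^bsub>T\<^esub> t = r \<odot>\<^bsub>T\<^esub> t \<oplus>\<^bsub>T\<^esub> s \<odot>\<^bsub>T\<^esub> t"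
    proof (rule word_hom_eqI [OF T.abelian_group_axioms T_smult_hom [OF R.a_closed [OF r s]]
          add_hom_plus [OF T.abelian_group_axioms T_smult_hom [OF r] T_smult_hom [OF s]] _ t])
      fix xs assume xs: "xs \<noteq> []" "xs \<in> Vs"
      then obtain y ys where "xs = y # ys" "y \<in> carrier V" "ys \<in> Vs" by (cases xs) auto
      then show "(r \<oplus>\<^bsub>R\<^esub> s) \<odot>\<^bsub>T\<^esub> wgen xs = r \<odot>\<^bsub>T\<^esub> wgen xs \<oplus>\<^bsub>T\<^esub> s \<odot>\<^bsub>T\<^esub> wgen xs"
        using wgen_add [of "[]" ys "r \<odot>\<^bsub>V\<^esub> y" "s \<odot>\<^bsub>V\<^esub> y"] r s
        by (simp add: T_smult_wgen l_add l_closed)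
    qed
  qed
qed

lemma T_rsmult_biadditive: "biadditive T R T (rsmult T)"
  unfolding biadditive_def
proof (intro conjI ballI)
  show "(\<lambda>t. t \<triangleleft>\<^bsub>T\<^esub> r) \<in> add_hom T T" if "r \<in> carrier R" for r
    using that by (rule T_rsmult_hom)
  fix t assume t: "t \<in> carrier T"
  show "rsmult T t \<in> add_hom R T"
  proof (rule add_homI)
    show "t \<triangleleft>\<^bsub>T\<^esub> r \<in> carrier T" if "r \<in> carrier R" for r
      using T_rsmult_hom [OF that] t by (rule add_hom_closed)
    fix r s assume r: "r \<in> carrier R" and s: "s \<in> carrier R"
    show "t \<triangleleft>\<^bsub>T\<^esub> (r \<oplus>\<^bsub>R\<^esub> s) = t \<triangleleft>\<^bsub>T\<^esub> r \<oplus>\<^bsub>T\<^esub> t \<triangleleft>\<^bsub>T\<^esub> s"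
    proof (rule word_hom_eqI [OF T.abelian_group_axioms T_rsmult_hom [OF R.a_closed [OF r s]]
          add_hom_plus [OF T.abelian_group_axioms T_rsmult_hom [OF r] T_rsmult_hom [OF s]] _ t])
      fix xs assume xs: "xs \<noteq> []" "xs \<in> Vs"
      then obtain y ys where "xs = ys @ [y]" "y \<in> carrier V" "ys \<in> Vs"
        by (cases xs rule: rev_cases) auto
      then show "wgen xs \<triangleleft>\<^bsub>T\<^esub> (r \<oplus>\<^bsub>R\<^esub> s) = wgen xs \<triangleleft>\<^bsub>T\<^esub> r \<oplus>\<^bsub>T\<^esub> wgen xs \<triangleleft>\<^bsub>T\<^esub> s"
        using wgen_add [of ys "[]" "y \<triangleleft>\<^bsub>V\<^esub> r" "y \<triangleleft>\<^bsub>V\<^esub> s"] r s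
        by (simp add: T_rsmult_wgen r_add r_closed)
    qed
  qed
qed

text \<open>For fixed scalars both sides of each axiom are additive in \<open>t\<close>, so words
  suffice, and on words the axiom concerns only the end letters.\<close>

lemma T_ring_bimodule: "ring_bimodule R T"
proof
  note L = T_smult_hom and R = T_rsmult_hom and T = T.abelian_group_axioms
  show "biadditive R T T (smult T)" by (rule T_smult_biadditive)
  show "biadditive T R T (rsmult T)" by (rule T_rsmult_biadditive)
  fix r s t assume r: "r \<in> carrier R" and s: "s \<in> carrier R" and t: "t \<in> carrier T"
  have rs: "r \<otimes>\<^bsub>R\<^esub> s \<in> carrier R" using r s by simp
  show "(r \<otimes>\<^bsub>R\<^esub> s) \<odot>\<^bsub>T\<^esub> t = r \<odot>\<^bsub>T\<^esub> (s \<odot>\<^bsub>T\<^esub> t)"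
  proof (rule word_hom_eqI [OF T L [OF rs] add_hom_comp [OF L [OF s] L [OF r]] _ t])
    fix xs assume "xs \<noteq> []" "xs \<in> Vs"
    then show "(r \<otimes>\<^bsub>R\<^esub> s) \<odot>\<^bsub>T\<^esub> wgen xs = r \<odot>\<^bsub>T\<^esub> (s \<odot>\<^bsub>T\<^esub> wgen xs)"
      using r s by (cases xs) (simp_all add: T_smult_wgen l_assoc l_closed)
  qed
  show "(t \<triangleleft>\<^bsub>T\<^esub> r) \<triangleleft>\<^bsub>T\<^esub> s = t \<triangleleft>\<^bsub>T\<^esub> (r \<otimes>\<^bsub>R\<^esub> s)"
  proof (rule word_hom_eqI [OF T add_hom_comp [OF R [OF r] R [OF s]] R [OF rs] _ t])
    fix xs assume "xs \<noteq> []" "xs \<in> Vs"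
    then show "(wgen xs \<triangleleft>\<^bsub>T\<^esub> r) \<triangleleft>\<^bsub>T\<^esub> s = wgen xs \<triangleleft>\<^bsub>T\<^esub> (r \<otimes>\<^bsub>R\<^esub> s)"
      using r s by (cases xs rule: rev_cases) (simp_all add: T_rsmult_wgen r_assoc r_closed)
  qed
  show "(r \<odot>\<^bsub>T\<^esub> t) \<triangleleft>\<^bsub>T\<^esub> s = r \<odot>\<^bsub>T\<^esub> (t \<triangleleft>\<^bsub>T\<^esub> s)"
  proof (rule word_hom_eqI [OF T add_hom_comp [OF L [OF r] R [OF s]] add_hom_comp [OF R [OF s] L [OF r]] _ t])
    fix xs assume xs: "xs \<noteq> []" "xs \<in> Vs"
    then obtain y ys where y: "xs = y # ys" "y \<in> carrier V" "ys \<in> Vs" by (cases xs) auto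
    show "(r \<odot>\<^bsub>T\<^esub> wgen xs) \<triangleleft>\<^bsub>T\<^esub> s = r \<odot>\<^bsub>T\<^esub> (wgen xs \<triangleleft>\<^bsub>T\<^esub> s)"
    \<comment> \<open>Only in a one-letter word do both actions meet the same letter, and there
      their commutation on \<open>V\<close> is used; otherwise they act on different
      letters.\<close>
    proof (cases ys rule: rev_cases)
      case Nil
      then show ?thesis
        using T_rsmult_wgen [of s "r \<odot>\<^bsub>V\<^esub> y" "[]"] T_rsmult_wgen [of s y "[]"] y r s
        by (simp add: T_smult_wgen l_closed r_closed lr_comm)
    next
      case (snoc zs z)
      then show ?thesis
        using T_rsmult_wgen [of s z "(r \<odot>\<^bsub>V\<^esub> y) # zs"] T_rsmult_wgen [of s z "y # zs"] y r s
        by (simp add: T_smult_wgen l_closed r_closed)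
    qed
  qed
next
  fix t assume t: "t \<in> carrier T"
  show "\<one>\<^bsub>R\<^esub> \<odot>\<^bsub>T\<^esub> t = t"
  proof (rule word_hom_eqI [OF T.abelian_group_axioms T_smult_hom [OF R.one_closed] add_hom_id _ t])
    fix xs assume "xs \<noteq> []" "xs \<in> Vs"
    then show "\<one>\<^bsub>R\<^esub> \<odot>\<^bsub>T\<^esub> wgen xs = wgen xs"
      by (cases xs) (simp_all add: T_smult_wgen l_one)
  qed
  show "t \<triangleleft>\<^bsub>T\<^esub> \<one>\<^bsub>R\<^esub> = t"
  proof (rule word_hom_eqI [OF T.abelian_group_axioms T_rsmult_hom [OF R.one_closed] add_hom_id _ t])
    fix xs assume "xs \<noteq> []" "xs \<in> Vs"
    then show "wgen xs \<triangleleft>\<^bsub>T\<^esub> \<one>\<^bsub>R\<^esub> = wgen xs"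
      by (cases xs rule: rev_cases) (simp_all add: T_rsmult_wgen r_one)
  qed
qed

lemma word_biadditive_eqI:
  assumes G: "abelian_group G" and f: "biadditive T T G f" and g: "biadditive T T G g"
    and eq: "\<And>xs ys. \<lbrakk>xs \<noteq> []; xs \<in> Vs; ys \<noteq> []; ys \<in> Vs\<rbrakk>
      \<Longrightarrow> f (wgen xs) (wgen ys) = g (wgen xs) (wgen ys)"
    and s: "s \<in> carrier T" and t: "t \<in> carrier T"
  shows "f s t = g s t"
proof (rule word_hom_eqI [OF G biadditive_hom_left [OF f t] biadditive_hom_left [OF g t] _ s])
  fix xs assume xs: "xs \<noteq> []" "xs \<in> Vs"
  note x = wgen_closed [OF xs]
  show "f (wgen xs) t = g (wgen xs) t"
    by (rule word_hom_eqI [OF G biadditive_hom_right [OF f x] biadditive_hom_right [OF g x] _ t])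
      (rule eq [OF xs])
qed

text \<open>The outer laws hold because the end letter of a product is an end letter of one factor.
  The middle law is the balancing relation at the junction of the two words.\<close>

lemma T_mult_smult:
  assumes r: "r \<in> carrier R" and s: "s \<in> carrier T" and t: "t \<in> carrier T"
  shows "(r \<odot>\<^bsub>T\<^esub> s) \<otimes>\<^bsub>T\<^esub> t = r \<odot>\<^bsub>T\<^esub> (s \<otimes>\<^bsub>T\<^esub> t)"
    and "(s \<triangleleft>\<^bsub>T\<^esub> r) \<otimes>\<^bsub>T\<^esub> t = s \<otimes>\<^bsub>T\<^esub> (r \<odot>\<^bsub>T\<^esub> t)"
    and "(s \<otimes>\<^bsub>T\<^esub> t) \<triangleleft>\<^bsub>T\<^esub> r = s \<otimes>\<^bsub>T\<^esub> (t \<triangleleft>\<^bsub>T\<^esub> r)"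
proof -
  note L = T_smult_hom [OF r] and R = T_rsmult_hom [OF r] and T = T.abelian_group_axioms
    and M = T_mult_biadditive
  show "(r \<odot>\<^bsub>T\<^esub> s) \<otimes>\<^bsub>T\<^esub> t = r \<odot>\<^bsub>T\<^esub> (s \<otimes>\<^bsub>T\<^esub> t)"
  proof (rule word_biadditive_eqI [OF T biadditive_comp [OF M L add_hom_id] biadditive_post [OF M L] _ s t])
    fix xs ys assume "xs \<noteq> []" "xs \<in> Vs" "ys \<noteq> []" "ys \<in> Vs"
    then show "(r \<odot>\<^bsub>T\<^esub> wgen xs) \<otimes>\<^bsub>T\<^esub> wgen ys = r \<odot>\<^bsub>T\<^esub> (wgen xs \<otimes>\<^bsub>T\<^esub> wgen ys)"
      using r by (cases xs) (simp_all add: T_mult_wgen T_smult_wgen l_closed)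
  qed
  show "(s \<triangleleft>\<^bsub>T\<^esub> r) \<otimes>\<^bsub>T\<^esub> t = s \<otimes>\<^bsub>T\<^esub> (r \<odot>\<^bsub>T\<^esub> t)"
  proof (rule word_biadditive_eqI [OF T biadditive_comp [OF M R add_hom_id]
        biadditive_comp [OF M add_hom_id L] _ s t])
    fix xs ys assume *: "xs \<noteq> []" "xs \<in> Vs" "ys \<noteq> []" "ys \<in> Vs"
    then obtain x xs' y ys' where "xs = xs' @ [x]" "ys = y # ys'"
      by (metis rev_exhaust list.exhaust)
    then show "(wgen xs \<triangleleft>\<^bsub>T\<^esub> r) \<otimes>\<^bsub>T\<^esub> wgen ys = wgen xs \<otimes>\<^bsub>T\<^esub> (r \<odot>\<^bsub>T\<^esub> wgen ys)"
      using r * wgen_balanced [of xs' ys' x y r]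
      by (simp add: T_mult_wgen T_smult_wgen T_rsmult_wgen l_closed r_closed)
  qed
  show "(s \<otimes>\<^bsub>T\<^esub> t) \<triangleleft>\<^bsub>T\<^esub> r = s \<otimes>\<^bsub>T\<^esub> (t \<triangleleft>\<^bsub>T\<^esub> r)"
  proof (rule word_biadditive_eqI [OF T biadditive_post [OF M R] biadditive_comp [OF M add_hom_id R] _ s t])
    fix xs ys assume *: "xs \<noteq> []" "xs \<in> Vs" "ys \<noteq> []" "ys \<in> Vs"
    then obtain y ys' where "ys = ys' @ [y]"
      by (metis rev_exhaust)
    then show "(wgen xs \<otimes>\<^bsub>T\<^esub> wgen ys) \<triangleleft>\<^bsub>T\<^esub> r = wgen xs \<otimes>\<^bsub>T\<^esub> (wgen ys \<triangleleft>\<^bsub>T\<^esub> r)"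
      using r * T_rsmult_wgen [of r y "xs @ ys'"]
      by (simp add: T_mult_wgen T_rsmult_wgen r_closed)
  qed
qed

text \<open>Three reductions to words, two by the biadditive rule and one by the additive rule,
  leave the associativity of list concatenation.\<close>

lemma T_mult_assoc:
  assumes s: "s \<in> carrier T" and t: "t \<in> carrier T" and u: "u \<in> carrier T"
  shows "(s \<otimes>\<^bsub>T\<^esub> t) \<otimes>\<^bsub>T\<^esub> u = s \<otimes>\<^bsub>T\<^esub> (t \<otimes>\<^bsub>T\<^esub> u)"
proof -
  note T = T.abelian_group_axioms and M = T_mult_biadditive
  note Mr = biadditive_hom_right [OF M] and Ml = biadditive_hom_left [OF M]
  show ?thesis
  proof (rule word_biadditive_eqI [OF T biadditive_post [OF M Ml [OF u]]
        biadditive_comp [OF M add_hom_id Ml [OF u]] _ s t])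
    fix xs ys assume *: "xs \<noteq> []" "xs \<in> Vs" "ys \<noteq> []" "ys \<in> Vs"
    note c = wgen_closed [OF *(1,2)] wgen_closed [OF *(3,4)]
    show "(wgen xs \<otimes>\<^bsub>T\<^esub> wgen ys) \<otimes>\<^bsub>T\<^esub> u = wgen xs \<otimes>\<^bsub>T\<^esub> (wgen ys \<otimes>\<^bsub>T\<^esub> u)"
    proof (rule word_hom_eqI [OF T Mr [OF biadditive_closed [OF M c]]
          add_hom_comp [OF Mr [OF c(2)] Mr [OF c(1)]] _ u])
      fix zs assume "zs \<noteq> []" "zs \<in> Vs"
      then show "(wgen xs \<otimes>\<^bsub>T\<^esub> wgen ys) \<otimes>\<^bsub>T\<^esub> wgen zs = wgen xs \<otimes>\<^bsub>T\<^esub> (wgen ys \<otimes>\<^bsub>T\<^esub> wgen zs)"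
        using * by (simp add: T_mult_wgen)
    qed
  qed
qed

section \<open>The tensor algebra as a ring generated in degrees zero and one\<close>

abbreviation B where "B \<equiv> tensor_algebra R V"

lemma B_simps:
  "carrier B = carrier R \<times> carrier T"
  "(r, s) \<oplus>\<^bsub>B\<^esub> (r', s') = (r \<oplus>\<^bsub>R\<^esub> r', s \<oplus>\<^bsub>T\<^esub> s')"
  "\<zero>\<^bsub>B\<^esub> = (\<zero>\<^bsub>R\<^esub>, \<zero>\<^bsub>T\<^esub>)" "\<one>\<^bsub>B\<^esub> = (\<one>\<^bsub>R\<^esub>, \<zero>\<^bsub>T\<^esub>)"
  "(r, s) \<otimes>\<^bsub>B\<^esub> (r', s') = (r \<otimes>\<^bsub>R\<^esub> r', (r \<odot>\<^bsub>T\<^esub> s') \<oplus>\<^bsub>T\<^esub> (s \<triangleleft>\<^bsub>T\<^esub> r') \<oplus>\<^bsub>T\<^esub> (s \<otimes>\<^bsub>T\<^esub> s'))"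
  by (simp_all add: tensor_algebra_def Let_def)

lemma T_zero_simps:
  shows "r \<in> carrier R \<Longrightarrow> r \<odot>\<^bsub>T\<^esub> \<zero>\<^bsub>T\<^esub> = \<zero>\<^bsub>T\<^esub>" "r \<in> carrier R \<Longrightarrow> \<zero>\<^bsub>T\<^esub> \<triangleleft>\<^bsub>T\<^esub> r = \<zero>\<^bsub>T\<^esub>" "s \<in> carrier T \<Longrightarrow> s \<otimes>\<^bsub>T\<^esub> \<zero>\<^bsub>T\<^esub> = \<zero>\<^bsub>T\<^esub>" "s \<in> carrier T \<Longrightarrow> \<zero>\<^bsub>T\<^esub> \<otimes>\<^bsub>T\<^esub> s = \<zero>\<^bsub>T\<^esub>"
    "s \<in> carrier T \<Longrightarrow> \<zero>\<^bsub>R\<^esub> \<odot>\<^bsub>T\<^esub> s = \<zero>\<^bsub>T\<^esub>" "s \<in> carrier T \<Longrightarrow> s \<triangleleft>\<^bsub>T\<^esub> \<zero>\<^bsub>R\<^esub> = \<zero>\<^bsub>T\<^esub>"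
proof -
  note z = add_hom_zero [OF T.abelian_group_axioms T.abelian_group_axioms]
    and zR = add_hom_zero [OF R.abelian_group_axioms T.abelian_group_axioms]
  show "r \<odot>\<^bsub>T\<^esub> \<zero>\<^bsub>T\<^esub> = \<zero>\<^bsub>T\<^esub>" if r: "r \<in> carrier R" by (rule z [OF T_smult_hom [OF r]])
  show "\<zero>\<^bsub>T\<^esub> \<triangleleft>\<^bsub>T\<^esub> r = \<zero>\<^bsub>T\<^esub>" if r: "r \<in> carrier R" by (rule z [OF T_rsmult_hom [OF r]])
  show "s \<otimes>\<^bsub>T\<^esub> \<zero>\<^bsub>T\<^esub> = \<zero>\<^bsub>T\<^esub>" if s: "s \<in> carrier T" by (rule z [OF biadditive_hom_right [OF T_mult_biadditive s]])
  show "\<zero>\<^bsub>T\<^esub> \<otimes>\<^bsub>T\<^esub> s = \<zero>\<^bsub>T\<^esub>" if s: "s \<in> carrier T" by (rule z [OF biadditive_hom_left [OF T_mult_biadditive s]])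
  show "\<zero>\<^bsub>R\<^esub> \<odot>\<^bsub>T\<^esub> s = \<zero>\<^bsub>T\<^esub>" if s: "s \<in> carrier T" by (rule zR [OF biadditive_hom_left [OF T_smult_biadditive s]])
  show "s \<triangleleft>\<^bsub>T\<^esub> \<zero>\<^bsub>R\<^esub> = \<zero>\<^bsub>T\<^esub>" if s: "s \<in> carrier T" by (rule zR [OF biadditive_hom_right [OF T_rsmult_biadditive s]])
qed

text \<open>A pair \<open>(r, s)\<close> stands for the sum of its degree-zero part and its part of
  positive degree. Expanding products leaves the ring axioms of \<open>R\<close>, the bimodule
  axioms of \<open>T\<close>, the laws of \<open>T_mult_smult\<close> and associativity of
  concatenation.\<close>

lemma B_ring: "ring B"
proof (rule ringI)
  interpret TB: ring_bimodule R T by (rule T_ring_bimodule)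
  note M = T_mult_biadditive
  note closed = TB.l_closed TB.r_closed biadditive_closed [OF M]
  note distr = TB.l_add TB.l_add_right TB.r_add TB.r_add_left biadditive_left [OF M] biadditive_right [OF M]
  note assoc = TB.l_assoc TB.r_assoc TB.lr_comm T_mult_smult T_mult_assoc
  show "abelian_group B"
  proof (rule abelian_groupI)
    show "\<exists>y \<in> carrier B. y \<oplus>\<^bsub>B\<^esub> x = \<zero>\<^bsub>B\<^esub>" if "x \<in> carrier B" for x
      using that
      by (intro bexI [of _ "(\<ominus>\<^bsub>R\<^esub> fst x, \<ominus>\<^bsub>T\<^esub> snd x)"]) (auto simp: B_simps R.l_neg T.l_neg)
  qed (auto simp: B_simps R.a_ac T.a_ac)
  show "monoid B"
  proof
    fix x y z assume "x \<in> carrier B" "y \<in> carrier B" "z \<in> carrier B"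
    then obtain r s r' s' r'' s'' where *: "x = (r, s)" "y = (r', s')" "z = (r'', s'')"
      "r \<in> carrier R" "s \<in> carrier T" "r' \<in> carrier R" "s' \<in> carrier T" "r'' \<in> carrier R" "s'' \<in> carrier T"
      by (cases x; cases y; cases z) (auto simp: B_simps)
    show "x \<otimes>\<^bsub>B\<^esub> y \<otimes>\<^bsub>B\<^esub> z = x \<otimes>\<^bsub>B\<^esub> (y \<otimes>\<^bsub>B\<^esub> z)"
      using *(4-) unfolding *(1-3)
      by (simp add: B_simps distr closed assoc R.m_assoc T.a_ac)
  qed (auto simp: B_simps closed TB.l_one TB.r_one T_zero_simps)
  show "(x \<oplus>\<^bsub>B\<^esub> y) \<otimes>\<^bsub>B\<^esub> z = x \<otimes>\<^bsub>B\<^esub> z \<oplus>\<^bsub>B\<^esub> y \<otimes>\<^bsub>B\<^esub> z"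
    if "x \<in> carrier B" "y \<in> carrier B" "z \<in> carrier B" for x y z
    using that by (cases x; cases y; cases z) (simp add: B_simps distr closed R.l_distr T.a_ac)
  show "z \<otimes>\<^bsub>B\<^esub> (x \<oplus>\<^bsub>B\<^esub> y) = z \<otimes>\<^bsub>B\<^esub> x \<oplus>\<^bsub>B\<^esub> z \<otimes>\<^bsub>B\<^esub> y"
    if "x \<in> carrier B" "y \<in> carrier B" "z \<in> carrier B" for x y z
    using that by (cases x; cases y; cases z) (simp add: B_simps distr closed R.r_distr T.a_ac)
qed

text \<open>\<open>inR\<close> and \<open>inV\<close> include degree zero and degree one; together
  their images generate the algebra, and all later work with it goes through them.\<close>

definition inR where "inR r = (r, \<zero>\<^bsub>T\<^esub>)"
definition inV where "inV v = (\<zero>\<^bsub>R\<^esub>, wgen [v])"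

lemma inR_simps:
  "r \<in> carrier R \<Longrightarrow> inR r \<in> carrier B" "inR \<one>\<^bsub>R\<^esub> = \<one>\<^bsub>B\<^esub>"
  "\<lbrakk>r \<in> carrier R; s \<in> carrier R\<rbrakk> \<Longrightarrow> inR (r \<otimes>\<^bsub>R\<^esub> s) = inR r \<otimes>\<^bsub>B\<^esub> inR s"
  "\<lbrakk>r \<in> carrier R; s \<in> carrier R\<rbrakk> \<Longrightarrow> inR (r \<oplus>\<^bsub>R\<^esub> s) = inR r \<oplus>\<^bsub>B\<^esub> inR s"
  by (simp_all add: inR_def B_simps T_zero_simps)

text \<open>These are the defining relations of the tensor algebra: multiplication by degree zero
  reproduces the bimodule structure of \<open>V\<close>.\<close>

lemma inV_simps:
  "v \<in> carrier V \<Longrightarrow> inV v \<in> carrier B"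
  "\<lbrakk>v \<in> carrier V; w \<in> carrier V\<rbrakk> \<Longrightarrow> inV (v \<oplus>\<^bsub>V\<^esub> w) = inV v \<oplus>\<^bsub>B\<^esub> inV w"
  "\<lbrakk>r \<in> carrier R; v \<in> carrier V\<rbrakk> \<Longrightarrow> inV (r \<odot>\<^bsub>V\<^esub> v) = inR r \<otimes>\<^bsub>B\<^esub> inV v"
  "\<lbrakk>r \<in> carrier R; v \<in> carrier V\<rbrakk> \<Longrightarrow> inV (v \<triangleleft>\<^bsub>V\<^esub> r) = inV v \<otimes>\<^bsub>B\<^esub> inR r"
  using wgen_add [of "[]" "[]" v w] T_rsmult_wgen [of r v "[]"]
  by (simp_all add: inR_def inV_def B_simps T_zero_simps wgen_closed T_smult_wgen l_closed r_closed)

text \<open>An element is a degree-zero term plus a combination of words, and a word is the product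
  of its letters; so sums, negatives and products of the generators exhaust the algebra.\<close>

lemma B_induct [consumes 1, case_names inR inV add inv mult]:
  assumes b: "b \<in> carrier B" and R: "\<And>r. r \<in> carrier R \<Longrightarrow> P (inR r)" and V: "\<And>v. v \<in> carrier V \<Longrightarrow> P (inV v)"
    and add: "\<And>b c. \<lbrakk>b \<in> carrier B; c \<in> carrier B; P b; P c\<rbrakk> \<Longrightarrow> P (b \<oplus>\<^bsub>B\<^esub> c)"
    and inv: "\<And>b. \<lbrakk>b \<in> carrier B; P b\<rbrakk> \<Longrightarrow> P (\<ominus>\<^bsub>B\<^esub> b)"
    and mult: "\<And>b c. \<lbrakk>b \<in> carrier B; c \<in> carrier B; P b; P c\<rbrakk> \<Longrightarrow> P (b \<otimes>\<^bsub>B\<^esub> c)"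
  shows "P b"
proof -
  interpret B: ring B by (rule B_ring)
  have 0: "(\<zero>\<^bsub>R\<^esub>, t) \<in> carrier B" if "t \<in> carrier T" for t
    using that by (simp add: B_simps)
  have T: "P (\<zero>\<^bsub>R\<^esub>, t)" if "t \<in> carrier T" for t
    using that
  proof (induction rule: presents_induct [OF T_presents, consumes 1, case_names zero gen add inv])
    case zero
    show ?case using R [of "\<zero>\<^bsub>R\<^esub>"] by (simp add: inR_def)
  next
    case (gen xs)
    then have "xs \<noteq> []" "xs \<in> Vs" by (simp_all add: words_iff)
    then show ?case
      unfolding wgen_def [symmetric]
    proof (induction xs rule: list_nonempty_induct)
      case (single x)
      then show ?case using V [of x] by (simp add: inV_def)
    next
      case (cons x xs)
      then have x: "x \<in> carrier V" "xs \<in> Vs" by simp_all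
      \<comment> \<open>Splitting off the first letter as a factor; the cross terms with the zero
        components vanish.\<close>
      have "(\<zero>\<^bsub>R\<^esub>, wgen (x # xs)) = inV x \<otimes>\<^bsub>B\<^esub> (\<zero>\<^bsub>R\<^esub>, wgen xs)"
        using cons.hyps x
        by (simp add: inV_def B_simps T_zero_simps wgen_closed T_mult_wgen)
      then show ?case
        using mult [of "inV x" "(\<zero>\<^bsub>R\<^esub>, wgen xs)"] V [OF x(1)] cons x
        by (simp add: inV_simps 0 wgen_closed)
    qed
  next
    case (add s t)
    then show ?case
      using assms(4) [of "(\<zero>\<^bsub>R\<^esub>, s)" "(\<zero>\<^bsub>R\<^esub>, t)"] by (simp add: B_simps)
  next
    case (inv s)
    have "\<ominus>\<^bsub>B\<^esub> (\<zero>\<^bsub>R\<^esub>, s) = (\<zero>\<^bsub>R\<^esub>, \<ominus>\<^bsub>T\<^esub> s)"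
      using inv by (intro B.minus_equality) (simp_all add: B_simps T.l_neg)
    then show ?case
      using assms(5) [of "(\<zero>\<^bsub>R\<^esub>, s)"] inv by (simp add: B_simps)
  qed
  obtain r s where b': "b = (r, s)" "r \<in> carrier R" "s \<in> carrier T"
    using b by (cases b) (simp add: B_simps)
  then have "b = inR r \<oplus>\<^bsub>B\<^esub> (\<zero>\<^bsub>R\<^esub>, s)"
    by (simp add: inR_def B_simps)
  then show ?thesis
    using add [of "inR r" "(\<zero>\<^bsub>R\<^esub>, s)"] R [OF b'(2)] T [OF b'(3)] b'
    by (simp add: inR_simps 0)
qed

end

section \<open>Modules over the tensor algebra determined by the generators\<close>

lemma is_action_simps:
  assumes "is_action R N f"
  shows "biadditive R N N f"
    and "\<lbrakk>r \<in> carrier R; s \<in> carrier R; n \<in> carrier N\<rbrakk> \<Longrightarrow> f (r \<otimes>\<^bsub>R\<^esub> s) n = f r (f s n)"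
    and "n \<in> carrier N \<Longrightarrow> f \<one>\<^bsub>R\<^esub> n = n"
  using assms by (simp_all add: is_action_def)

context ring_bimodule
begin

text \<open>The elements whose action commutes with \<open>h\<close> are closed under sums,
  negatives and products, so it is enough to know the generators. With \<open>h\<close> the identity
  this compares two actions, otherwise it tests linearity of a map.\<close>

lemma action_hom_generated:
  assumes N: "abelian_group N" and N': "abelian_group N'"
    and f: "is_action B N f" and f': "is_action B N' f'" and h: "h \<in> add_hom N N'"
    and R: "\<And>r n. \<lbrakk>r \<in> carrier R; n \<in> carrier N\<rbrakk> \<Longrightarrow> h (f (inR r) n) = f' (inR r) (h n)"
    and V: "\<And>v n. \<lbrakk>v \<in> carrier V; n \<in> carrier N\<rbrakk> \<Longrightarrow> h (f (inV v) n) = f' (inV v) (h n)"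
    and b: "b \<in> carrier B" and n: "n \<in> carrier N"
  shows "h (f b n) = f' b (h n)"
proof -
  interpret B: ring B by (rule B_ring)
  note fb = is_action_simps(1) [OF f] and fb' = is_action_simps(1) [OF f']
  note fc = biadditive_closed [OF fb] and hc = add_hom_closed [OF h]
  \<comment> \<open>The vector is generalized because the product case applies the claim for
    \<open>b\<close> to the vector \<open>f c n\<close>.\<close>
  have "\<forall>n \<in> carrier N. h (f b n) = f' b (h n)"
    using b
  proof (induction rule: B_induct)
    case (add b c)
    then show ?case
      by (simp add: biadditive_left [OF fb] biadditive_left [OF fb'] add_hom_add [OF h] fc hc)
  next
    case (inv b)
    then show ?case
      by (simp add: add_hom_inv [OF B.abelian_group_axioms N biadditive_hom_left [OF fb]]
          add_hom_inv [OF B.abelian_group_axioms N' biadditive_hom_left [OF fb']]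
          add_hom_inv [OF N N' h] fc hc)
  next
    case (mult b c)
    then show ?case
      by (simp add: is_action_simps(2) [OF f] is_action_simps(2) [OF f'] fc hc)
  qed (use R V in auto)
  then show ?thesis using n by blast
qed

end

text \<open>The data of the universal property for modules: an action \<alpha> of the base ring and
  operators \<beta> indexed by \<open>V\<close> that turn the bimodule actions on \<open>V\<close>
  into composition with \<alpha> on either side.\<close>

locale tensor_algebra_action = ring_bimodule R V + N?: abelian_group N
  for R :: "('r, 'x) ring_scheme" and V :: "('r, 'v, 'y) bimodule_scheme"
    and N :: "('n, 'z) ring_scheme" and \<alpha> :: "'r \<Rightarrow> 'n \<Rightarrow> 'n" and \<beta> :: "'v \<Rightarrow> 'n \<Rightarrow> 'n" +
  assumes \<alpha>: "is_action R N \<alpha>" and \<beta>: "biadditive V N N \<beta>"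
    and \<beta>_l: "\<lbrakk>r \<in> carrier R; v \<in> carrier V; n \<in> carrier N\<rbrakk> \<Longrightarrow> \<beta> (r \<odot>\<^bsub>V\<^esub> v) n = \<alpha> r (\<beta> v n)"
    and \<beta>_r: "\<lbrakk>r \<in> carrier R; v \<in> carrier V; n \<in> carrier N\<rbrakk> \<Longrightarrow> \<beta> (v \<triangleleft>\<^bsub>V\<^esub> r) n = \<beta> v (\<alpha> r n)"
begin

text \<open>A word acts by composing the operators of its letters, the last letter first. Degree
  zero is added separately in \<open>act\<close>, since \<open>T\<close> consists of combinations of
  nonempty words.\<close>

definition wact where "wact t n = lift (words V) (word_relations R V) T N (\<lambda>xs. foldr \<beta> xs n) t"
definition act where "act b n = \<alpha> (fst b) n \<oplus>\<^bsub>N\<^esub> wact (snd b) n"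

lemmas \<alpha>_biadd = is_action_simps(1) [OF \<alpha>]
lemmas \<alpha>_closed = biadditive_closed [OF \<alpha>_biadd]
lemmas \<beta>_closed = biadditive_closed [OF \<beta>]

lemma foldr_hom: "xs \<in> Vs \<Longrightarrow> (\<lambda>n. foldr \<beta> xs n) \<in> add_hom N N"
proof (induction xs)
  case Nil
  show ?case using add_hom_id by simp
next
  case (Cons x xs)
  then have "x \<in> carrier V" "(\<lambda>n. foldr \<beta> xs n) \<in> add_hom N N" by auto
  from add_hom_comp [OF this(2) biadditive_hom_right [OF \<beta> this(1)]] show ?case by simp
qed

text \<open>For a balancing relator both words apply \<alpha> of the scalar between the operators of
  \<open>v\<close> and \<open>w\<close>: \<open>\<beta>_r\<close> moves it out of \<open>v\<close>,
  \<open>\<beta>_l\<close> out of \<open>w\<close>.\<close>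

lemma
  assumes n: "n \<in> carrier N"
  shows wact_hom: "(\<lambda>t. wact t n) \<in> add_hom T N"
    and wact_wgen: "\<lbrakk>xs \<noteq> []; xs \<in> Vs\<rbrakk> \<Longrightarrow> wact (wgen xs) n = foldr \<beta> xs n"
proof -
  let ?f = "\<lambda>xs. foldr \<beta> xs n"
  note fh = foldr_hom and fc = add_hom_closed [OF foldr_hom n]
  have 1: "?f xs \<in> carrier N" if "xs \<noteq> []" "xs \<in> Vs" for xs
    using that fc by simp
  have 2: "?f (xs @ [v \<oplus>\<^bsub>V\<^esub> w] @ ys) = ?f (xs @ [v] @ ys) \<oplus>\<^bsub>N\<^esub> ?f (xs @ [w] @ ys)"
    if "xs \<in> Vs" "ys \<in> Vs" "v \<in> carrier V" "w \<in> carrier V" for xs ys v w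
    using that fc [of ys] by (simp add: biadditive_left [OF \<beta>] add_hom_add [OF foldr_hom] \<beta>_closed)
  have 3: "?f (xs @ [v \<triangleleft>\<^bsub>V\<^esub> s, w] @ ys) = ?f (xs @ [v, s \<odot>\<^bsub>V\<^esub> w] @ ys)"
    if "xs \<in> Vs" "ys \<in> Vs" "v \<in> carrier V" "w \<in> carrier V" "s \<in> carrier R"
    for xs ys v w s
    using that fc [of ys] by (simp add: \<beta>_l \<beta>_r \<beta>_closed)
  show "(\<lambda>t. wact t n) \<in> add_hom T N"
    unfolding wact_def using word_lift_hom [OF N.abelian_group_axioms 1 2 3] by blast
  show "wact (wgen xs) n = ?f xs" if "xs \<noteq> []" "xs \<in> Vs"
    unfolding wact_def using word_lift_wgen [OF N.abelian_group_axioms 1 2 3 that] by blast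
qed

lemma wact_biadditive: "biadditive T N N wact"
proof (rule biadditiveI)
  show "wact s n \<in> carrier N" if "s \<in> carrier T" "n \<in> carrier N" for s n
    using wact_hom [OF that(2)] that(1) by (rule add_hom_closed)
  show "wact (s \<oplus>\<^bsub>T\<^esub> t) n = wact s n \<oplus>\<^bsub>N\<^esub> wact t n"
    if "s \<in> carrier T" "t \<in> carrier T" "n \<in> carrier N" for s t n
    using wact_hom [OF that(3)] that(1,2) by (rule add_hom_add)
  fix s n n' assume s: "s \<in> carrier T" and n: "n \<in> carrier N" and n': "n' \<in> carrier N"
  show "wact s (n \<oplus>\<^bsub>N\<^esub> n') = wact s n \<oplus>\<^bsub>N\<^esub> wact s n'"
  proof (rule word_hom_eqI [OF N.abelian_group_axioms wact_hom [OF N.a_closed [OF n n']]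
        add_hom_plus [OF N.abelian_group_axioms wact_hom [OF n] wact_hom [OF n']] _ s])
    fix xs assume xs: "xs \<noteq> []" "xs \<in> Vs"
    then show "wact (wgen xs) (n \<oplus>\<^bsub>N\<^esub> n') = wact (wgen xs) n \<oplus>\<^bsub>N\<^esub> wact (wgen xs) n'"
      using n n' by (simp add: wact_wgen add_hom_add [OF foldr_hom])
  qed
qed

lemmas wact_closed = biadditive_closed [OF wact_biadditive]

lemma wact_smult:
  assumes r: "r \<in> carrier R" and t: "t \<in> carrier T" and n: "n \<in> carrier N"
  shows "wact (r \<odot>\<^bsub>T\<^esub> t) n = \<alpha> r (wact t n)" and "wact (t \<triangleleft>\<^bsub>T\<^esub> r) n = wact t (\<alpha> r n)"
proof -
  show "wact (r \<odot>\<^bsub>T\<^esub> t) n = \<alpha> r (wact t n)"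
  proof (rule word_hom_eqI [OF N.abelian_group_axioms add_hom_comp [OF T_smult_hom [OF r] wact_hom [OF n]]
        add_hom_comp [OF wact_hom [OF n] biadditive_hom_right [OF \<alpha>_biadd r]] _ t])
    fix xs assume xs: "xs \<noteq> []" "xs \<in> Vs"
    then obtain y ys where "xs = y # ys" "y \<in> carrier V" "ys \<in> Vs" by (cases xs) auto
    then show "wact (r \<odot>\<^bsub>T\<^esub> wgen xs) n = \<alpha> r (wact (wgen xs) n)"
      using r n by (simp add: T_smult_wgen wact_wgen l_closed \<beta>_l add_hom_closed [OF foldr_hom])
  qed
  show "wact (t \<triangleleft>\<^bsub>T\<^esub> r) n = wact t (\<alpha> r n)"
  proof (rule word_hom_eqI [OF N.abelian_group_axioms add_hom_comp [OF T_rsmult_hom [OF r] wact_hom [OF n]]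
        wact_hom [OF \<alpha>_closed [OF r n]] _ t])
    fix xs assume xs: "xs \<noteq> []" "xs \<in> Vs"
    then obtain y ys where "xs = ys @ [y]" "y \<in> carrier V" "ys \<in> Vs"
      by (cases xs rule: rev_cases) auto
    then show "wact (wgen xs \<triangleleft>\<^bsub>T\<^esub> r) n = wact (wgen xs) (\<alpha> r n)"
      using r n by (simp add: T_rsmult_wgen wact_wgen r_closed \<beta>_r \<alpha>_closed)
  qed
qed

lemma wact_mult:
  assumes s: "s \<in> carrier T" and t: "t \<in> carrier T" and n: "n \<in> carrier N"
  shows "wact (s \<otimes>\<^bsub>T\<^esub> t) n = wact s (wact t n)"
proof (rule word_biadditive_eqI [OF N.abelian_group_axioms biadditive_post [OF T_mult_biadditive wact_hom [OF n]]
      biadditive_comp [OF wact_biadditive add_hom_id wact_hom [OF n]] _ s t])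
  fix xs ys assume *: "xs \<noteq> []" "xs \<in> Vs" "ys \<noteq> []" "ys \<in> Vs"
  show "wact (wgen xs \<otimes>\<^bsub>T\<^esub> wgen ys) n = wact (wgen xs) (wact (wgen ys) n)"
    using * n add_hom_closed [OF foldr_hom [of ys] n] by (simp add: T_mult_wgen wact_wgen)
qed

text \<open>Letting \<open>(r, s)\<close> act after \<open>(r', s')\<close> produces four terms,
  matching the four terms of the product in the algebra by \<open>wact_smult\<close> and
  \<open>wact_mult\<close>.\<close>

lemma act_action: "is_action B N act"
  unfolding is_action_def
proof (intro conjI ballI)
  note wl = biadditive_left [OF wact_biadditive] and wr = biadditive_right [OF wact_biadditive]
  note al = biadditive_left [OF \<alpha>_biadd] and ar = biadditive_right [OF \<alpha>_biadd]
  interpret TB: ring_bimodule R T by (rule T_ring_bimodule)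
  note closed = TB.l_closed TB.r_closed biadditive_closed [OF T_mult_biadditive] wact_closed \<alpha>_closed
  show "biadditive B N N act"
  proof (rule biadditiveI)
    show "act b n \<in> carrier N" if "b \<in> carrier B" "n \<in> carrier N" for b n
      using that by (cases b) (simp add: act_def B_simps closed)
    show "act (b \<oplus>\<^bsub>B\<^esub> c) n = act b n \<oplus>\<^bsub>N\<^esub> act c n"
      if "b \<in> carrier B" "c \<in> carrier B" "n \<in> carrier N" for b c n
      using that by (cases b; cases c) (simp add: act_def B_simps closed wl al N.a_ac)
    show "act b (n \<oplus>\<^bsub>N\<^esub> n') = act b n \<oplus>\<^bsub>N\<^esub> act b n'"
      if "b \<in> carrier B" "n \<in> carrier N" "n' \<in> carrier N" for b n n'
      using that by (cases b) (simp add: act_def B_simps closed wr ar N.a_ac)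
  qed
  show "act (b \<otimes>\<^bsub>B\<^esub> c) n = act b (act c n)"
    if "b \<in> carrier B" "c \<in> carrier B" "n \<in> carrier N" for b c n
    using that
    by (cases b; cases c)
      (simp add: act_def B_simps closed wl wr al ar N.a_ac wact_smult wact_mult is_action_simps(2) [OF \<alpha>])
  show "act \<one>\<^bsub>B\<^esub> n = n" if "n \<in> carrier N" for n
    using that add_hom_zero [OF T.abelian_group_axioms N.abelian_group_axioms wact_hom [OF that]]
    by (simp add: act_def B_simps is_action_simps(3) [OF \<alpha>])
qed

lemma act_inR: "\<lbrakk>r \<in> carrier R; n \<in> carrier N\<rbrakk> \<Longrightarrow> act (inR r) n = \<alpha> r n"
  using add_hom_zero [OF T.abelian_group_axioms N.abelian_group_axioms wact_hom]
  by (simp add: act_def inR_def \<alpha>_closed)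

lemma act_inV: "\<lbrakk>v \<in> carrier V; n \<in> carrier N\<rbrakk> \<Longrightarrow> act (inV v) n = \<beta> v n"
  using add_hom_zero [OF R.abelian_group_axioms N.abelian_group_axioms biadditive_hom_left [OF \<alpha>_biadd]]
  by (simp add: act_def inV_def \<beta>_closed wact_wgen)

end

section \<open>Duals, the enveloping algebra and dual pairs\<close>

context algebra_bimodule
begin

lemma scalar_closed: "k \<in> carrier K \<Longrightarrow> k \<odot>\<^bsub>A\<^esub> \<one>\<^bsub>A\<^esub> \<in> carrier A"
  by simp

lemma scalar_mult:
  assumes "k \<in> carrier K" "a \<in> carrier A"
  shows "k \<odot>\<^bsub>A\<^esub> a = (k \<odot>\<^bsub>A\<^esub> \<one>\<^bsub>A\<^esub>) \<otimes>\<^bsub>A\<^esub> a" and "k \<odot>\<^bsub>A\<^esub> a = a \<otimes>\<^bsub>A\<^esub> (k \<odot>\<^bsub>A\<^esub> \<one>\<^bsub>A\<^esub>)"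
  using assms smult_mult_left [of k "\<one>\<^bsub>A\<^esub>" a] smult_mult_right [of k a "\<one>\<^bsub>A\<^esub>"] by simp_all

text \<open>In each case a scalar is pulled to the far left, using that its image in
  \<open>A\<close> is central and acts equally from both sides. These are the rules behind every
  balancing over \<open>K\<close> in the enveloping algebra's actions.\<close>

lemma scalar_simps:
  assumes k: "k \<in> carrier K" and a: "a \<in> carrier A" and m: "m \<in> carrier M"
  shows "(k \<odot>\<^bsub>A\<^esub> a) \<odot>\<^bsub>M\<^esub> m = (k \<odot>\<^bsub>A\<^esub> \<one>\<^bsub>A\<^esub>) \<odot>\<^bsub>M\<^esub> (a \<odot>\<^bsub>M\<^esub> m)"
    and "a \<odot>\<^bsub>M\<^esub> ((k \<odot>\<^bsub>A\<^esub> \<one>\<^bsub>A\<^esub>) \<odot>\<^bsub>M\<^esub> m) = (k \<odot>\<^bsub>A\<^esub> \<one>\<^bsub>A\<^esub>) \<odot>\<^bsub>M\<^esub> (a \<odot>\<^bsub>M\<^esub> m)"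
    and "m \<triangleleft>\<^bsub>M\<^esub> (k \<odot>\<^bsub>A\<^esub> a) = (k \<odot>\<^bsub>A\<^esub> \<one>\<^bsub>A\<^esub>) \<odot>\<^bsub>M\<^esub> (m \<triangleleft>\<^bsub>M\<^esub> a)"
    and "((k \<odot>\<^bsub>A\<^esub> \<one>\<^bsub>A\<^esub>) \<odot>\<^bsub>M\<^esub> m) \<triangleleft>\<^bsub>M\<^esub> a = (k \<odot>\<^bsub>A\<^esub> \<one>\<^bsub>A\<^esub>) \<odot>\<^bsub>M\<^esub> (m \<triangleleft>\<^bsub>M\<^esub> a)"
proof -
  interpret M: ring_bimodule A M
    by (rule algebra_bimodule_ring_bimodule) (rule algebra_bimodule_axioms)
  let ?k = "k \<odot>\<^bsub>A\<^esub> \<one>\<^bsub>A\<^esub>"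
  note k' = scalar_closed [OF k]
  show "(k \<odot>\<^bsub>A\<^esub> a) \<odot>\<^bsub>M\<^esub> m = ?k \<odot>\<^bsub>M\<^esub> (a \<odot>\<^bsub>M\<^esub> m)"
    using M.l_assoc [OF k' a m] scalar_mult(1) [OF k a] by metis
  show "a \<odot>\<^bsub>M\<^esub> (?k \<odot>\<^bsub>M\<^esub> m) = ?k \<odot>\<^bsub>M\<^esub> (a \<odot>\<^bsub>M\<^esub> m)"
    using M.l_assoc [OF k' a m] M.l_assoc [OF a k' m] scalar_mult [OF k a] by metis
  show "m \<triangleleft>\<^bsub>M\<^esub> (k \<odot>\<^bsub>A\<^esub> a) = ?k \<odot>\<^bsub>M\<^esub> (m \<triangleleft>\<^bsub>M\<^esub> a)"
    using M.r_assoc [OF a k' m] scalar_mult(2) [OF k a] scalars_central [OF k M.r_closed [OF m a]] by metis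
  show "(?k \<odot>\<^bsub>M\<^esub> m) \<triangleleft>\<^bsub>M\<^esub> a = ?k \<odot>\<^bsub>M\<^esub> (m \<triangleleft>\<^bsub>M\<^esub> a)"
    by (rule M.lr_comm [OF k' a m])
qed

end

section \<open>The dual bimodule\<close>

text \<open>\<open>R\<close> is given as an algebra record because \<open>dual_bimodule\<close>
  takes one. Only bimodule axioms are assumed here; the dual basis enters later.\<close>

locale dualizable_bimodule = ring_bimodule R V
  for R :: "('k, 'r, 'x) module_scheme" and V :: "('r, 'v, 'y) bimodule_scheme"
begin

abbreviation X where "X \<equiv> dual_bimodule R V"

lemma X_carrier:
  "x \<in> carrier X \<longleftrightarrow> x \<in> extensional (carrier V) \<and> x \<in> add_hom V R \<and>
     (\<forall>v \<in> carrier V. \<forall>r \<in> carrier R. x (v \<triangleleft>\<^bsub>V\<^esub> r) = x v \<otimes>\<^bsub>R\<^esub> r)"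
  by (auto simp: dual_bimodule_def add_hom_def PiE_def)

lemma
  assumes "x \<in> carrier X"
  shows X_closed: "v \<in> carrier V \<Longrightarrow> x v \<in> carrier R"
    and X_hom: "x \<in> add_hom V R"
    and X_rsmult: "\<lbrakk>v \<in> carrier V; r \<in> carrier R\<rbrakk> \<Longrightarrow> x (v \<triangleleft>\<^bsub>V\<^esub> r) = x v \<otimes>\<^bsub>R\<^esub> r"
  using assms by (auto simp: X_carrier add_hom_def)

lemmas X_add_arg = add_hom_add [OF X_hom]

lemma X_eqI: "\<lbrakk>x \<in> carrier X; y \<in> carrier X; \<And>v. v \<in> carrier V \<Longrightarrow> x v = y v\<rbrakk> \<Longrightarrow> x = y"
  by (rule extensionalityI [of x "carrier V"]) (simp_all add: X_carrier)

lemma X_simps: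
  assumes "v \<in> carrier V"
  shows "(x \<oplus>\<^bsub>X\<^esub> y) v = x v \<oplus>\<^bsub>R\<^esub> y v" "\<zero>\<^bsub>X\<^esub> v = \<zero>\<^bsub>R\<^esub>"
    "(a \<odot>\<^bsub>X\<^esub> x) v = a \<otimes>\<^bsub>R\<^esub> x v" "(x \<triangleleft>\<^bsub>X\<^esub> b) v = x (b \<odot>\<^bsub>V\<^esub> v)"
  using assms by (simp_all add: dual_bimodule_def)

lemma X_carrierI:
  assumes "x \<in> extensional (carrier V)" "\<And>v. v \<in> carrier V \<Longrightarrow> x v \<in> carrier R"
    and "\<And>v w. \<lbrakk>v \<in> carrier V; w \<in> carrier V\<rbrakk> \<Longrightarrow> x (v \<oplus>\<^bsub>V\<^esub> w) = x v \<oplus>\<^bsub>R\<^esub> x w"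
    and "\<And>v r. \<lbrakk>v \<in> carrier V; r \<in> carrier R\<rbrakk> \<Longrightarrow> x (v \<triangleleft>\<^bsub>V\<^esub> r) = x v \<otimes>\<^bsub>R\<^esub> r"
  shows "x \<in> carrier X"
  using assms by (simp add: X_carrier add_hom_def)

text \<open>Right linearity of \<open>x \<triangleleft> a\<close> rests on the commutation of the
  two actions on \<open>V\<close>, as \<open>a\<close> acts on the argument from the left. The last
  clause supplies the additive inverses.\<close>

lemma X_op_closed:
  assumes x: "x \<in> carrier X"
  shows "y \<in> carrier X \<Longrightarrow> x \<oplus>\<^bsub>X\<^esub> y \<in> carrier X" "a \<in> carrier R \<Longrightarrow> a \<odot>\<^bsub>X\<^esub> x \<in> carrier X"
    "a \<in> carrier R \<Longrightarrow> x \<triangleleft>\<^bsub>X\<^esub> a \<in> carrier X" "(\<lambda>v \<in> carrier V. \<ominus>\<^bsub>R\<^esub> x v) \<in> carrier X"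
proof -
  have e: "x \<oplus>\<^bsub>X\<^esub> y \<in> extensional (carrier V)" "a \<odot>\<^bsub>X\<^esub> x \<in> extensional (carrier V)"
    "x \<triangleleft>\<^bsub>X\<^esub> a \<in> extensional (carrier V)" for y a
    by (simp_all add: dual_bimodule_def)
  show "x \<oplus>\<^bsub>X\<^esub> y \<in> carrier X" if y: "y \<in> carrier X"
    using X_closed [OF x] X_closed [OF y] X_add_arg [OF x] X_add_arg [OF y] X_rsmult [OF x] X_rsmult [OF y]
    by (intro X_carrierI e) (simp_all add: X_simps R.a_ac R.l_distr r_closed)
  show "a \<odot>\<^bsub>X\<^esub> x \<in> carrier X" if a: "a \<in> carrier R"
    using a X_closed [OF x] X_add_arg [OF x] X_rsmult [OF x]
    by (intro X_carrierI e) (simp_all add: X_simps R.r_distr R.m_assoc r_closed)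
  show "x \<triangleleft>\<^bsub>X\<^esub> a \<in> carrier X" if a: "a \<in> carrier R"
    using a X_closed [OF x] X_add_arg [OF x] X_rsmult [OF x]
    by (intro X_carrierI e) (simp_all add: X_simps l_closed r_closed l_add_right flip: lr_comm)
  show "(\<lambda>v \<in> carrier V. \<ominus>\<^bsub>R\<^esub> x v) \<in> carrier X"
    using X_closed [OF x] X_add_arg [OF x] X_rsmult [OF x]
    by (intro X_carrierI) (simp_all add: r_closed R.minus_add R.l_minus)
qed

lemma X_zero_closed: "\<zero>\<^bsub>X\<^esub> \<in> carrier X"
proof (rule X_carrierI)
  show "\<zero>\<^bsub>X\<^esub> \<in> extensional (carrier V)" by (simp add: dual_bimodule_def)
qed (simp_all add: X_simps r_closed)

lemma X_abelian_group: "abelian_group X"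
proof (rule abelian_groupI)
  show "\<exists>y \<in> carrier X. y \<oplus>\<^bsub>X\<^esub> x = \<zero>\<^bsub>X\<^esub>" if x: "x \<in> carrier X" for x
    using X_op_closed(4) [OF x]
    by (rule bexI [rotated], intro X_eqI X_op_closed(1) X_op_closed(4) x X_zero_closed)
      (simp add: X_simps R.l_neg X_closed [OF x])
  show "x \<oplus>\<^bsub>X\<^esub> y \<oplus>\<^bsub>X\<^esub> z = x \<oplus>\<^bsub>X\<^esub> (y \<oplus>\<^bsub>X\<^esub> z)"
    if "x \<in> carrier X" "y \<in> carrier X" "z \<in> carrier X" for x y z
    using that by (intro X_eqI) (simp_all add: X_simps X_op_closed R.a_assoc X_closed)
  show "x \<oplus>\<^bsub>X\<^esub> y = y \<oplus>\<^bsub>X\<^esub> x" if "x \<in> carrier X" "y \<in> carrier X" for x y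
    using that by (intro X_eqI) (simp_all add: X_simps X_op_closed R.a_comm X_closed)
  show "\<zero>\<^bsub>X\<^esub> \<oplus>\<^bsub>X\<^esub> x = x" if "x \<in> carrier X" for x
    using that by (intro X_eqI) (simp_all add: X_simps X_op_closed X_zero_closed X_closed)
qed (simp_all add: X_op_closed X_zero_closed)

lemma X_ring_bimodule: "ring_bimodule R X"
proof -
  interpret X: abelian_group X by (rule X_abelian_group)
  show ?thesis
  proof
    show "biadditive R X X (smult X)"
      by (rule biadditiveI; (intro X_eqI)?)
        (simp_all add: X_simps X_op_closed X_closed R.l_distr R.r_distr)
    show "biadditive X R X (rsmult X)"
      by (rule biadditiveI; (intro X_eqI)?)
        (simp_all add: X_simps X_op_closed X_closed X_add_arg l_add l_closed)
  qed (intro X_eqI; simp add: X_simps X_op_closed X_closed R.m_assoc l_assoc l_one l_closed)+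
qed

end

text \<open>Centrality of scalars passes to the dual: k x(w) = x(w) k = x(w k) = x(k w), by
  centrality in \<open>A\<close>, right linearity of x, and centrality on \<Omega>.\<close>

lemma dual_algebra_bimodule:
  assumes "algebra_bimodule K A \<Omega>"
  shows "algebra_bimodule K A (dual_bimodule A \<Omega>)"
proof -
  interpret algebra_bimodule K A \<Omega> by fact
  interpret O: dualizable_bimodule A \<Omega>
    by (rule dualizable_bimodule.intro [OF algebra_bimodule_ring_bimodule [OF assms]])
  show ?thesis
  proof (rule algebra_bimoduleI [OF assoc_algebra_axioms O.X_ring_bimodule])
    fix k x assume k: "k \<in> carrier K" and x: "x \<in> carrier (dual_bimodule A \<Omega>)"
    note k' = scalar_closed [OF k]
    show "(k \<odot>\<^bsub>A\<^esub> \<one>\<^bsub>A\<^esub>) \<odot>\<^bsub>dual_bimodule A \<Omega>\<^esub> x = x \<triangleleft>\<^bsub>dual_bimodule A \<Omega>\<^esub> (k \<odot>\<^bsub>A\<^esub> \<one>\<^bsub>A\<^esub>)"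
    proof (rule O.X_eqI)
      fix w assume w: "w \<in> carrier \<Omega>"
      have "(k \<odot>\<^bsub>A\<^esub> \<one>\<^bsub>A\<^esub>) \<otimes>\<^bsub>A\<^esub> x w = x w \<otimes>\<^bsub>A\<^esub> (k \<odot>\<^bsub>A\<^esub> \<one>\<^bsub>A\<^esub>)"
        using scalar_mult [OF k O.X_closed [OF x w]] by simp
      also have "\<dots> = x ((k \<odot>\<^bsub>A\<^esub> \<one>\<^bsub>A\<^esub>) \<odot>\<^bsub>\<Omega>\<^esub> w)"
        using O.X_rsmult [OF x w k'] scalars_central [OF k w] by simp
      finally show "((k \<odot>\<^bsub>A\<^esub> \<one>\<^bsub>A\<^esub>) \<odot>\<^bsub>dual_bimodule A \<Omega>\<^esub> x) w
          = (x \<triangleleft>\<^bsub>dual_bimodule A \<Omega>\<^esub> (k \<odot>\<^bsub>A\<^esub> \<one>\<^bsub>A\<^esub>)) w"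
        using w by (simp only: O.X_simps)
    qed (intro O.X_op_closed x k')+
  qed
qed

lemma central_bimodule_simps [simp]:
  "carrier (central_bimodule M) = carrier M" "add (central_bimodule M) = add M"
  "\<zero>\<^bsub>central_bimodule M\<^esub> = \<zero>\<^bsub>M\<^esub>" "smult (central_bimodule M) = smult M"
  "m \<triangleleft>\<^bsub>central_bimodule M\<^esub> k = k \<odot>\<^bsub>M\<^esub> m"
  by (simp_all add: central_bimodule_def)

lemma restrict_scalars_simps [simp]:
  "carrier (restrict_scalars A M) = carrier M" "add (restrict_scalars A M) = add M"
  "\<zero>\<^bsub>restrict_scalars A M\<^esub> = \<zero>\<^bsub>M\<^esub>"
  "k \<odot>\<^bsub>restrict_scalars A M\<^esub> m = (k \<odot>\<^bsub>A\<^esub> \<one>\<^bsub>A\<^esub>) \<odot>\<^bsub>M\<^esub> m"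
  "m \<triangleleft>\<^bsub>restrict_scalars A M\<^esub> k = (k \<odot>\<^bsub>A\<^esub> \<one>\<^bsub>A\<^esub>) \<odot>\<^bsub>M\<^esub> m"
  by (simp_all add: restrict_scalars_def)

lemma smult_op_ring [simp]: "smult (op_ring A) = smult A"
  by (simp add: op_ring_def)

section \<open>The enveloping algebra\<close>

context assoc_algebra
begin

abbreviation "A1 \<equiv> central_bimodule A"
abbreviation "A2 \<equiv> central_bimodule (op_ring A)"
abbreviation "E \<equiv> enveloping_algebra K A"
text \<open>The element of the enveloping algebra written as \<open>a\<close> followed by
  \<open>b\<close> with a bar, the second factor being taken in the opposite algebra.\<close>

definition elt where "elt a b = pure K A1 A2 a b"

lemma E_tensor: "is_tensor K A1 A2 E"
proof -
  have "abelian_group A1" "abelian_group A2"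
    by (rule abelian_group_cong [OF _ _ _ ring.axioms(1) [OF A.ring_axioms]]; simp)+
  then show ?thesis
    by (simp add: is_tensor_def enveloping_algebra_def Let_def)
qed

sublocale E: abelian_group E
  by (rule is_tensor_abelian_group [OF E_tensor])

lemma elt_closed: "\<lbrakk>a \<in> carrier A; b \<in> carrier A\<rbrakk> \<Longrightarrow> elt a b \<in> carrier E"
  unfolding elt_def by (rule pure_closed [OF E_tensor]) simp_all

lemma elt_biadditive: "biadditive A A E elt"
  using pure_biadditive [OF E_tensor] by (simp add: biadditive_def add_hom_def elt_def Pi_iff)

lemma elt_balanced: "\<lbrakk>k \<in> carrier K; a \<in> carrier A; b \<in> carrier A\<rbrakk> \<Longrightarrow> elt (k \<odot>\<^bsub>A\<^esub> a) b = elt a (k \<odot>\<^bsub>A\<^esub> b)"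
  using pure_balanced [OF E_tensor, of a k b] by (simp add: elt_def)

lemma E_hom_eqI:
  assumes "abelian_group G" "f \<in> add_hom E G" "g \<in> add_hom E G"
    and "\<And>a b. \<lbrakk>a \<in> carrier A; b \<in> carrier A\<rbrakk> \<Longrightarrow> f (elt a b) = g (elt a b)" and "r \<in> carrier E"
  shows "f r = g r"
  by (rule tensor_hom_eqI [OF E_tensor assms(1-3) _ assms(5)]) (simp add: assms(4) flip: elt_def)

lemma E_biadditive_eqI:
  assumes "abelian_group G" "biadditive E E G f" "biadditive E E G g"
    and "\<And>a b a' b'. \<lbrakk>a \<in> carrier A; b \<in> carrier A; a' \<in> carrier A; b' \<in> carrier A\<rbrakk>
      \<Longrightarrow> f (elt a b) (elt a' b') = g (elt a b) (elt a' b')" and "r \<in> carrier E" "s \<in> carrier E"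
  shows "f r s = g r s"
  by (rule biadditive_eqI [OF E_tensor E_tensor assms(1-3) _ assms(5,6)]) (simp add: assms(4) flip: elt_def)

lemma E_one: "\<one>\<^bsub>E\<^esub> = elt \<one>\<^bsub>A\<^esub> \<one>\<^bsub>A\<^esub>"
  by (simp add: elt_def pure_def gen_def enveloping_algebra_def Let_def tensor_null_def)

text \<open>Well-definedness reduces to moving a scalar out of a product in \<open>A\<close> on
  either side. The second factors appear in reversed order, since they multiply in the opposite
  algebra.\<close>

lemma
  shows E_mult_biadditive: "biadditive E E E (mult E)"
    and E_mult_elt: "\<lbrakk>a \<in> carrier A; b \<in> carrier A; a' \<in> carrier A; b' \<in> carrier A\<rbrakk>
      \<Longrightarrow> elt a b \<otimes>\<^bsub>E\<^esub> elt a' b' = elt (a \<otimes>\<^bsub>A\<^esub> a') (b' \<otimes>\<^bsub>A\<^esub> b)"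
proof -
  have m: "mult E = induced2 (tensor_null K A1 A2) (\<lambda>(a, b) (a', b'). (a \<otimes>\<^bsub>A\<^esub> a', b' \<otimes>\<^bsub>A\<^esub> b))"
    by (simp add: enveloping_algebra_def Let_def)
  have 1: "biadditive A1 A1 A1 (mult A)" "biadditive A2 A2 A2 (\<lambda>b b'. b' \<otimes>\<^bsub>A\<^esub> b)"
    by (auto intro!: biadditiveI simp: A.l_distr A.r_distr)
  have b: "pure K A1 A2 (k \<odot>\<^bsub>A\<^esub> a) b = pure K A1 A2 a (k \<odot>\<^bsub>A\<^esub> b)"
    if "k \<in> carrier K" "a \<in> carrier A" "b \<in> carrier A" for k a b
    using elt_balanced [OF that] by (simp add: elt_def)
  have 2: "pure K A1 A2 ((x \<triangleleft>\<^bsub>A1\<^esub> r) \<otimes>\<^bsub>A\<^esub> x') (z' \<otimes>\<^bsub>A\<^esub> z) = pure K A1 A2 (x \<otimes>\<^bsub>A\<^esub> x') (z' \<otimes>\<^bsub>A\<^esub> (r \<odot>\<^bsub>A2\<^esub> z))"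
    if "x \<in> carrier A1" "r \<in> carrier K" "z \<in> carrier A2" "x' \<in> carrier A1" "z' \<in> carrier A2" for x r z x' z'
    using that by (simp add: smult_mult_left smult_mult_right b)
  have 3: "pure K A1 A2 (x \<otimes>\<^bsub>A\<^esub> (x' \<triangleleft>\<^bsub>A1\<^esub> r)) (z' \<otimes>\<^bsub>A\<^esub> z) = pure K A1 A2 (x \<otimes>\<^bsub>A\<^esub> x') ((r \<odot>\<^bsub>A2\<^esub> z') \<otimes>\<^bsub>A\<^esub> z)"
    if "x \<in> carrier A1" "r \<in> carrier K" "z \<in> carrier A2" "x' \<in> carrier A1" "z' \<in> carrier A2" for x r z x' z'
    using that by (simp add: smult_mult_left smult_mult_right b)
  show "biadditive E E E (mult E)"
    unfolding m by (rule tensor_induced2_biadditive [where f = "mult A" and g = "\<lambda>b b'. b' \<otimes>\<^bsub>A\<^esub> b",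
        OF E_tensor E_tensor E_tensor 1 2 3])
  show "elt a b \<otimes>\<^bsub>E\<^esub> elt a' b' = elt (a \<otimes>\<^bsub>A\<^esub> a') (b' \<otimes>\<^bsub>A\<^esub> b)"
    if "a \<in> carrier A" "b \<in> carrier A" "a' \<in> carrier A" "b' \<in> carrier A"
    unfolding m elt_def
    by (rule tensor_induced2_pure [where f = "mult A" and g = "\<lambda>b b'. b' \<otimes>\<^bsub>A\<^esub> b",
        OF E_tensor E_tensor E_tensor 1 2 3]) (use that in simp_all)
qed

lemma E_ring: "ring E"
proof (rule ringI)
  note E = E.abelian_group_axioms and M = E_mult_biadditive
  note Mr = biadditive_hom_right [OF M] and Ml = biadditive_hom_left [OF M]
  have 1: "elt \<one>\<^bsub>A\<^esub> \<one>\<^bsub>A\<^esub> \<in> carrier E" by (simp add: elt_closed)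
  show "monoid E"
  proof
    fix x y z assume x: "x \<in> carrier E" and y: "y \<in> carrier E" and z: "z \<in> carrier E"
    show "x \<otimes>\<^bsub>E\<^esub> y \<otimes>\<^bsub>E\<^esub> z = x \<otimes>\<^bsub>E\<^esub> (y \<otimes>\<^bsub>E\<^esub> z)"
    proof (rule E_biadditive_eqI [OF E biadditive_post [OF M Ml [OF z]]
          biadditive_comp [OF M add_hom_id Ml [OF z]] _ x y])
      fix a b a' b' assume *: "a \<in> carrier A" "b \<in> carrier A" "a' \<in> carrier A" "b' \<in> carrier A"
      note c = elt_closed [OF *(1,2)] elt_closed [OF *(3,4)]
      show "elt a b \<otimes>\<^bsub>E\<^esub> elt a' b' \<otimes>\<^bsub>E\<^esub> z = elt a b \<otimes>\<^bsub>E\<^esub> (elt a' b' \<otimes>\<^bsub>E\<^esub> z)"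
      \<comment> \<open>Two factors are pure by now; the third is reduced on its own as an additive
        argument.\<close>
      proof (rule E_hom_eqI [OF E Mr [OF biadditive_closed [OF M c]] add_hom_comp [OF Mr [OF c(2)] Mr [OF c(1)]] _ z])
        show "elt a b \<otimes>\<^bsub>E\<^esub> elt a' b' \<otimes>\<^bsub>E\<^esub> elt a'' b'' = elt a b \<otimes>\<^bsub>E\<^esub> (elt a' b' \<otimes>\<^bsub>E\<^esub> elt a'' b'')"
          if "a'' \<in> carrier A" "b'' \<in> carrier A" for a'' b''
          using that * by (simp add: E_mult_elt A.m_assoc)
      qed
    qed
  next
    fix x assume x: "x \<in> carrier E"
    show "\<one>\<^bsub>E\<^esub> \<otimes>\<^bsub>E\<^esub> x = x"
      unfolding E_one by (rule E_hom_eqI [OF E Mr [OF 1] add_hom_id _ x]) (simp add: E_mult_elt)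
    show "x \<otimes>\<^bsub>E\<^esub> \<one>\<^bsub>E\<^esub> = x"
      unfolding E_one by (rule E_hom_eqI [OF E Ml [OF 1] add_hom_id _ x]) (simp add: E_mult_elt)
  qed (simp_all add: biadditive_closed [OF M] E_one 1)
qed (simp_all add: E.abelian_group_axioms biadditive_left [OF E_mult_biadditive]
    biadditive_right [OF E_mult_biadditive])

end

section \<open>Dual pairs as a bimodule over the enveloping algebra\<close>

locale bimodule_setting = assoc_algebra K A + Om: algebra_bimodule K A \<Omega>
  for K :: "('k, 'x) ring_scheme" and A :: "('k, 'a, 'y) module_scheme"
    and \<Omega> :: "('a, 'w, 'z) bimodule_scheme"
begin

sublocale O: dualizable_bimodule A \<Omega>
  by (rule dualizable_bimodule.intro, rule algebra_bimodule_ring_bimodule [OF Om.algebra_bimodule_axioms])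

abbreviation "D \<equiv> dual_bimodule A \<Omega>"
abbreviation "P \<equiv> dual_pair_bimodule K A \<Omega>"

sublocale D: algebra_bimodule K A D
  by (rule dual_algebra_bimodule [OF Om.algebra_bimodule_axioms])

sublocale DB: ring_bimodule A D
  by (rule O.X_ring_bimodule)

abbreviation "D' \<equiv> restrict_scalars A D"
abbreviation "O' \<equiv> restrict_scalars A \<Omega>"
definition pair where "pair x w = pure K D' O' x w"

lemma P_tensor: "is_tensor K D' O' P"
proof -
  have "abelian_group D'"
    by (rule abelian_group_cong [OF _ _ _ O.X_abelian_group]) simp_all
  moreover have "abelian_group O'"
    by (rule abelian_group_cong [OF _ _ _ ring_bimodule.axioms(2) [OF O.ring_bimodule_axioms]]) simp_all
  ultimately show ?thesis
    by (simp add: is_tensor_def dual_pair_bimodule_def Let_def O.l_closed DB.l_closed)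
qed

lemma pair_closed: "\<lbrakk>x \<in> carrier D; w \<in> carrier \<Omega>\<rbrakk> \<Longrightarrow> pair x w \<in> carrier P"
  unfolding pair_def by (rule pure_closed [OF P_tensor]) simp_all

lemma pair_biadditive: "biadditive D \<Omega> P pair"
  using pure_biadditive [OF P_tensor] by (simp add: biadditive_def add_hom_def pair_def Pi_iff)

lemma pair_balanced:
  "\<lbrakk>k \<in> carrier K; x \<in> carrier D; w \<in> carrier \<Omega>\<rbrakk>
    \<Longrightarrow> pair ((k \<odot>\<^bsub>A\<^esub> \<one>\<^bsub>A\<^esub>) \<odot>\<^bsub>D\<^esub> x) w = pair x ((k \<odot>\<^bsub>A\<^esub> \<one>\<^bsub>A\<^esub>) \<odot>\<^bsub>\<Omega>\<^esub> w)"
  using pure_balanced [OF P_tensor, of x k w] by (simp add: pair_def)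

lemma P_hom_eqI:
  assumes "abelian_group G" "f \<in> add_hom P G" "g \<in> add_hom P G"
    and "\<And>x w. \<lbrakk>x \<in> carrier D; w \<in> carrier \<Omega>\<rbrakk> \<Longrightarrow> f (pair x w) = g (pair x w)" and "v \<in> carrier P"
  shows "f v = g v"
  by (rule tensor_hom_eqI [OF P_tensor assms(1-3) _ assms(5)]) (simp add: assms(4) flip: pair_def)

text \<open>Two balancings over \<open>K\<close> must be respected, one in the enveloping algebra
  and one in the dual pairs. In both a scalar is pulled out of each slot by
  \<open>scalar_simps\<close> and carried across by \<open>pair_balanced\<close>.\<close>

lemma
  shows P_smult_biadditive: "biadditive E P P (smult P)"
    and P_smult_pair: "\<lbrakk>a \<in> carrier A; b \<in> carrier A; x \<in> carrier D; w \<in> carrier \<Omega>\<rbrakk>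
      \<Longrightarrow> elt a b \<odot>\<^bsub>P\<^esub> pair x w = pair (a \<odot>\<^bsub>D\<^esub> x) (w \<triangleleft>\<^bsub>\<Omega>\<^esub> b)"
proof -
  have m: "smult P = induced2 (tensor_null K D' O') (\<lambda>(a, b) (x, w). (a \<odot>\<^bsub>D\<^esub> x, w \<triangleleft>\<^bsub>\<Omega>\<^esub> b))"
    by (simp add: dual_pair_bimodule_def Let_def)
  have 1: "biadditive A1 D' D' (smult D)" "biadditive A2 O' O' (\<lambda>b w. w \<triangleleft>\<^bsub>\<Omega>\<^esub> b)"
    by (auto intro!: biadditiveI simp: DB.l_add DB.l_add_right DB.l_closed O.r_add O.r_add_left O.r_closed)
  have b: "pure K D' O' ((k \<odot>\<^bsub>A\<^esub> \<one>\<^bsub>A\<^esub>) \<odot>\<^bsub>D\<^esub> x) w = pure K D' O' x ((k \<odot>\<^bsub>A\<^esub> \<one>\<^bsub>A\<^esub>) \<odot>\<^bsub>\<Omega>\<^esub> w)"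
    if "k \<in> carrier K" "x \<in> carrier D" "w \<in> carrier \<Omega>" for k x w
    using pair_balanced [OF that] by (simp add: pair_def)
  have 2: "pure K D' O' ((a \<triangleleft>\<^bsub>A1\<^esub> k) \<odot>\<^bsub>D\<^esub> x) (w \<triangleleft>\<^bsub>\<Omega>\<^esub> b) = pure K D' O' (a \<odot>\<^bsub>D\<^esub> x) (w \<triangleleft>\<^bsub>\<Omega>\<^esub> (k \<odot>\<^bsub>A2\<^esub> b))"
    if "a \<in> carrier A1" "k \<in> carrier K" "b \<in> carrier A2" "x \<in> carrier D'" "w \<in> carrier O'" for a k b x w
    using that D.scalar_simps(1) [of k a x] Om.scalar_simps(3) [of k b w]
    by (simp add: b DB.l_closed O.r_closed)
  have 3: "pure K D' O' (a \<odot>\<^bsub>D\<^esub> (x \<triangleleft>\<^bsub>D'\<^esub> k)) (w \<triangleleft>\<^bsub>\<Omega>\<^esub> b) = pure K D' O' (a \<odot>\<^bsub>D\<^esub> x) ((k \<odot>\<^bsub>O'\<^esub> w) \<triangleleft>\<^bsub>\<Omega>\<^esub> b)"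
    if "a \<in> carrier A1" "k \<in> carrier K" "b \<in> carrier A2" "x \<in> carrier D'" "w \<in> carrier O'" for a k b x w
    using that D.scalar_simps(2) [of k a x] Om.scalar_simps(4) [of k b w]
    by (simp add: b DB.l_closed O.r_closed)
  show "biadditive E P P (smult P)"
    unfolding m by (rule tensor_induced2_biadditive [where f = "smult D" and g = "\<lambda>b w. w \<triangleleft>\<^bsub>\<Omega>\<^esub> b",
        OF E_tensor P_tensor P_tensor 1 2 3])
  show "elt a b \<odot>\<^bsub>P\<^esub> pair x w = pair (a \<odot>\<^bsub>D\<^esub> x) (w \<triangleleft>\<^bsub>\<Omega>\<^esub> b)"
    if "a \<in> carrier A" "b \<in> carrier A" "x \<in> carrier D" "w \<in> carrier \<Omega>"
    unfolding m elt_def pair_def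
    by (rule tensor_induced2_pure [where f = "smult D" and g = "\<lambda>b w. w \<triangleleft>\<^bsub>\<Omega>\<^esub> b",
        OF E_tensor P_tensor P_tensor 1 2 3]) (use that in simp_all)
qed

text \<open>Same argument with the sides exchanged: the right action uses the right structure of the
  dual and the left structure of \<Omega>.\<close>

lemma
  shows P_rsmult_biadditive: "biadditive P E P (rsmult P)"
    and P_rsmult_pair: "\<lbrakk>a \<in> carrier A; b \<in> carrier A; x \<in> carrier D; w \<in> carrier \<Omega>\<rbrakk>
      \<Longrightarrow> pair x w \<triangleleft>\<^bsub>P\<^esub> elt a b = pair (x \<triangleleft>\<^bsub>D\<^esub> a) (b \<odot>\<^bsub>\<Omega>\<^esub> w)"
proof -
  have m: "rsmult P = induced2 (tensor_null K D' O') (\<lambda>(x, w) (a, b). (x \<triangleleft>\<^bsub>D\<^esub> a, b \<odot>\<^bsub>\<Omega>\<^esub> w))"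
    by (simp add: dual_pair_bimodule_def Let_def)
  have 1: "biadditive D' A1 D' (rsmult D)" "biadditive O' A2 O' (\<lambda>w b. b \<odot>\<^bsub>\<Omega>\<^esub> w)"
    by (auto intro!: biadditiveI simp: DB.r_add DB.r_add_left DB.r_closed O.l_add O.l_add_right O.l_closed)
  have b: "pure K D' O' ((k \<odot>\<^bsub>A\<^esub> \<one>\<^bsub>A\<^esub>) \<odot>\<^bsub>D\<^esub> x) w = pure K D' O' x ((k \<odot>\<^bsub>A\<^esub> \<one>\<^bsub>A\<^esub>) \<odot>\<^bsub>\<Omega>\<^esub> w)"
    if "k \<in> carrier K" "x \<in> carrier D" "w \<in> carrier \<Omega>" for k x w
    using pair_balanced [OF that] by (simp add: pair_def)
  have 2: "pure K D' O' ((x \<triangleleft>\<^bsub>D'\<^esub> k) \<triangleleft>\<^bsub>D\<^esub> a) (b \<odot>\<^bsub>\<Omega>\<^esub> w) = pure K D' O' (x \<triangleleft>\<^bsub>D\<^esub> a) (b \<odot>\<^bsub>\<Omega>\<^esub> (k \<odot>\<^bsub>O'\<^esub> w))"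
    if "x \<in> carrier D'" "k \<in> carrier K" "w \<in> carrier O'" "a \<in> carrier A1" "b \<in> carrier A2" for a k b x w
    using that D.scalar_simps(4) [of k a x] Om.scalar_simps(2) [of k b w]
    by (simp add: b DB.r_closed O.l_closed)
  have 3: "pure K D' O' (x \<triangleleft>\<^bsub>D\<^esub> (a \<triangleleft>\<^bsub>A1\<^esub> k)) (b \<odot>\<^bsub>\<Omega>\<^esub> w) = pure K D' O' (x \<triangleleft>\<^bsub>D\<^esub> a) ((k \<odot>\<^bsub>A2\<^esub> b) \<odot>\<^bsub>\<Omega>\<^esub> w)"
    if "x \<in> carrier D'" "k \<in> carrier K" "w \<in> carrier O'" "a \<in> carrier A1" "b \<in> carrier A2" for a k b x w
    using that D.scalar_simps(3) [of k a x] Om.scalar_simps(1) [of k b w]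
    by (simp add: b DB.r_closed O.l_closed)
  show "biadditive P E P (rsmult P)"
    unfolding m by (rule tensor_induced2_biadditive [where f = "rsmult D" and g = "\<lambda>w b. b \<odot>\<^bsub>\<Omega>\<^esub> w",
        OF P_tensor E_tensor P_tensor 1 2 3])
  show "pair x w \<triangleleft>\<^bsub>P\<^esub> elt a b = pair (x \<triangleleft>\<^bsub>D\<^esub> a) (b \<odot>\<^bsub>\<Omega>\<^esub> w)"
    if "a \<in> carrier A" "b \<in> carrier A" "x \<in> carrier D" "w \<in> carrier \<Omega>"
    unfolding m elt_def pair_def
    by (rule tensor_induced2_pure [where f = "rsmult D" and g = "\<lambda>w b. b \<odot>\<^bsub>\<Omega>\<^esub> w",
        OF P_tensor E_tensor P_tensor 1 2 3]) (use that in simp_all)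
qed

text \<open>Reduced to pairs and elements \<open>elt a b\<close>, each axiom splits into one for the
  dual and one for \<Omega>. The left action uses the right structure of \<Omega>, so the reversed
  product of the opposite algebra is exactly what associativity asks for; commutation of the actions
  is commutation in each slot.\<close>

lemma P_ring_bimodule: "ring_bimodule E P"
proof (intro ring_bimodule.intro ring_bimodule_axioms.intro)
  note P = is_tensor_abelian_group [OF P_tensor]
  note L = P_smult_biadditive and R = P_rsmult_biadditive and M = E_mult_biadditive
  note Lr = biadditive_hom_right [OF L] and Ll = biadditive_hom_left [OF L]
  note Rr = biadditive_hom_right [OF R] and Rl = biadditive_hom_left [OF R]
  show "ring E" by (rule E_ring)
  show "abelian_group P" by (rule P)
  show "biadditive E P P (smult P)" by (rule L)
  show "biadditive P E P (rsmult P)" by (rule R)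
  fix r s v assume r: "r \<in> carrier E" and s: "s \<in> carrier E" and v: "v \<in> carrier P"
  note rs = biadditive_closed [OF M r s]
  show "(r \<otimes>\<^bsub>E\<^esub> s) \<odot>\<^bsub>P\<^esub> v = r \<odot>\<^bsub>P\<^esub> (s \<odot>\<^bsub>P\<^esub> v)"
  proof (rule P_hom_eqI [OF P Lr [OF rs] add_hom_comp [OF Lr [OF s] Lr [OF r]] _ v])
    fix x w assume xw: "x \<in> carrier D" "w \<in> carrier \<Omega>"
    note p = pair_closed [OF xw]
    show "(r \<otimes>\<^bsub>E\<^esub> s) \<odot>\<^bsub>P\<^esub> pair x w = r \<odot>\<^bsub>P\<^esub> (s \<odot>\<^bsub>P\<^esub> pair x w)"
    proof (rule E_biadditive_eqI [OF P biadditive_post [OF M Ll [OF p]]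
          biadditive_comp [OF L add_hom_id Ll [OF p]] _ r s])
      show "(elt a b \<otimes>\<^bsub>E\<^esub> elt a' b') \<odot>\<^bsub>P\<^esub> pair x w = elt a b \<odot>\<^bsub>P\<^esub> (elt a' b' \<odot>\<^bsub>P\<^esub> pair x w)"
        if "a \<in> carrier A" "b \<in> carrier A" "a' \<in> carrier A" "b' \<in> carrier A" for a b a' b'
        using that xw
        by (simp add: E_mult_elt P_smult_pair DB.l_assoc O.r_assoc DB.l_closed O.r_closed)
    qed
  qed
  show "(v \<triangleleft>\<^bsub>P\<^esub> r) \<triangleleft>\<^bsub>P\<^esub> s = v \<triangleleft>\<^bsub>P\<^esub> (r \<otimes>\<^bsub>E\<^esub> s)"
  proof (rule P_hom_eqI [OF P add_hom_comp [OF Rl [OF r] Rl [OF s]] Rl [OF rs] _ v])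
    fix x w assume xw: "x \<in> carrier D" "w \<in> carrier \<Omega>"
    note p = pair_closed [OF xw]
    show "(pair x w \<triangleleft>\<^bsub>P\<^esub> r) \<triangleleft>\<^bsub>P\<^esub> s = pair x w \<triangleleft>\<^bsub>P\<^esub> (r \<otimes>\<^bsub>E\<^esub> s)"
    proof (rule E_biadditive_eqI [OF P biadditive_comp [OF R Rr [OF p] add_hom_id]
          biadditive_post [OF M Rr [OF p]] _ r s])
      show "(pair x w \<triangleleft>\<^bsub>P\<^esub> elt a b) \<triangleleft>\<^bsub>P\<^esub> elt a' b' = pair x w \<triangleleft>\<^bsub>P\<^esub> (elt a b \<otimes>\<^bsub>E\<^esub> elt a' b')"
        if "a \<in> carrier A" "b \<in> carrier A" "a' \<in> carrier A" "b' \<in> carrier A" for a b a' b'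
        using that xw
        by (simp add: E_mult_elt P_rsmult_pair DB.r_assoc O.l_assoc DB.r_closed O.l_closed)
    qed
  qed
  show "(r \<odot>\<^bsub>P\<^esub> v) \<triangleleft>\<^bsub>P\<^esub> s = r \<odot>\<^bsub>P\<^esub> (v \<triangleleft>\<^bsub>P\<^esub> s)"
  proof (rule P_hom_eqI [OF P add_hom_comp [OF Lr [OF r] Rl [OF s]] add_hom_comp [OF Rl [OF s] Lr [OF r]] _ v])
    fix x w assume xw: "x \<in> carrier D" "w \<in> carrier \<Omega>"
    note p = pair_closed [OF xw]
    show "(r \<odot>\<^bsub>P\<^esub> pair x w) \<triangleleft>\<^bsub>P\<^esub> s = r \<odot>\<^bsub>P\<^esub> (pair x w \<triangleleft>\<^bsub>P\<^esub> s)"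
    proof (rule E_biadditive_eqI [OF P biadditive_comp [OF R Ll [OF p] add_hom_id]
          biadditive_comp [OF L add_hom_id Rr [OF p]] _ r s])
      show "(elt a b \<odot>\<^bsub>P\<^esub> pair x w) \<triangleleft>\<^bsub>P\<^esub> elt a' b' = elt a b \<odot>\<^bsub>P\<^esub> (pair x w \<triangleleft>\<^bsub>P\<^esub> elt a' b')"
        if "a \<in> carrier A" "b \<in> carrier A" "a' \<in> carrier A" "b' \<in> carrier A" for a b a' b'
        using that xw
        by (simp add: P_smult_pair P_rsmult_pair DB.lr_comm O.lr_comm DB.l_closed DB.r_closed O.l_closed O.r_closed)
    qed
  qed
next
  note P = is_tensor_abelian_group [OF P_tensor]
  have 1: "elt \<one>\<^bsub>A\<^esub> \<one>\<^bsub>A\<^esub> \<in> carrier E" by (simp add: elt_closed)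
  fix v assume v: "v \<in> carrier P"
  show "\<one>\<^bsub>E\<^esub> \<odot>\<^bsub>P\<^esub> v = v"
    unfolding E_one
    by (rule P_hom_eqI [OF P biadditive_hom_right [OF P_smult_biadditive 1] add_hom_id _ v])
      (simp add: P_smult_pair DB.l_one O.r_one)
  show "v \<triangleleft>\<^bsub>P\<^esub> \<one>\<^bsub>E\<^esub> = v"
    unfolding E_one
    by (rule P_hom_eqI [OF P biadditive_hom_left [OF P_rsmult_biadditive 1] add_hom_id _ v])
      (simp add: P_rsmult_pair DB.r_one O.l_one)
qed

sublocale PB: ring_bimodule E P
  by (rule P_ring_bimodule)

end

section \<open>Intertwining maps and pairings\<close>

lemma tensor_bimodule_simps:
  "r \<odot>\<^bsub>tensor_bimodule R M N\<^esub> t = induced (tensor_null R M N) (\<lambda>(x, y). (r \<odot>\<^bsub>M\<^esub> x, y)) t"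
  "t \<triangleleft>\<^bsub>tensor_bimodule R M N\<^esub> r = induced (tensor_null R M N) (\<lambda>(x, y). (x, y \<triangleleft>\<^bsub>N\<^esub> r)) t"
  by (simp_all add: tensor_bimodule_def)

lemma tensor_bimodule_is_tensor:
  assumes "ring_bimodule R M" "ring_bimodule R N"
  shows "is_tensor R M N (tensor_bimodule R M N)"
proof -
  interpret M: ring_bimodule R M by fact
  interpret N: ring_bimodule R N by fact
  show ?thesis
    using M.r_closed N.l_closed ring_bimodule.axioms(2) [OF assms(1)] ring_bimodule.axioms(2) [OF assms(2)]
    by (simp add: is_tensor_def tensor_bimodule_def)
qed

text \<open>The outer actions respect balancing because in each factor the left and right actions
  commute.\<close>

lemma
  assumes M: "ring_bimodule R M" and N: "ring_bimodule R N" and r: "r \<in> carrier R"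
  shows tensor_smult_hom:
      "smult (tensor_bimodule R M N) r \<in> add_hom (tensor_bimodule R M N) (tensor_bimodule R M N)"
    and tensor_smult_pure: "\<lbrakk>x \<in> carrier M; y \<in> carrier N\<rbrakk>
      \<Longrightarrow> r \<odot>\<^bsub>tensor_bimodule R M N\<^esub> pure R M N x y = pure R M N (r \<odot>\<^bsub>M\<^esub> x) y"
    and tensor_rsmult_hom:
      "(\<lambda>t. t \<triangleleft>\<^bsub>tensor_bimodule R M N\<^esub> r) \<in> add_hom (tensor_bimodule R M N) (tensor_bimodule R M N)"
    and tensor_rsmult_pure: "\<lbrakk>x \<in> carrier M; y \<in> carrier N\<rbrakk>
      \<Longrightarrow> pure R M N x y \<triangleleft>\<^bsub>tensor_bimodule R M N\<^esub> r = pure R M N x (y \<triangleleft>\<^bsub>N\<^esub> r)"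
proof -
  interpret M: ring_bimodule R M by fact
  interpret N: ring_bimodule R N by fact
  note T = tensor_bimodule_is_tensor [OF M N]
  have 1: "pure R M N (r \<odot>\<^bsub>M\<^esub> (x \<triangleleft>\<^bsub>M\<^esub> s)) y = pure R M N (r \<odot>\<^bsub>M\<^esub> x) (s \<odot>\<^bsub>N\<^esub> y)"
    if "x \<in> carrier M" "s \<in> carrier R" "y \<in> carrier N" for x s y
    using pure_balanced [OF T, of "r \<odot>\<^bsub>M\<^esub> x" s y] that r by (simp add: M.l_closed M.lr_comm)
  have 2: "pure R M N (x \<triangleleft>\<^bsub>M\<^esub> s) (y \<triangleleft>\<^bsub>N\<^esub> r) = pure R M N x ((s \<odot>\<^bsub>N\<^esub> y) \<triangleleft>\<^bsub>N\<^esub> r)"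
    if "x \<in> carrier M" "s \<in> carrier R" "y \<in> carrier N" for x s y
    using pure_balanced [OF T, of x s "y \<triangleleft>\<^bsub>N\<^esub> r"] that r by (simp add: N.r_closed N.lr_comm)
  have sm: "smult (tensor_bimodule R M N) r = induced (tensor_null R M N) (\<lambda>(x, y). (r \<odot>\<^bsub>M\<^esub> x, y))"
    by (simp add: tensor_bimodule_def)
  show "smult (tensor_bimodule R M N) r \<in> add_hom (tensor_bimodule R M N) (tensor_bimodule R M N)"
    unfolding sm by (rule tensor_induced_hom [where f = "smult M r" and g = "\<lambda>y. y",
        OF T T M.l_hom [OF r] add_hom_id 1])
  show "r \<odot>\<^bsub>tensor_bimodule R M N\<^esub> pure R M N x y = pure R M N (r \<odot>\<^bsub>M\<^esub> x) y"
    if "x \<in> carrier M" "y \<in> carrier N"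
    unfolding sm by (rule tensor_induced_pure [where f = "smult M r" and g = "\<lambda>y. y",
        OF T T M.l_hom [OF r] add_hom_id 1]) (use that in auto)
  show "(\<lambda>t. t \<triangleleft>\<^bsub>tensor_bimodule R M N\<^esub> r) \<in> add_hom (tensor_bimodule R M N) (tensor_bimodule R M N)"
    unfolding tensor_bimodule_simps
    by (rule tensor_induced_hom [where f = "\<lambda>x. x" and g = "\<lambda>y. y \<triangleleft>\<^bsub>N\<^esub> r",
        OF T T add_hom_id N.r_hom [OF r] 2])
  show "pure R M N x y \<triangleleft>\<^bsub>tensor_bimodule R M N\<^esub> r = pure R M N x (y \<triangleleft>\<^bsub>N\<^esub> r)"
    if "x \<in> carrier M" "y \<in> carrier N"
    unfolding tensor_bimodule_simps
    by (rule tensor_induced_pure [where f = "\<lambda>x. x" and g = "\<lambda>y. y \<triangleleft>\<^bsub>N\<^esub> r",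
        OF T T add_hom_id N.r_hom [OF r] 2]) (use that in auto)
qed

text \<open>Only the actions facing the tensor sign matter: \<open>f\<close> has to be right linear
  and \<open>g\<close> left linear.\<close>

lemma
  assumes M: "ring_bimodule R M" and N: "ring_bimodule R N" and M': "ring_bimodule R M'" and N': "ring_bimodule R N'"
    and f: "f \<in> add_hom M M'" "\<And>x r. \<lbrakk>x \<in> carrier M; r \<in> carrier R\<rbrakk> \<Longrightarrow> f (x \<triangleleft>\<^bsub>M\<^esub> r) = f x \<triangleleft>\<^bsub>M'\<^esub> r"
    and g: "g \<in> add_hom N N'" "\<And>y r. \<lbrakk>y \<in> carrier N; r \<in> carrier R\<rbrakk> \<Longrightarrow> g (r \<odot>\<^bsub>N\<^esub> y) = r \<odot>\<^bsub>N'\<^esub> g y"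
  shows tensor_map_hom: "tensor_map R M' N' f g \<in> add_hom (tensor_bimodule R M N) (tensor_bimodule R M' N')"
    and tensor_map_pure: "\<lbrakk>x \<in> carrier M; y \<in> carrier N\<rbrakk>
      \<Longrightarrow> tensor_map R M' N' f g (pure R M N x y) = pure R M' N' (f x) (g y)"
proof -
  note T = tensor_bimodule_is_tensor [OF M N] and T' = tensor_bimodule_is_tensor [OF M' N']
  have 1: "pure R M' N' (f (x \<triangleleft>\<^bsub>M\<^esub> s)) (g y) = pure R M' N' (f x) (g (s \<odot>\<^bsub>N\<^esub> y))"
    if "x \<in> carrier M" "s \<in> carrier R" "y \<in> carrier N" for x s y
    using pure_balanced [OF T', of "f x" s "g y"] that f g by (simp add: add_hom_closed [OF f(1)] add_hom_closed [OF g(1)])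
  show "tensor_map R M' N' f g \<in> add_hom (tensor_bimodule R M N) (tensor_bimodule R M' N')"
    unfolding tensor_map_def by (rule tensor_induced_hom [where f = f and g = g, OF T T' f(1) g(1) 1])
  show "tensor_map R M' N' f g (pure R M N x y) = pure R M' N' (f x) (g y)"
    if "x \<in> carrier M" "y \<in> carrier N"
    unfolding tensor_map_def
    by (rule tensor_induced_pure [where f = f and g = g, OF T T' f(1) g(1) 1]) (use that in auto)
qed

lemma abelian_group_finsum_closed:
  "\<lbrakk>abelian_group M; f \<in> I \<rightarrow> carrier M\<rbrakk> \<Longrightarrow> finsum M f I \<in> carrier M"
  by (rule abelian_monoid.finsum_closed [OF abelian_group.axioms(1)])

lemma abelian_group_finsum_cong:
  assumes "abelian_group M" "g \<in> I \<rightarrow> carrier M" "\<And>i. i \<in> I \<Longrightarrow> f i = g i"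
  shows "finsum M f I = finsum M g I"
  by (rule abelian_monoid.finsum_cong' [OF abelian_group.axioms(1) [OF assms(1)] refl assms(2,3)])

section \<open>Dual bases, evaluation, and expansions\<close>

text \<open>The generators index themselves, with \<open>e s\<close> the coordinate functional of
  \<open>s\<close>. The functionals need not satisfy a Kronecker relation, as \<Omega> is projective
  and possibly not free; the expansion is all that is required.\<close>

locale dual_basis_setting = bimodule_setting K A \<Omega>
  for K :: "('k, 'x) ring_scheme" and A :: "('k, 'a, 'y) module_scheme"
    and \<Omega> :: "('a, 'w, 'z) bimodule_scheme" +
  fixes S :: "'w set" and e :: "'w \<Rightarrow> 'w \<Rightarrow> 'a"
  assumes S: "finite S" "S \<subseteq> carrier \<Omega>" and e: "s \<in> S \<Longrightarrow> e s \<in> carrier D"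
    and dual_basis: "w \<in> carrier \<Omega> \<Longrightarrow> w = (\<Oplus>\<^bsub>\<Omega>\<^esub>s\<in>S. s \<triangleleft>\<^bsub>\<Omega>\<^esub> e s w)"
begin

lemmas O_group = ring_bimodule.axioms(2) [OF O.ring_bimodule_axioms]
lemmas A_group = ring.axioms(1) [OF A.ring_axioms]

lemma S_closed: "s \<in> S \<Longrightarrow> s \<in> carrier \<Omega>"
  using S by blast

lemma e_closed: "\<lbrakk>s \<in> S; w \<in> carrier \<Omega>\<rbrakk> \<Longrightarrow> e s w \<in> carrier A"
  using O.X_closed [OF e] .

text \<open>Applying the right linear x to the expansion of w gives x(w) = sum of x(s) e_s(w); so
  the e_s generate the dual as a left module, with the values x(s) as coefficients.\<close>

lemma D_expand:
  assumes x: "x \<in> carrier D"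
  shows "x = (\<Oplus>\<^bsub>D\<^esub>s\<in>S. x s \<odot>\<^bsub>D\<^esub> e s)"
proof (rule O.X_eqI [OF x])
  have c: "(\<lambda>s. x s \<odot>\<^bsub>D\<^esub> e s) \<in> S \<rightarrow> carrier D"
    using DB.l_closed O.X_closed [OF x] S_closed e by auto
  then show "(\<Oplus>\<^bsub>D\<^esub>s\<in>S. x s \<odot>\<^bsub>D\<^esub> e s) \<in> carrier D" by (rule abelian_group_finsum_closed [OF O.X_abelian_group])
  fix w assume w: "w \<in> carrier \<Omega>"
  \<comment> \<open>Evaluation at \<open>w\<close> is additive on the dual, which lets the sum be
    formed either in the dual or in \<open>A\<close>.\<close>
  have ev: "(\<lambda>y. y w) \<in> add_hom D A"
    using w by (intro add_homI) (simp_all add: O.X_simps O.X_closed)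
  have "x w = x (\<Oplus>\<^bsub>\<Omega>\<^esub>s\<in>S. s \<triangleleft>\<^bsub>\<Omega>\<^esub> e s w)"
    using dual_basis [OF w] by simp
  also have "\<dots> = (\<Oplus>\<^bsub>A\<^esub>s\<in>S. x (s \<triangleleft>\<^bsub>\<Omega>\<^esub> e s w))"
    by (rule finsum_add_hom [OF O_group A_group O.X_hom [OF x]]) (use w in \<open>simp add: O.r_closed S_closed e_closed\<close>)
  also have "\<dots> = (\<Oplus>\<^bsub>A\<^esub>s\<in>S. (x s \<odot>\<^bsub>D\<^esub> e s) w)"
    by (rule abelian_group_finsum_cong [OF A_group])
      (use w in \<open>simp_all add: O.X_simps O.X_rsmult [OF x] S_closed e_closed O.X_closed [OF x]\<close>)
  also have "\<dots> = (\<Oplus>\<^bsub>D\<^esub>s\<in>S. x s \<odot>\<^bsub>D\<^esub> e s) w"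
    by (rule finsum_add_hom [OF O.X_abelian_group A_group ev c, symmetric])
  finally show "x w = (\<Oplus>\<^bsub>D\<^esub>s\<in>S. x s \<odot>\<^bsub>D\<^esub> e s) w" .
qed

end

locale bimodule_over = dual_basis_setting K A \<Omega> S e + Mb: algebra_bimodule K A M
  for K :: "('k, 'x) ring_scheme" and A :: "('k, 'a, 'y) module_scheme"
    and \<Omega> :: "('a, 'w, 'z) bimodule_scheme" and S e and M :: "('a, 'm, 'u) bimodule_scheme"
begin

sublocale MB: ring_bimodule A M
  by (rule algebra_bimodule_ring_bimodule [OF Mb.algebra_bimodule_axioms])

lemmas M_group = ring_bimodule.axioms(2) [OF MB.ring_bimodule_axioms]
lemmas MM = MB.ring_bimodule_axioms and OO = O.ring_bimodule_axioms

abbreviation "MO \<equiv> tensor_bimodule A M \<Omega>"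
abbreviation "OM \<equiv> tensor_bimodule A \<Omega> M"
abbreviation "pMO \<equiv> pure A M \<Omega>"
abbreviation "pOM \<equiv> pure A \<Omega> M"

lemmas MO_tensor = tensor_bimodule_is_tensor [OF MM OO]
lemmas OM_tensor = tensor_bimodule_is_tensor [OF OO MM]
lemmas MO_group = is_tensor_abelian_group [OF MO_tensor]
lemmas OM_group = is_tensor_abelian_group [OF OM_tensor]
lemmas pMO_closed = pure_closed [OF MO_tensor]
lemmas pOM_closed = pure_closed [OF OM_tensor]
lemmas pMO_biadd = pure_biadditive [OF MO_tensor]
lemmas pOM_biadd = pure_biadditive [OF OM_tensor]
lemmas MO_smult_hom = tensor_smult_hom [OF MM OO]
lemmas MO_smult_pure = tensor_smult_pure [OF MM OO]
lemmas MO_rsmult_hom = tensor_rsmult_hom [OF MM OO]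
lemmas MO_rsmult_pure = tensor_rsmult_pure [OF MM OO]
lemmas OM_smult_hom = tensor_smult_hom [OF OO MM]
lemmas OM_smult_pure = tensor_smult_pure [OF OO MM]
lemmas OM_rsmult_hom = tensor_rsmult_hom [OF OO MM]
lemmas OM_rsmult_pure = tensor_rsmult_pure [OF OO MM]

text \<open>The map x \<otimes> id from \<Omega> \<otimes> M, followed by the identification of A
  \<otimes> M with M. It is well defined because x is right linear.\<close>

definition ev where "ev x = tensor_lift A \<Omega> M OM M (\<lambda>w m. x w \<odot>\<^bsub>M\<^esub> m)"

lemma
  assumes x: "x \<in> carrier D"
  shows ev_hom: "ev x \<in> add_hom OM M"
    and ev_pure: "\<lbrakk>w \<in> carrier \<Omega>; m \<in> carrier M\<rbrakk> \<Longrightarrow> ev x (pOM w m) = x w \<odot>\<^bsub>M\<^esub> m"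
proof -
  have 1: "biadditive \<Omega> M M (\<lambda>w m. x w \<odot>\<^bsub>M\<^esub> m)"
    by (rule biadditive_comp [OF MB.l_biadd O.X_hom [OF x] add_hom_id])
  have 2: "x (w \<triangleleft>\<^bsub>\<Omega>\<^esub> r) \<odot>\<^bsub>M\<^esub> m = x w \<odot>\<^bsub>M\<^esub> (r \<odot>\<^bsub>M\<^esub> m)"
    if "w \<in> carrier \<Omega>" "r \<in> carrier A" "m \<in> carrier M" for w r m
    using that by (simp add: O.X_rsmult [OF x] MB.l_assoc O.X_closed [OF x])
  show "ev x \<in> add_hom OM M"
    unfolding ev_def by (rule tensor_lift_hom [OF OM_tensor M_group 1 2])
  show "ev x (pOM w m) = x w \<odot>\<^bsub>M\<^esub> m" if "w \<in> carrier \<Omega>" "m \<in> carrier M"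
    unfolding ev_def
    by (rule tensor_lift_pure [where f = "\<lambda>w m. x w \<odot>\<^bsub>M\<^esub> m", OF OM_tensor M_group 1 2]) (use that in auto)
qed

lemmas ev_closed = add_hom_closed [OF ev_hom]

text \<open>The last identity is the adjunction between the right action on the dual and the left
  action on \<Omega>; it converts left linearity of \<sigma> into a relation on \<rho>.\<close>

lemma ev_simps:
  assumes x: "x \<in> carrier D" and t: "t \<in> carrier OM"
  shows "y \<in> carrier D \<Longrightarrow> ev (x \<oplus>\<^bsub>D\<^esub> y) t = ev x t \<oplus>\<^bsub>M\<^esub> ev y t"
    and "a \<in> carrier A \<Longrightarrow> ev (a \<odot>\<^bsub>D\<^esub> x) t = a \<odot>\<^bsub>M\<^esub> ev x t"
    and "a \<in> carrier A \<Longrightarrow> ev x (t \<triangleleft>\<^bsub>OM\<^esub> a) = ev x t \<triangleleft>\<^bsub>M\<^esub> a"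
    and "a \<in> carrier A \<Longrightarrow> ev (x \<triangleleft>\<^bsub>D\<^esub> a) t = ev x (a \<odot>\<^bsub>OM\<^esub> t)"
proof -
  show "ev (x \<oplus>\<^bsub>D\<^esub> y) t = ev x t \<oplus>\<^bsub>M\<^esub> ev y t" if y: "y \<in> carrier D"
    by (rule tensor_hom_eqI [OF OM_tensor M_group ev_hom [OF O.X_op_closed(1) [OF x y]]
          add_hom_plus [OF M_group ev_hom [OF x] ev_hom [OF y]] _ t])
      (simp add: ev_pure O.X_op_closed x y O.X_simps MB.l_add O.X_closed [OF x] O.X_closed [OF y])
  show "ev (a \<odot>\<^bsub>D\<^esub> x) t = a \<odot>\<^bsub>M\<^esub> ev x t" if a: "a \<in> carrier A"
    by (rule tensor_hom_eqI [OF OM_tensor M_group ev_hom [OF O.X_op_closed(2) [OF x a]]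
          add_hom_comp [OF ev_hom [OF x] MB.l_hom [OF a]] _ t])
      (simp add: ev_pure O.X_op_closed x a O.X_simps MB.l_assoc O.X_closed [OF x])
  show "ev x (t \<triangleleft>\<^bsub>OM\<^esub> a) = ev x t \<triangleleft>\<^bsub>M\<^esub> a" if a: "a \<in> carrier A"
    by (rule tensor_hom_eqI [OF OM_tensor M_group add_hom_comp [OF OM_rsmult_hom [OF a] ev_hom [OF x]]
          add_hom_comp [OF ev_hom [OF x] MB.r_hom [OF a]] _ t])
      (simp add: ev_pure OM_rsmult_pure x a MB.r_closed MB.lr_comm O.X_closed [OF x])
  show "ev (x \<triangleleft>\<^bsub>D\<^esub> a) t = ev x (a \<odot>\<^bsub>OM\<^esub> t)" if a: "a \<in> carrier A"
    by (rule tensor_hom_eqI [OF OM_tensor M_group ev_hom [OF O.X_op_closed(3) [OF x a]]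
          add_hom_comp [OF OM_smult_hom [OF a] ev_hom [OF x]] _ t])
      (simp add: ev_pure OM_smult_pure x a O.l_closed O.X_op_closed O.X_simps)
qed

text \<open>On a pure tensor, s \<otimes> e_s(w) m equals s e_s(w) \<otimes> m by balancing, and the
  sum over s gives w \<otimes> m. In particular an element is determined by its values under the
  maps \<open>ev (e s)\<close>.\<close>

lemma OM_expand:
  assumes t: "t \<in> carrier OM"
  shows "(\<Oplus>\<^bsub>OM\<^esub>s\<in>S. pOM s (ev (e s) t)) = t"
proof -
  show ?thesis
  proof (rule tensor_hom_eqI [OF OM_tensor OM_group add_hom_finsum [OF OM_group] add_hom_id _ t])
    show "(\<lambda>t. pOM s (ev (e s) t)) \<in> add_hom OM OM" if s: "s \<in> S" for s
      by (rule add_hom_comp [OF ev_hom [OF e [OF s]] biadditive_hom_right [OF pOM_biadd S_closed [OF s]]])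
    fix w m assume w: "w \<in> carrier \<Omega>" and m: "m \<in> carrier M"
    have "(\<Oplus>\<^bsub>OM\<^esub>s\<in>S. pOM s (ev (e s) (pOM w m))) = (\<Oplus>\<^bsub>OM\<^esub>s\<in>S. pOM (s \<triangleleft>\<^bsub>\<Omega>\<^esub> e s w) m)"
      by (rule abelian_group_finsum_cong [OF OM_group])
        (use w m in \<open>simp_all add: ev_pure e pure_balanced [OF OM_tensor] S_closed e_closed
            pOM_closed O.r_closed MB.l_closed\<close>)
    also have "\<dots> = pOM (\<Oplus>\<^bsub>\<Omega>\<^esub>s\<in>S. s \<triangleleft>\<^bsub>\<Omega>\<^esub> e s w) m"
      by (rule finsum_add_hom [OF O_group OM_group biadditive_hom_left [OF pOM_biadd m], symmetric])
        (use w in \<open>simp add: O.r_closed S_closed e_closed\<close>)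
    also have "\<dots> = pOM w m"
      using dual_basis [OF w] by simp
    finally show "(\<Oplus>\<^bsub>OM\<^esub>s\<in>S. pOM s (ev (e s) (pOM w m))) = pOM w m" .
  qed
qed

text \<open>An intertwining map \<open>\<sigma>\<close> is encoded by the operators \<open>m \<mapsto> x(\<sigma>(m \<otimes> w))\<close> on \<open>M\<close>; they satisfy
  \<open>pairing\<close>, which is what an action of the generators \<open>(x, w)\<close> has to satisfy.\<close>

definition pairing :: "(('w \<Rightarrow> 'a) \<Rightarrow> 'w \<Rightarrow> 'm \<Rightarrow> 'm) \<Rightarrow> bool" where
  "pairing \<rho> \<longleftrightarrow>
    (\<forall>m \<in> carrier M. biadditive D \<Omega> M (\<lambda>x w. \<rho> x w m)) \<and>
    (\<forall>x \<in> carrier D. \<forall>w \<in> carrier \<Omega>. \<rho> x w \<in> add_hom M M) \<and>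
    (\<forall>x \<in> carrier D. \<forall>w \<in> carrier \<Omega>. \<forall>m \<in> carrier M. \<forall>a \<in> carrier A.
       \<rho> (a \<odot>\<^bsub>D\<^esub> x) w m = a \<odot>\<^bsub>M\<^esub> \<rho> x w m \<and> \<rho> x (w \<triangleleft>\<^bsub>\<Omega>\<^esub> a) m = \<rho> x w m \<triangleleft>\<^bsub>M\<^esub> a \<and>
       \<rho> (x \<triangleleft>\<^bsub>D\<^esub> a) w m = \<rho> x w (a \<odot>\<^bsub>M\<^esub> m) \<and> \<rho> x (a \<odot>\<^bsub>\<Omega>\<^esub> w) m = \<rho> x w (m \<triangleleft>\<^bsub>M\<^esub> a))"

definition pairing_of where "pairing_of \<sigma> x w m = ev x (\<sigma> (pMO m w))"

lemma
  assumes "\<sigma> \<in> bimodule_hom A MO OM"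
  shows intertwiner_hom: "\<sigma> \<in> add_hom MO OM"
    and intertwiner_l: "\<lbrakk>a \<in> carrier A; t \<in> carrier MO\<rbrakk> \<Longrightarrow> \<sigma> (a \<odot>\<^bsub>MO\<^esub> t) = a \<odot>\<^bsub>OM\<^esub> \<sigma> t"
    and intertwiner_r: "\<lbrakk>a \<in> carrier A; t \<in> carrier MO\<rbrakk> \<Longrightarrow> \<sigma> (t \<triangleleft>\<^bsub>MO\<^esub> a) = \<sigma> t \<triangleleft>\<^bsub>OM\<^esub> a"
    and intertwiner_ext: "\<sigma> \<in> extensional (carrier MO)"
  using assms by (auto simp: bimodule_hom_def module_hom_def add_hom_def PiE_def)

text \<open>The four relations have separate sources, in order: left linearity of \<open>ev\<close>
  in x, right linearity of \<sigma>, left linearity of \<sigma>, and balancing in M \<otimes>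
  \<Omega>.\<close>

lemma pairing_of_pairing:
  assumes \<sigma>: "\<sigma> \<in> bimodule_hom A MO OM"
  shows "pairing (pairing_of \<sigma>)"
  unfolding pairing_def pairing_of_def
proof (intro conjI ballI)
  note h = intertwiner_hom [OF \<sigma>]
  note c = add_hom_closed [OF h]
  show "biadditive D \<Omega> M (\<lambda>x w. ev x (\<sigma> (pMO m w)))" if m: "m \<in> carrier M" for m
    unfolding biadditive_def
  proof (intro conjI ballI)
    show "(\<lambda>w. ev x (\<sigma> (pMO m w))) \<in> add_hom \<Omega> M" if x: "x \<in> carrier D" for x
      by (rule add_hom_comp [OF add_hom_comp [OF biadditive_hom_right [OF pMO_biadd m] h] ev_hom [OF x]])
    show "(\<lambda>x. ev x (\<sigma> (pMO m w))) \<in> add_hom D M" if w: "w \<in> carrier \<Omega>" for w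
      using m w by (intro add_homI) (simp_all add: ev_simps ev_closed c pMO_closed)
  qed
  fix x w assume x: "x \<in> carrier D" and w: "w \<in> carrier \<Omega>"
  show "(\<lambda>m. ev x (\<sigma> (pMO m w))) \<in> add_hom M M"
    by (rule add_hom_comp [OF add_hom_comp [OF biadditive_hom_left [OF pMO_biadd w] h] ev_hom [OF x]])
  fix m a assume m: "m \<in> carrier M" and a: "a \<in> carrier A"
  note p = pMO_closed [OF m w]
  show "ev (a \<odot>\<^bsub>D\<^esub> x) (\<sigma> (pMO m w)) = a \<odot>\<^bsub>M\<^esub> ev x (\<sigma> (pMO m w))"
    by (rule ev_simps(2) [OF x c [OF p] a])
  show "ev x (\<sigma> (pMO m (w \<triangleleft>\<^bsub>\<Omega>\<^esub> a))) = ev x (\<sigma> (pMO m w)) \<triangleleft>\<^bsub>M\<^esub> a"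
    using MO_rsmult_pure [OF a m w] intertwiner_r [OF \<sigma> a p] ev_simps(3) [OF x c [OF p] a] by simp
  show "ev (x \<triangleleft>\<^bsub>D\<^esub> a) (\<sigma> (pMO m w)) = ev x (\<sigma> (pMO (a \<odot>\<^bsub>M\<^esub> m) w))"
    using MO_smult_pure [OF a m w] intertwiner_l [OF \<sigma> a p] ev_simps(4) [OF x c [OF p] a] by simp
  show "ev x (\<sigma> (pMO m (a \<odot>\<^bsub>\<Omega>\<^esub> w))) = ev x (\<sigma> (pMO (m \<triangleleft>\<^bsub>M\<^esub> a) w))"
    using pure_balanced [OF MO_tensor m a w] by simp
qed

definition coev where "coev \<rho> m w = (\<Oplus>\<^bsub>OM\<^esub>s\<in>S. pOM s (\<rho> (e s) w m))"

text \<open>The restriction to the carrier meets the extensionality required of bimodule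
  homomorphisms, so that an intertwiner can be recovered as an equal function.\<close>

definition intertwiner_of where
  "intertwiner_of \<rho> = restrict (tensor_lift A M \<Omega> MO OM (coev \<rho>)) (carrier MO)"

context
  fixes \<rho> assumes \<rho>: "pairing \<rho>"
begin

lemma
  shows pairing_biadd: "m \<in> carrier M \<Longrightarrow> biadditive D \<Omega> M (\<lambda>x w. \<rho> x w m)"
    and pairing_hom: "\<lbrakk>x \<in> carrier D; w \<in> carrier \<Omega>\<rbrakk> \<Longrightarrow> \<rho> x w \<in> add_hom M M"
    and pairing_simps: "\<lbrakk>x \<in> carrier D; w \<in> carrier \<Omega>; m \<in> carrier M; a \<in> carrier A\<rbrakk>
      \<Longrightarrow> \<rho> (a \<odot>\<^bsub>D\<^esub> x) w m = a \<odot>\<^bsub>M\<^esub> \<rho> x w m"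
      "\<lbrakk>x \<in> carrier D; w \<in> carrier \<Omega>; m \<in> carrier M; a \<in> carrier A\<rbrakk> \<Longrightarrow> \<rho> x (w \<triangleleft>\<^bsub>\<Omega>\<^esub> a) m = \<rho> x w m \<triangleleft>\<^bsub>M\<^esub> a"
      "\<lbrakk>x \<in> carrier D; w \<in> carrier \<Omega>; m \<in> carrier M; a \<in> carrier A\<rbrakk> \<Longrightarrow> \<rho> (x \<triangleleft>\<^bsub>D\<^esub> a) w m = \<rho> x w (a \<odot>\<^bsub>M\<^esub> m)"
      "\<lbrakk>x \<in> carrier D; w \<in> carrier \<Omega>; m \<in> carrier M; a \<in> carrier A\<rbrakk> \<Longrightarrow> \<rho> x (a \<odot>\<^bsub>\<Omega>\<^esub> w) m = \<rho> x w (m \<triangleleft>\<^bsub>M\<^esub> a)"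
  using \<rho> by (simp_all add: pairing_def)

lemma pairing_closed: "\<lbrakk>x \<in> carrier D; w \<in> carrier \<Omega>; m \<in> carrier M\<rbrakk> \<Longrightarrow> \<rho> x w m \<in> carrier M"
  using add_hom_closed [OF pairing_hom] .

lemma coev_summand_closed:
  "\<lbrakk>s \<in> S; w \<in> carrier \<Omega>; m \<in> carrier M\<rbrakk> \<Longrightarrow> pOM s (\<rho> (e s) w m) \<in> carrier OM"
  by (simp add: pOM_closed S_closed e pairing_closed)

lemma coev_closed: "\<lbrakk>m \<in> carrier M; w \<in> carrier \<Omega>\<rbrakk> \<Longrightarrow> coev \<rho> m w \<in> carrier OM"
  unfolding coev_def
  by (intro abelian_group_finsum_closed [OF OM_group] Pi_I coev_summand_closed)

lemma coev_biadditive: "biadditive M \<Omega> OM (coev \<rho>)"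
  unfolding biadditive_def coev_def [abs_def]
proof (intro conjI ballI)
  show "(\<lambda>w. \<Oplus>\<^bsub>OM\<^esub>s\<in>S. pOM s (\<rho> (e s) w m)) \<in> add_hom \<Omega> OM" if m: "m \<in> carrier M" for m
  proof (rule add_hom_finsum [OF OM_group])
    show "(\<lambda>w. pOM s (\<rho> (e s) w m)) \<in> add_hom \<Omega> OM" if s: "s \<in> S" for s
      by (rule add_hom_comp [OF biadditive_hom_right [OF pairing_biadd [OF m] e [OF s]]
            biadditive_hom_right [OF pOM_biadd S_closed [OF s]]])
  qed
  show "(\<lambda>m. \<Oplus>\<^bsub>OM\<^esub>s\<in>S. pOM s (\<rho> (e s) w m)) \<in> add_hom M OM" if w: "w \<in> carrier \<Omega>" for w
  proof (rule add_hom_finsum [OF OM_group])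
    show "(\<lambda>m. pOM s (\<rho> (e s) w m)) \<in> add_hom M OM" if s: "s \<in> S" for s
      by (rule add_hom_comp [OF pairing_hom [OF e [OF s] w] biadditive_hom_right [OF pOM_biadd S_closed [OF s]]])
  qed
qed

lemma coev_balanced:
  "\<lbrakk>m \<in> carrier M; a \<in> carrier A; w \<in> carrier \<Omega>\<rbrakk> \<Longrightarrow> coev \<rho> (m \<triangleleft>\<^bsub>M\<^esub> a) w = coev \<rho> m (a \<odot>\<^bsub>\<Omega>\<^esub> w)"
  unfolding coev_def
  by (intro abelian_group_finsum_cong [OF OM_group] Pi_I coev_summand_closed)
    (simp_all add: pairing_simps e O.l_closed)

text \<open>Evaluation puts the coefficient x(s) in front of the operator for e_s; left linearity of
  \<rho> moves it into the first argument, where \<open>D_expand\<close> reassembles x. Hence the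
  choice of dual basis leaves no trace in the recovered operators.\<close>

lemma ev_coev:
  assumes x: "x \<in> carrier D" and m: "m \<in> carrier M" and w: "w \<in> carrier \<Omega>"
  shows "ev x (coev \<rho> m w) = \<rho> x w m"
proof -
  have "ev x (coev \<rho> m w) = (\<Oplus>\<^bsub>M\<^esub>s\<in>S. ev x (pOM s (\<rho> (e s) w m)))"
    unfolding coev_def
    by (rule finsum_add_hom [OF OM_group M_group ev_hom [OF x]]) (use m w in \<open>simp add: coev_summand_closed\<close>)
  also have "\<dots> = (\<Oplus>\<^bsub>M\<^esub>s\<in>S. \<rho> (x s \<odot>\<^bsub>D\<^esub> e s) w m)"
    by (rule abelian_group_finsum_cong [OF M_group])
      (use m w in \<open>simp_all add: ev_pure x S_closed e pairing_closed pairing_simps O.X_closed [OF x] MB.l_closed\<close>)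
  also have "\<dots> = \<rho> (\<Oplus>\<^bsub>D\<^esub>s\<in>S. x s \<odot>\<^bsub>D\<^esub> e s) w m"
    by (rule finsum_add_hom [OF O.X_abelian_group M_group biadditive_hom_left [OF pairing_biadd [OF m] w], symmetric])
      (simp add: DB.l_closed O.X_closed [OF x] S_closed e)
  also have "\<dots> = \<rho> x w m"
    using D_expand [OF x] by simp
  finally show ?thesis .
qed

lemma intertwiner_of_pure:
  assumes m: "m \<in> carrier M" and w: "w \<in> carrier \<Omega>"
  shows "intertwiner_of \<rho> (pMO m w) = coev \<rho> m w"
proof -
  have "tensor_lift A M \<Omega> MO OM (coev \<rho>) (pMO m w) = coev \<rho> m w"
    by (rule tensor_lift_pure [where f = "coev \<rho>", OF MO_tensor OM_group coev_biadditive coev_balanced])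
      (use m w in auto)
  then show ?thesis
    using pMO_closed [OF m w] by (simp add: intertwiner_of_def)
qed

text \<open>Right linearity holds in each summand, as both sides act on the M factor. For left
  linearity the elements a s leave the generating set, so the result is expanded again by
  \<open>OM_expand\<close> and its coefficients are computed through \<open>ev_coev\<close>.\<close>

lemma intertwiner_of_hom: "intertwiner_of \<rho> \<in> bimodule_hom A MO OM"
proof -
  have h0: "tensor_lift A M \<Omega> MO OM (coev \<rho>) \<in> add_hom MO OM"
    by (rule tensor_lift_hom [OF MO_tensor OM_group coev_biadditive coev_balanced])
  have h: "intertwiner_of \<rho> \<in> add_hom MO OM"
    using h0 by (intro add_homI) (simp_all add: intertwiner_of_def add_hom_closed add_hom_add
        abelian_monoid.a_closed [OF abelian_group.axioms(1) [OF MO_group]])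
  have l: "intertwiner_of \<rho> (a \<odot>\<^bsub>MO\<^esub> t) = a \<odot>\<^bsub>OM\<^esub> intertwiner_of \<rho> t"
    if a: "a \<in> carrier A" and t: "t \<in> carrier MO" for a t
  proof (rule tensor_hom_eqI [OF MO_tensor OM_group add_hom_comp [OF MO_smult_hom [OF a] h]
        add_hom_comp [OF h OM_smult_hom [OF a]] _ t])
    fix m w assume m: "m \<in> carrier M" and w: "w \<in> carrier \<Omega>"
    have am: "a \<odot>\<^bsub>M\<^esub> m \<in> carrier M" by (rule MB.l_closed [OF a m])
    note c = add_hom_closed [OF OM_smult_hom [OF a] coev_closed [OF m w]]
    \<comment> \<open>The coefficient of s in the new expansion is the value at e_s, where
      \<open>a\<close> can be moved to the functional and from there onto m.\<close>
    have "a \<odot>\<^bsub>OM\<^esub> coev \<rho> m w = (\<Oplus>\<^bsub>OM\<^esub>s\<in>S. pOM s (ev (e s) (a \<odot>\<^bsub>OM\<^esub> coev \<rho> m w)))"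
      by (rule OM_expand [OF c, symmetric])
    also have "\<dots> = coev \<rho> (a \<odot>\<^bsub>M\<^esub> m) w"
      unfolding coev_def [of _ "a \<odot>\<^bsub>M\<^esub> m"]
    proof (rule abelian_group_finsum_cong [OF OM_group])
      fix s assume s: "s \<in> S"
      have "ev (e s) (a \<odot>\<^bsub>OM\<^esub> coev \<rho> m w) = ev (e s \<triangleleft>\<^bsub>D\<^esub> a) (coev \<rho> m w)"
        by (rule ev_simps(4) [OF e [OF s] coev_closed [OF m w] a, symmetric])
      also have "\<dots> = \<rho> (e s) w (a \<odot>\<^bsub>M\<^esub> m)"
        using s a m w by (simp add: ev_coev e DB.r_closed pairing_simps)
      finally show "pOM s (ev (e s) (a \<odot>\<^bsub>OM\<^esub> coev \<rho> m w)) = pOM s (\<rho> (e s) w (a \<odot>\<^bsub>M\<^esub> m))"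
        by simp
    qed (use am w in \<open>simp add: coev_summand_closed\<close>)
    finally show "intertwiner_of \<rho> (a \<odot>\<^bsub>MO\<^esub> pMO m w) = a \<odot>\<^bsub>OM\<^esub> intertwiner_of \<rho> (pMO m w)"
      using m w a by (simp add: MO_smult_pure intertwiner_of_pure MB.l_closed)
  qed
  have r: "intertwiner_of \<rho> (t \<triangleleft>\<^bsub>MO\<^esub> a) = intertwiner_of \<rho> t \<triangleleft>\<^bsub>OM\<^esub> a"
    if a: "a \<in> carrier A" and t: "t \<in> carrier MO" for a t
  proof (rule tensor_hom_eqI [OF MO_tensor OM_group add_hom_comp [OF MO_rsmult_hom [OF a] h]
        add_hom_comp [OF h OM_rsmult_hom [OF a]] _ t])
    fix m w assume m: "m \<in> carrier M" and w: "w \<in> carrier \<Omega>"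
    have "coev \<rho> m w \<triangleleft>\<^bsub>OM\<^esub> a = (\<Oplus>\<^bsub>OM\<^esub>s\<in>S. pOM s (\<rho> (e s) w m) \<triangleleft>\<^bsub>OM\<^esub> a)"
      unfolding coev_def
      by (rule finsum_add_hom [OF OM_group OM_group OM_rsmult_hom [OF a]])
        (use m w in \<open>simp add: coev_summand_closed\<close>)
    also have "\<dots> = coev \<rho> m (w \<triangleleft>\<^bsub>\<Omega>\<^esub> a)"
      unfolding coev_def using m w a
      by (intro abelian_group_finsum_cong [OF OM_group] Pi_I coev_summand_closed O.r_closed)
        (simp_all add: OM_rsmult_pure S_closed pairing_closed e pairing_simps)
    finally show "intertwiner_of \<rho> (pMO m w \<triangleleft>\<^bsub>MO\<^esub> a) = intertwiner_of \<rho> (pMO m w) \<triangleleft>\<^bsub>OM\<^esub> a"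
      using m w a by (simp add: MO_rsmult_pure intertwiner_of_pure O.r_closed)
  qed
  have "intertwiner_of \<rho> \<in> extensional (carrier MO)"
    by (simp add: intertwiner_of_def)
  then show ?thesis
    using h l r by (simp add: bimodule_hom_def module_hom_def PiE_def add_hom_def)
qed

lemma pairing_of_intertwiner_of:
  "\<lbrakk>x \<in> carrier D; w \<in> carrier \<Omega>; m \<in> carrier M\<rbrakk> \<Longrightarrow> pairing_of (intertwiner_of \<rho>) x w m = \<rho> x w m"
  by (simp add: pairing_of_def intertwiner_of_pure ev_coev)

end

text \<open>Pairings are compared only on carriers, so \<open>coev\<close> must be shown insensitive
  to their other values.\<close>

lemma coev_cong:
  assumes m: "m \<in> carrier M" and w: "w \<in> carrier \<Omega>"
    and "\<And>x. x \<in> carrier D \<Longrightarrow> \<rho> x w m = \<rho>' x w m" "\<And>x. x \<in> carrier D \<Longrightarrow> \<rho>' x w m \<in> carrier M"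
  shows "coev \<rho> m w = coev \<rho>' m w"
  unfolding coev_def using assms
  by (intro abelian_group_finsum_cong [OF OM_group] Pi_I pOM_closed)
    (simp_all add: e S_closed)

text \<open>By \<open>OM_expand\<close> a given \<sigma> is reassembled from its own operators.
  Agreement of \<rho> with them is asked on carriers only, since the operators read off from a
  strict module are controlled only there.\<close>

lemma intertwiner_of_eqI:
  assumes \<sigma>: "\<sigma> \<in> bimodule_hom A MO OM" and \<rho>: "pairing \<rho>"
    and eq: "\<And>x w m. \<lbrakk>x \<in> carrier D; w \<in> carrier \<Omega>; m \<in> carrier M\<rbrakk> \<Longrightarrow> \<rho> x w m = pairing_of \<sigma> x w m"
  shows "intertwiner_of \<rho> = \<sigma>"
proof (rule extensionalityI [of _ "carrier MO"])
  note \<sigma>' = intertwiner_hom [OF \<sigma>]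
  show "intertwiner_of \<rho> \<in> extensional (carrier MO)"
    by (simp add: intertwiner_of_def)
  show "\<sigma> \<in> extensional (carrier MO)"
    by (rule intertwiner_ext [OF \<sigma>])
  fix t assume t: "t \<in> carrier MO"
  show "intertwiner_of \<rho> t = \<sigma> t"
  proof (rule tensor_hom_eqI [OF MO_tensor OM_group intertwiner_hom [OF intertwiner_of_hom [OF \<rho>]] \<sigma>' _ t])
    fix m w assume m: "m \<in> carrier M" and w: "w \<in> carrier \<Omega>"
    note c = add_hom_closed [OF \<sigma>' pMO_closed [OF m w]]
    have "coev \<rho> m w = coev (pairing_of \<sigma>) m w"
      using m w by (intro coev_cong) (simp_all add: eq pairing_of_def ev_closed c)
    also have "\<dots> = \<sigma> (pMO m w)"
      unfolding coev_def pairing_of_def by (rule OM_expand [OF c])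
    finally show "intertwiner_of \<rho> (pMO m w) = \<sigma> (pMO m w)"
      using m w by (simp add: intertwiner_of_pure [OF \<rho>])
  qed
qed

end

section \<open>Generators and relations of the algebra of dual pairs\<close>

context bimodule_setting
begin

abbreviation "BB \<equiv> tensor_algebra E P"
definition bielt where "bielt a b = PB.inR (elt a b)"
definition bipair where "bipair x w = PB.inV (pair x w)"

lemma bielt_closed: "\<lbrakk>a \<in> carrier A; b \<in> carrier A\<rbrakk> \<Longrightarrow> bielt a b \<in> carrier BB"
  by (simp add: bielt_def PB.inR_simps elt_closed)

lemma bielt_mult: "\<lbrakk>a \<in> carrier A; b \<in> carrier A; a' \<in> carrier A; b' \<in> carrier A\<rbrakk>
    \<Longrightarrow> bielt a b \<otimes>\<^bsub>BB\<^esub> bielt a' b' = bielt (a \<otimes>\<^bsub>A\<^esub> a') (b' \<otimes>\<^bsub>A\<^esub> b)"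
  by (simp add: bielt_def elt_closed E_mult_elt flip: PB.inR_simps(3))

lemma bielt_one: "bielt \<one>\<^bsub>A\<^esub> \<one>\<^bsub>A\<^esub> = \<one>\<^bsub>BB\<^esub>"
  by (simp add: bielt_def PB.inR_simps flip: E_one)

lemma inR_hom: "PB.inR \<in> add_hom E BB"
  by (intro add_homI) (simp_all add: PB.inR_simps)

lemma inV_hom: "PB.inV \<in> add_hom P BB"
  by (intro add_homI) (simp_all add: PB.inV_simps)

lemma bielt_biadditive: "biadditive A A BB bielt"
  unfolding bielt_def [abs_def] by (rule biadditive_post [OF elt_biadditive inR_hom])

lemma bipair_biadditive: "biadditive D \<Omega> BB bipair"
  unfolding bipair_def [abs_def] by (rule biadditive_post [OF pair_biadditive inV_hom])

lemma bipair_closed: "\<lbrakk>x \<in> carrier D; w \<in> carrier \<Omega>\<rbrakk> \<Longrightarrow> bipair x w \<in> carrier BB"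
  by (rule biadditive_closed [OF bipair_biadditive])

lemma bielt_bipair: "\<lbrakk>a \<in> carrier A; b \<in> carrier A; x \<in> carrier D; w \<in> carrier \<Omega>\<rbrakk>
    \<Longrightarrow> bielt a b \<otimes>\<^bsub>BB\<^esub> bipair x w = bipair (a \<odot>\<^bsub>D\<^esub> x) (w \<triangleleft>\<^bsub>\<Omega>\<^esub> b)"
  by (simp add: bielt_def bipair_def elt_closed pair_closed P_smult_pair flip: PB.inV_simps(3))

lemma bipair_bielt: "\<lbrakk>a \<in> carrier A; b \<in> carrier A; x \<in> carrier D; w \<in> carrier \<Omega>\<rbrakk>
    \<Longrightarrow> bipair x w \<otimes>\<^bsub>BB\<^esub> bielt a b = bipair (x \<triangleleft>\<^bsub>D\<^esub> a) (b \<odot>\<^bsub>\<Omega>\<^esub> w)"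
  by (simp add: bielt_def bipair_def elt_closed pair_closed P_rsmult_pair flip: PB.inV_simps(4))

text \<open>Balancing over \<open>K\<close> in the enveloping algebra. It forces the two actions of
  \<open>A\<close> read off from a module to agree on scalars, as the notion of an algebra bimodule
  demands.\<close>

lemma bielt_central: "k \<in> carrier K \<Longrightarrow> bielt (k \<odot>\<^bsub>A\<^esub> \<one>\<^bsub>A\<^esub>) \<one>\<^bsub>A\<^esub> = bielt \<one>\<^bsub>A\<^esub> (k \<odot>\<^bsub>A\<^esub> \<one>\<^bsub>A\<^esub>)"
  by (simp add: bielt_def elt_balanced)

text \<open>\<open>action_hom_generated\<close> asks for all of degrees zero and one; the pure
  elements suffice, because both sides are additive in the algebra element. It settles both the
  comparison of actions on objects and the comparison of morphisms.\<close>

lemma B_action_hom: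
  assumes N: "abelian_group N" and N': "abelian_group N'"
    and f: "is_action BB N f" and f': "is_action BB N' f'" and h: "h \<in> add_hom N N'"
    and elt: "\<And>a b n. \<lbrakk>a \<in> carrier A; b \<in> carrier A; n \<in> carrier N\<rbrakk> \<Longrightarrow> h (f (bielt a b) n) = f' (bielt a b) (h n)"
    and pair: "\<And>x w n. \<lbrakk>x \<in> carrier D; w \<in> carrier \<Omega>; n \<in> carrier N\<rbrakk> \<Longrightarrow> h (f (bipair x w) n) = f' (bipair x w) (h n)"
    and b: "b \<in> carrier BB" and n: "n \<in> carrier N"
  shows "h (f b n) = f' b (h n)"
proof (rule PB.action_hom_generated [OF N N' f f' h _ _ b n])
  note fl = biadditive_hom_left [OF is_action_simps(1) [OF f]]
    and fl' = biadditive_hom_left [OF is_action_simps(1) [OF f'] add_hom_closed [OF h]]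
  show "h (f (PB.inR r) n) = f' (PB.inR r) (h n)" if r: "r \<in> carrier E" and n: "n \<in> carrier N" for r n
    by (rule E_hom_eqI [OF N' add_hom_comp [OF add_hom_comp [OF inR_hom fl [OF n]] h]
          add_hom_comp [OF inR_hom fl' [OF n]] _ r])
      (simp add: elt n flip: bielt_def)
  show "h (f (PB.inV v) n) = f' (PB.inV v) (h n)" if v: "v \<in> carrier P" and n: "n \<in> carrier N" for v n
    by (rule P_hom_eqI [OF N' add_hom_comp [OF add_hom_comp [OF inV_hom fl [OF n]] h]
          add_hom_comp [OF inV_hom fl' [OF n]] _ v])
      (simp add: pair n flip: bipair_def)
qed

end

section \<open>From a pairing to an action of the algebra\<close>

context bimodule_over
begin

text \<open>The usual identification of bimodules with left modules over the enveloping algebra;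
  balancing over \<open>K\<close> uses that scalars act equally from both sides.\<close>

definition env_act where
  "env_act r m = tensor_lift K A1 A2 E M (\<lambda>a b. (a \<odot>\<^bsub>M\<^esub> m) \<triangleleft>\<^bsub>M\<^esub> b) r"

lemma
  assumes m: "m \<in> carrier M"
  shows env_act_hom: "(\<lambda>r. env_act r m) \<in> add_hom E M"
    and env_act_elt: "\<lbrakk>a \<in> carrier A; b \<in> carrier A\<rbrakk> \<Longrightarrow> env_act (elt a b) m = (a \<odot>\<^bsub>M\<^esub> m) \<triangleleft>\<^bsub>M\<^esub> b"
proof -
  let ?f = "\<lambda>a b. (a \<odot>\<^bsub>M\<^esub> m) \<triangleleft>\<^bsub>M\<^esub> b"
  have 1: "biadditive A1 A2 M ?f"
    using biadditive_comp [OF MB.r_biadd biadditive_hom_left [OF MB.l_biadd m] add_hom_id]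
    by (simp add: biadditive_def add_hom_def)
  have 2: "?f (a \<triangleleft>\<^bsub>A1\<^esub> k) b = ?f a (k \<odot>\<^bsub>A2\<^esub> b)" if "a \<in> carrier A1" "k \<in> carrier K" "b \<in> carrier A2" for a k b
    using that m Mb.scalar_simps(1) [of k a m] Mb.scalar_simps(3) [of k b "a \<odot>\<^bsub>M\<^esub> m"]
      Mb.scalar_simps(4) [of k b "a \<odot>\<^bsub>M\<^esub> m"]
    by (simp add: MB.l_closed)
  show "(\<lambda>r. env_act r m) \<in> add_hom E M"
    unfolding env_act_def by (rule tensor_lift_hom [where f = ?f, OF E_tensor M_group 1 2])
  show "env_act (elt a b) m = ?f a b" if "a \<in> carrier A" "b \<in> carrier A"
    unfolding env_act_def elt_def
    by (rule tensor_lift_pure [where f = ?f, OF E_tensor M_group 1 2]) (use that in auto)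
qed

lemma env_act_biadditive: "biadditive E M M env_act"
proof (rule biadditiveI)
  show "env_act r m \<in> carrier M" if "r \<in> carrier E" "m \<in> carrier M" for r m
    using env_act_hom [OF that(2)] that(1) by (rule add_hom_closed)
  show "env_act (r \<oplus>\<^bsub>E\<^esub> s) m = env_act r m \<oplus>\<^bsub>M\<^esub> env_act s m"
    if "r \<in> carrier E" "s \<in> carrier E" "m \<in> carrier M" for r s m
    using env_act_hom [OF that(3)] that(1,2) by (rule add_hom_add)
  fix r m n assume r: "r \<in> carrier E" and m: "m \<in> carrier M" and n: "n \<in> carrier M"
  note mn = abelian_monoid.a_closed [OF abelian_group.axioms(1) [OF M_group] m n]
  show "env_act r (m \<oplus>\<^bsub>M\<^esub> n) = env_act r m \<oplus>\<^bsub>M\<^esub> env_act r n"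
    by (rule E_hom_eqI [OF M_group env_act_hom [OF mn] add_hom_plus [OF M_group env_act_hom [OF m] env_act_hom [OF n]] _ r])
      (simp add: env_act_elt m n mn MB.l_add_right MB.r_add_left MB.l_closed)
qed

lemma env_act_action: "is_action E M env_act"
  unfolding is_action_def
proof (intro conjI ballI env_act_biadditive)
  fix m assume m: "m \<in> carrier M"
  show "env_act \<one>\<^bsub>E\<^esub> m = m"
    using m by (simp add: E_one env_act_elt MB.l_one MB.r_one)
  fix r s assume r: "r \<in> carrier E" and s: "s \<in> carrier E"
  show "env_act (r \<otimes>\<^bsub>E\<^esub> s) m = env_act r (env_act s m)"
  proof (rule E_biadditive_eqI [OF M_group biadditive_post [OF E_mult_biadditive env_act_hom [OF m]]
        biadditive_comp [OF env_act_biadditive add_hom_id env_act_hom [OF m]] _ r s])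
    show "env_act (elt a b \<otimes>\<^bsub>E\<^esub> elt a' b') m = env_act (elt a b) (env_act (elt a' b') m)"
      if "a \<in> carrier A" "b \<in> carrier A" "a' \<in> carrier A" "b' \<in> carrier A" for a b a' b'
      using that m
      by (simp add: E_mult_elt env_act_elt MB.l_closed MB.r_closed MB.l_assoc MB.r_assoc flip: MB.lr_comm)
  qed
qed

definition pair_act where
  "pair_act \<rho> v m = tensor_lift K D' O' P M (\<lambda>x w. \<rho> x w m) v"

context
  fixes \<rho> assumes \<rho>: "pairing \<rho>"
begin

lemmas rho_simps = pairing_simps [OF \<rho>]
lemmas rho_closed = pairing_closed [OF \<rho>]

text \<open>Balancing over \<open>K\<close> is not listed among the axioms of a pairing; it follows
  from them because scalars are central both in the dual and in M.\<close>

lemma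
  assumes m: "m \<in> carrier M"
  shows pair_act_hom: "(\<lambda>v. pair_act \<rho> v m) \<in> add_hom P M"
    and pair_act_pair: "\<lbrakk>x \<in> carrier D; w \<in> carrier \<Omega>\<rbrakk> \<Longrightarrow> pair_act \<rho> (pair x w) m = \<rho> x w m"
proof -
  let ?f = "\<lambda>x w. \<rho> x w m"
  have 1: "biadditive D' O' M ?f"
    using pairing_biadd [OF \<rho> m] by (simp add: biadditive_def add_hom_def)
  have 2: "?f (x \<triangleleft>\<^bsub>D'\<^esub> k) w = ?f x (k \<odot>\<^bsub>O'\<^esub> w)" if "x \<in> carrier D'" "k \<in> carrier K" "w \<in> carrier O'" for x k w
  proof -
    let ?k = "k \<odot>\<^bsub>A\<^esub> \<one>\<^bsub>A\<^esub>"
    have c: "x \<in> carrier D" "w \<in> carrier \<Omega>" "?k \<in> carrier A"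
      using that Om.scalar_closed by simp_all
    \<comment> \<open>The scalar travels from the dual to M and on to \<Omega>, changing sides once
      on the dual and once on M.\<close>
    have "\<rho> (?k \<odot>\<^bsub>D\<^esub> x) w m = \<rho> (x \<triangleleft>\<^bsub>D\<^esub> ?k) w m"
      using D.scalars_central [OF that(2) c(1)] by simp
    also have "\<dots> = \<rho> x w (m \<triangleleft>\<^bsub>M\<^esub> ?k)"
      using c m Mb.scalars_central [OF that(2) m] by (simp add: rho_simps)
    also have "\<dots> = \<rho> x (?k \<odot>\<^bsub>\<Omega>\<^esub> w) m"
      using c m by (simp add: rho_simps)
    finally show ?thesis by simp
  qed
  show "(\<lambda>v. pair_act \<rho> v m) \<in> add_hom P M"
    unfolding pair_act_def by (rule tensor_lift_hom [where f = ?f, OF P_tensor M_group 1 2])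
  show "pair_act \<rho> (pair x w) m = \<rho> x w m" if "x \<in> carrier D" "w \<in> carrier \<Omega>"
    unfolding pair_act_def pair_def
    by (rule tensor_lift_pure [where f = ?f, OF P_tensor M_group 1 2]) (use that in auto)
qed

lemma pair_act_biadditive: "biadditive P M M (pair_act \<rho>)"
proof (rule biadditiveI)
  show "pair_act \<rho> v m \<in> carrier M" if "v \<in> carrier P" "m \<in> carrier M" for v m
    using pair_act_hom [OF that(2)] that(1) by (rule add_hom_closed)
  show "pair_act \<rho> (v \<oplus>\<^bsub>P\<^esub> u) m = pair_act \<rho> v m \<oplus>\<^bsub>M\<^esub> pair_act \<rho> u m"
    if "v \<in> carrier P" "u \<in> carrier P" "m \<in> carrier M" for v u m
    using pair_act_hom [OF that(3)] that(1,2) by (rule add_hom_add)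
  fix v m n assume v: "v \<in> carrier P" and m: "m \<in> carrier M" and n: "n \<in> carrier M"
  note mn = abelian_monoid.a_closed [OF abelian_group.axioms(1) [OF M_group] m n]
  show "pair_act \<rho> v (m \<oplus>\<^bsub>M\<^esub> n) = pair_act \<rho> v m \<oplus>\<^bsub>M\<^esub> pair_act \<rho> v n"
    by (rule P_hom_eqI [OF M_group pair_act_hom [OF mn] add_hom_plus [OF M_group pair_act_hom [OF m] pair_act_hom [OF n]] _ v])
      (simp add: pair_act_pair m n mn add_hom_add [OF pairing_hom [OF \<rho>]])
qed

text \<open>On pure elements these are the first two relations of a pairing, combined into one
  action of the enveloping algebra.\<close>

lemma pair_act_smult:
  assumes r: "r \<in> carrier E" and v: "v \<in> carrier P" and m: "m \<in> carrier M"
  shows "pair_act \<rho> (r \<odot>\<^bsub>P\<^esub> v) m = env_act r (pair_act \<rho> v m)"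
proof (rule biadditive_eqI [OF E_tensor P_tensor M_group
      biadditive_post [OF P_smult_biadditive pair_act_hom [OF m]]
      biadditive_comp [OF env_act_biadditive add_hom_id pair_act_hom [OF m]] _ r v])
  fix a b x w assume "a \<in> carrier A1" "b \<in> carrier A2" "x \<in> carrier D'" "w \<in> carrier O'"
  then show "pair_act \<rho> (pure K A1 A2 a b \<odot>\<^bsub>P\<^esub> pure K D' O' x w) m
      = env_act (pure K A1 A2 a b) (pair_act \<rho> (pure K D' O' x w) m)"
    using m
    by (simp add: P_smult_pair env_act_elt pair_act_pair rho_simps rho_closed DB.l_closed O.r_closed
        flip: elt_def pair_def)
qed

text \<open>Counterpart for the last two relations, which move the scalars of the algebra onto the
  vector.\<close>

lemma pair_act_rsmult:
  assumes r: "r \<in> carrier E" and v: "v \<in> carrier P" and m: "m \<in> carrier M"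
  shows "pair_act \<rho> (v \<triangleleft>\<^bsub>P\<^esub> r) m = pair_act \<rho> v (env_act r m)"
proof (rule biadditive_eqI [OF P_tensor E_tensor M_group
      biadditive_post [OF P_rsmult_biadditive pair_act_hom [OF m]]
      biadditive_comp [OF pair_act_biadditive add_hom_id env_act_hom [OF m]] _ v r])
  fix x w a b assume "x \<in> carrier D'" "w \<in> carrier O'" "a \<in> carrier A1" "b \<in> carrier A2"
  then show "pair_act \<rho> (pure K D' O' x w \<triangleleft>\<^bsub>P\<^esub> pure K A1 A2 a b) m
      = pair_act \<rho> (pure K D' O' x w) (env_act (pure K A1 A2 a b) m)"
    using m
    by (simp add: P_rsmult_pair env_act_elt pair_act_pair rho_simps rho_closed DB.r_closed O.l_closed
        MB.l_closed MB.r_closed MB.lr_comm flip: elt_def pair_def)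
qed

lemma B_action_exists:
  "\<exists>f. is_action BB M f \<and>
    (\<forall>a \<in> carrier A. \<forall>b \<in> carrier A. \<forall>m \<in> carrier M. f (bielt a b) m = (a \<odot>\<^bsub>M\<^esub> m) \<triangleleft>\<^bsub>M\<^esub> b) \<and>
    (\<forall>x \<in> carrier D. \<forall>w \<in> carrier \<Omega>. \<forall>m \<in> carrier M. f (bipair x w) m = \<rho> x w m)"
proof -
  interpret act: tensor_algebra_action E P M env_act "pair_act \<rho>"
    by (intro tensor_algebra_action.intro tensor_algebra_action_axioms.intro P_ring_bimodule M_group
        env_act_action pair_act_biadditive pair_act_smult pair_act_rsmult)
  show ?thesis
    by (intro exI [of _ act.act] conjI ballI act.act_action)
      (simp_all add: bielt_def bipair_def act.act_inR act.act_inV elt_closed pair_closed env_act_elt pair_act_pair)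
qed

end

text \<open>The constructed action lives in an interpretation local to the existence proof, so it is
  named here by its values on generators; these determine it on the carriers.\<close>

definition B_action where
  "B_action \<rho> = (SOME f. is_action BB M f \<and>
    (\<forall>a \<in> carrier A. \<forall>b \<in> carrier A. \<forall>m \<in> carrier M. f (bielt a b) m = (a \<odot>\<^bsub>M\<^esub> m) \<triangleleft>\<^bsub>M\<^esub> b) \<and>
    (\<forall>x \<in> carrier D. \<forall>w \<in> carrier \<Omega>. \<forall>m \<in> carrier M. f (bipair x w) m = \<rho> x w m))"

lemma
  assumes "pairing \<rho>"
  shows B_action: "is_action BB M (B_action \<rho>)"
    and B_action_bielt: "\<lbrakk>a \<in> carrier A; b \<in> carrier A; m \<in> carrier M\<rbrakk>
      \<Longrightarrow> B_action \<rho> (bielt a b) m = (a \<odot>\<^bsub>M\<^esub> m) \<triangleleft>\<^bsub>M\<^esub> b"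
    and B_action_bipair: "\<lbrakk>x \<in> carrier D; w \<in> carrier \<Omega>; m \<in> carrier M\<rbrakk> \<Longrightarrow> B_action \<rho> (bipair x w) m = \<rho> x w m"
  using someI_ex [OF B_action_exists [OF assms]] unfolding B_action_def [symmetric] by blast+

end

section \<open>Morphisms in terms of pairings\<close>

locale two_bimodules = M: bimodule_over K A \<Omega> S e M + M': bimodule_over K A \<Omega> S e M'
  for K :: "('k, 'x) ring_scheme" and A :: "('k, 'a, 'y) module_scheme"
    and \<Omega> :: "('a, 'w, 'z) bimodule_scheme" and S e
    and M :: "('a, 'm, 'u) bimodule_scheme" and M' :: "('a, 'm', 'u') bimodule_scheme"
begin

text \<open>Applying \<open>ev x\<close> to the intertwining identity gives commutation with the
  operators. Conversely, commutation for the functionals e_s alone recovers the identity, since they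
  separate the elements of \<Omega> \<otimes> M'.\<close>

lemma intertwining_iff:
  assumes f: "f \<in> bimodule_hom A M M'"
    and \<sigma>: "\<sigma> \<in> bimodule_hom A M.MO M.OM" and \<sigma>': "\<sigma>' \<in> bimodule_hom A M'.MO M'.OM"
  shows "(\<forall>t \<in> carrier M.MO. \<sigma>' (tensor_map A M' \<Omega> f id t) = tensor_map A \<Omega> M' id f (\<sigma> t)) \<longleftrightarrow>
    (\<forall>x \<in> carrier M.D. \<forall>w \<in> carrier \<Omega>. \<forall>m \<in> carrier M.
       f (M.pairing_of \<sigma> x w m) = M'.pairing_of \<sigma>' x w (f m))"
proof -
  have fl: "f (a \<odot>\<^bsub>M\<^esub> m) = a \<odot>\<^bsub>M'\<^esub> f m" and fr: "f (m \<triangleleft>\<^bsub>M\<^esub> a) = f m \<triangleleft>\<^bsub>M'\<^esub> a"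
    if "a \<in> carrier A" "m \<in> carrier M" for a m
    using f that by (auto simp: bimodule_hom_def module_hom_def add_hom_def)
  have fh: "f \<in> add_hom M M'"
    using f by (auto simp: bimodule_hom_def module_hom_def add_hom_def)
  note fc = add_hom_closed [OF fh]
  have idh: "id \<in> add_hom \<Omega> \<Omega>" using add_hom_id by (simp add: id_def)
  have mapL_pure: "tensor_map A M' \<Omega> f id (M.pMO m w) = M'.pMO (f m) w"
    if "m \<in> carrier M" "w \<in> carrier \<Omega>" for m w
    using tensor_map_pure [OF M.MM M.OO M'.MM M.OO fh fr idh, of m w] that by simp
  have mapL: "tensor_map A M' \<Omega> f id \<in> add_hom M.MO M'.MO"
    using tensor_map_hom [OF M.MM M.OO M'.MM M.OO fh fr idh] by simp
  have mapR: "tensor_map A \<Omega> M' id f \<in> add_hom M.OM M'.OM"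
    using tensor_map_hom [OF M.OO M.MM M.OO M'.MM idh _ fh fl] by simp
  have mapR_pure: "tensor_map A \<Omega> M' id f (M.pOM w m) = M'.pOM w (f m)"
    if "m \<in> carrier M" "w \<in> carrier \<Omega>" for m w
    using tensor_map_pure [OF M.OO M.MM M.OO M'.MM idh _ fh fl, of w m] that by simp
  note h = M.intertwiner_hom [OF \<sigma>] and h' = M'.intertwiner_hom [OF \<sigma>']
  \<comment> \<open>Naturality of evaluation: on w \<otimes> m both sides are x(w) f(m), by left
    linearity of f.\<close>
  have f_ev: "f (M.ev x t) = M'.ev x (tensor_map A \<Omega> M' id f t)" if x: "x \<in> carrier M.D" and t: "t \<in> carrier M.OM" for x t
    by (rule tensor_hom_eqI [OF M.OM_tensor M'.M_group add_hom_comp [OF M.ev_hom [OF x] fh]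
          add_hom_comp [OF mapR M'.ev_hom [OF x]] _ t])
      (simp add: M.ev_pure M'.ev_pure mapR_pure x fl fc M.O.X_closed [OF x])
  show ?thesis
  proof (intro iffI ballI)
    fix x w m
    assume *: "\<forall>t \<in> carrier M.MO. \<sigma>' (tensor_map A M' \<Omega> f id t) = tensor_map A \<Omega> M' id f (\<sigma> t)"
      and x: "x \<in> carrier M.D" and w: "w \<in> carrier \<Omega>" and m: "m \<in> carrier M"
    note p = M.pMO_closed [OF m w]
    have "f (M.pairing_of \<sigma> x w m) = M'.ev x (tensor_map A \<Omega> M' id f (\<sigma> (M.pMO m w)))"
      unfolding M.pairing_of_def by (rule f_ev [OF x add_hom_closed [OF h p]])
    also have "tensor_map A \<Omega> M' id f (\<sigma> (M.pMO m w)) = \<sigma>' (M'.pMO (f m) w)"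
      using bspec [OF * p] unfolding mapL_pure [OF m w] by (rule sym)
    finally show "f (M.pairing_of \<sigma> x w m) = M'.pairing_of \<sigma>' x w (f m)"
      by (simp add: M'.pairing_of_def)
  next
    fix t
    assume *: "\<forall>x \<in> carrier M.D. \<forall>w \<in> carrier \<Omega>. \<forall>m \<in> carrier M.
       f (M.pairing_of \<sigma> x w m) = M'.pairing_of \<sigma>' x w (f m)" and t: "t \<in> carrier M.MO"
    show "\<sigma>' (tensor_map A M' \<Omega> f id t) = tensor_map A \<Omega> M' id f (\<sigma> t)"
    proof (rule tensor_hom_eqI [OF M.MO_tensor M'.OM_group add_hom_comp [OF mapL h'] add_hom_comp [OF h mapR] _ t])
      fix m w assume m: "m \<in> carrier M" and w: "w \<in> carrier \<Omega>"
      note p = M.pMO_closed [OF m w]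
      let ?u = "\<sigma>' (M'.pMO (f m) w)" and ?v = "tensor_map A \<Omega> M' id f (\<sigma> (M.pMO m w))"
      have u: "?u \<in> carrier M'.OM"
        by (rule add_hom_closed [OF h' M'.pMO_closed [OF fc [OF m] w]])
      have v: "?v \<in> carrier M'.OM"
        by (rule add_hom_closed [OF mapR add_hom_closed [OF h p]])
      \<comment> \<open>Both candidates are tested on the e_s; the expansions that follow turn this
        into equality.\<close>
      have eq: "M'.ev (e s) ?u = M'.ev (e s) ?v" if s: "s \<in> S" for s
      proof -
        have "M'.ev (e s) ?v = f (M.ev (e s) (\<sigma> (M.pMO m w)))"
          by (rule f_ev [OF M.e [OF s] add_hom_closed [OF h p], symmetric])
        then show ?thesis
          using * M.e [OF s] w m by (simp add: M.pairing_of_def M'.pairing_of_def)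
      qed
      have "?u = (\<Oplus>\<^bsub>M'.OM\<^esub>s\<in>S. M'.pOM s (M'.ev (e s) ?u))"
        by (rule M'.OM_expand [OF u, symmetric])
      also have "\<dots> = (\<Oplus>\<^bsub>M'.OM\<^esub>s\<in>S. M'.pOM s (M'.ev (e s) ?v))"
        by (rule abelian_group_finsum_cong [OF M'.OM_group])
          (use eq v in \<open>simp_all add: M'.pOM_closed M.S_closed M'.ev_closed M.e\<close>)
      also have "\<dots> = ?v"
        by (rule M'.OM_expand [OF v])
      finally show "\<sigma>' (tensor_map A M' \<Omega> f id (M.pMO m w)) = ?v"
        using mapL_pure [OF m w] by simp
    qed
  qed
qed

end

section \<open>The dual basis lemma\<close>

text \<open>The finite generating set makes \<open>P\<close> a quotient of the free module on it;
  projectivity lifts the identity of \<open>P\<close> along the quotient map, and the coordinates of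
  the lift are the functionals. The statement is for left modules and is meant for a right module
  viewed over the opposite ring.\<close>

lemma finitely_generated_projective_dual_basis:
  fixes R :: "('r, 'x) ring_scheme" and P :: "('r, 'p) module"
  assumes fg: "finitely_generated R P" and proj: "projective_module R P"
  shows "\<exists>S e. finite S \<and> S \<subseteq> carrier P \<and> (\<forall>s \<in> S. e s \<in> add_hom P R) \<and>
    (\<forall>s \<in> S. \<forall>r \<in> carrier R. \<forall>x \<in> carrier P. e s (r \<odot>\<^bsub>P\<^esub> x) = r \<otimes>\<^bsub>R\<^esub> e s x) \<and>
    (\<forall>x \<in> carrier P. x = (\<Oplus>\<^bsub>P\<^esub>s\<in>S. e s x \<odot>\<^bsub>P\<^esub> s))"
proof -
  interpret P: left_module R P
    using proj by (simp add: projective_module_def)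
  obtain S where S: "finite S" "S \<subseteq> carrier P"
    and span: "\<forall>x \<in> carrier P. \<exists>c \<in> S \<rightarrow> carrier R. x = (\<Oplus>\<^bsub>P\<^esub>s\<in>S. c s \<odot>\<^bsub>P\<^esub> s)"
    using fg by (auto simp: finitely_generated_def)
  \<comment> \<open>The free module on S as extensional coefficient functions; its type is the one
    over which \<open>projective_module\<close> lets the covering module range.\<close>
  define N :: "('r, 'p \<Rightarrow> 'r) module" where
    "N = \<lparr>carrier = S \<rightarrow>\<^sub>E carrier R, mult = undefined, one = undefined, ring.zero = (\<lambda>s \<in> S. \<zero>\<^bsub>R\<^esub>),
      add = (\<lambda>c d. \<lambda>s \<in> S. c s \<oplus>\<^bsub>R\<^esub> d s), smult = (\<lambda>r c. \<lambda>s \<in> S. r \<otimes>\<^bsub>R\<^esub> c s)\<rparr>"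
  have N_simps: "carrier N = S \<rightarrow>\<^sub>E carrier R" "\<zero>\<^bsub>N\<^esub> = (\<lambda>s \<in> S. \<zero>\<^bsub>R\<^esub>)"
    "c \<oplus>\<^bsub>N\<^esub> d = (\<lambda>s \<in> S. c s \<oplus>\<^bsub>R\<^esub> d s)" "r \<odot>\<^bsub>N\<^esub> c = (\<lambda>s \<in> S. r \<otimes>\<^bsub>R\<^esub> c s)" for c d r
    by (simp_all add: N_def)
  have Nc: "c s \<in> carrier R" if "c \<in> carrier N" "s \<in> S" for c s
    using that by (auto simp: N_simps)
  have Neq: "c = d" if "c \<in> carrier N" "d \<in> carrier N" "\<And>s. s \<in> S \<Longrightarrow> c s = d s" for c d
    using that unfolding N_simps by (rule PiE_ext)
  have N_group: "abelian_group N"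
  proof (rule abelian_groupI)
    show "\<exists>y \<in> carrier N. y \<oplus>\<^bsub>N\<^esub> x = \<zero>\<^bsub>N\<^esub>" if x: "x \<in> carrier N" for x
    proof
      show "(\<lambda>s \<in> S. \<ominus>\<^bsub>R\<^esub> x s) \<in> carrier N" using Nc [OF x] by (simp add: N_simps)
      show "(\<lambda>s \<in> S. \<ominus>\<^bsub>R\<^esub> x s) \<oplus>\<^bsub>N\<^esub> x = \<zero>\<^bsub>N\<^esub>"
        using Nc [OF x] by (simp add: N_simps P.R.l_neg cong: restrict_cong)
    qed
    show "x \<oplus>\<^bsub>N\<^esub> y \<in> carrier N" if "x \<in> carrier N" "y \<in> carrier N" for x y
      using Nc that by (simp add: N_simps)
    show z: "\<zero>\<^bsub>N\<^esub> \<in> carrier N" by (simp add: N_simps)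
    show "x \<oplus>\<^bsub>N\<^esub> y \<oplus>\<^bsub>N\<^esub> z = x \<oplus>\<^bsub>N\<^esub> (y \<oplus>\<^bsub>N\<^esub> z)"
      if "x \<in> carrier N" "y \<in> carrier N" "z \<in> carrier N" for x y z
      using Nc that by (simp add: N_simps P.R.a_assoc cong: restrict_cong)
    show "x \<oplus>\<^bsub>N\<^esub> y = y \<oplus>\<^bsub>N\<^esub> x" if "x \<in> carrier N" "y \<in> carrier N" for x y
      using Nc that by (simp add: N_simps P.R.a_comm cong: restrict_cong)
    show "\<zero>\<^bsub>N\<^esub> \<oplus>\<^bsub>N\<^esub> x = x" if x: "x \<in> carrier N" for x
      using Nc [OF x] by (intro Neq x) (simp_all add: N_simps)
  qed
  have N: "left_module R N"
    unfolding left_module_iff is_action_def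
  proof (intro conjI ballI P.R.ring_axioms N_group)
    show "biadditive R N N (smult N)"
      using Nc by (intro biadditiveI) (simp_all add: N_simps P.R.l_distr P.R.r_distr cong: restrict_cong)
    show "(r \<otimes>\<^bsub>R\<^esub> s) \<odot>\<^bsub>N\<^esub> n = r \<odot>\<^bsub>N\<^esub> (s \<odot>\<^bsub>N\<^esub> n)"
      if "r \<in> carrier R" "s \<in> carrier R" "n \<in> carrier N" for r s n
      using Nc that by (simp add: N_simps P.R.m_assoc cong: restrict_cong)
    show "\<one>\<^bsub>R\<^esub> \<odot>\<^bsub>N\<^esub> n = n" if n: "n \<in> carrier N" for n
      using Nc [OF n] by (intro Neq n) (simp_all add: N_simps)
  qed
  note act = left_module_iff [THEN iffD1, OF P.left_module_axioms]
  have Pb: "biadditive R P P (smult P)" using act by (simp add: is_action_def)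
  have P_group: "abelian_group P" using act by simp
  let ?g = "\<lambda>c \<in> carrier N. \<Oplus>\<^bsub>P\<^esub>s\<in>S. c s \<odot>\<^bsub>P\<^esub> s"
  have Sc: "s \<in> carrier P" if "s \<in> S" for s using S that by blast
  have summand: "(\<lambda>c. c s \<odot>\<^bsub>P\<^esub> s) \<in> add_hom N P" if s: "s \<in> S" for s
    by (rule add_hom_comp [OF _ biadditive_hom_left [OF Pb Sc [OF s]]])
      (use s Nc in \<open>auto intro!: add_homI simp: N_simps\<close>)
  have g: "(\<lambda>c. \<Oplus>\<^bsub>P\<^esub>s\<in>S. c s \<odot>\<^bsub>P\<^esub> s) \<in> add_hom N P"
    by (rule add_hom_finsum [OF P_group summand])
  have N_closed: "c \<oplus>\<^bsub>N\<^esub> d \<in> carrier N" "r \<in> carrier R \<Longrightarrow> r \<odot>\<^bsub>N\<^esub> c \<in> carrier N"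
    if "c \<in> carrier N" "d \<in> carrier N" for c d r
    using Nc that by (simp_all add: N_simps)
  have g_hom: "?g \<in> module_hom R N P"
  proof -
    have "(\<Oplus>\<^bsub>P\<^esub>s\<in>S. (r \<odot>\<^bsub>N\<^esub> c) s \<odot>\<^bsub>P\<^esub> s) = r \<odot>\<^bsub>P\<^esub> (\<Oplus>\<^bsub>P\<^esub>s\<in>S. c s \<odot>\<^bsub>P\<^esub> s)"
      if r: "r \<in> carrier R" and c: "c \<in> carrier N" for r c
    proof -
      have "r \<odot>\<^bsub>P\<^esub> (\<Oplus>\<^bsub>P\<^esub>s\<in>S. c s \<odot>\<^bsub>P\<^esub> s) = (\<Oplus>\<^bsub>P\<^esub>s\<in>S. r \<odot>\<^bsub>P\<^esub> (c s \<odot>\<^bsub>P\<^esub> s))"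
        by (rule finsum_add_hom [OF P_group P_group biadditive_hom_right [OF Pb r]])
          (use Nc [OF c] Sc in \<open>simp add: P.smult_closed\<close>)
      also have "\<dots> = (\<Oplus>\<^bsub>P\<^esub>s\<in>S. (r \<odot>\<^bsub>N\<^esub> c) s \<odot>\<^bsub>P\<^esub> s)"
        by (rule abelian_group_finsum_cong [OF P_group])
          (use Nc [OF c] Sc r in \<open>simp_all add: N_simps P.smult_closed P.smult_assoc\<close>)
      finally show ?thesis by simp
    qed
    then show ?thesis
      using add_hom_closed [OF g] add_hom_add [OF g] N_closed
      by (simp add: module_hom_def)
  qed
  have "?g ` carrier N = carrier P"
  proof
    show "?g ` carrier N \<subseteq> carrier P" using add_hom_closed [OF g] by auto
    show "carrier P \<subseteq> ?g ` carrier N"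
    proof
      fix x assume "x \<in> carrier P"
      then obtain c where c: "c \<in> S \<rightarrow> carrier R" "x = (\<Oplus>\<^bsub>P\<^esub>s\<in>S. c s \<odot>\<^bsub>P\<^esub> s)" using span by blast
      \<comment> \<open>Coefficients have to be cut down to S to be extensional; the sum does not
        see the change.\<close>
      have cN: "restrict c S \<in> carrier N" using c by (auto simp: N_simps)
      have "(\<Oplus>\<^bsub>P\<^esub>s\<in>S. restrict c S s \<odot>\<^bsub>P\<^esub> s) = x"
        unfolding c(2) by (rule abelian_group_finsum_cong [OF P_group]) (use c Sc P.smult_closed in auto)
      then have "x = ?g (restrict c S)"
        unfolding restrict_apply' [OF cN] by (rule sym)
      then show "x \<in> ?g ` carrier N" using cN by (rule image_eqI)
    qed
  qed
  moreover have "(\<lambda>x \<in> carrier P. x) \<in> module_hom R P P"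
    using P.smult_closed by (auto simp: module_hom_def)
  \<comment> \<open>The lifting property is used with \<open>Q = P\<close> and the identity, written
    as an extensional function to be a \<open>module_hom\<close>.\<close>
  ultimately obtain h where h: "h \<in> module_hom R P N" and gh: "\<forall>x \<in> carrier P. ?g (h x) = (\<lambda>x \<in> carrier P. x) x"
    using proj N P.left_module_axioms g_hom unfolding projective_module_def by blast
  have hc: "h x \<in> carrier N" if "x \<in> carrier P" for x
    using h that by (auto simp: module_hom_def)
  show ?thesis
  proof (intro exI [of _ S] exI [of _ "\<lambda>s x. h x s"] conjI ballI S)
    show "(\<lambda>x. h x s) \<in> add_hom P R" if "s \<in> S" for s
      using h hc Nc that by (intro add_homI) (auto simp: module_hom_def N_simps)
    show "h (r \<odot>\<^bsub>P\<^esub> x) s = r \<otimes>\<^bsub>R\<^esub> h x s" if "s \<in> S" "r \<in> carrier R" "x \<in> carrier P" for s r x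
      using h that by (auto simp: module_hom_def N_simps)
    show "x = (\<Oplus>\<^bsub>P\<^esub>s\<in>S. h x s \<odot>\<^bsub>P\<^esub> s)" if "x \<in> carrier P" for x
      using gh hc that by simp
  qed
qed

section \<open>The isomorphism of categories\<close>

text \<open>When corresponding Hom-sets, identities and compositions are literally equal, both
  functors can be the identity on morphisms. The category laws then pass from \<open>C\<close> to
  \<open>D\<close> along \<open>G\<close> and need no separate proof.\<close>

lemma isomorphic_categoriesI:
  fixes C :: "('o, 'h) cat" and D :: "('p, 'h) cat"
  assumes "category C"
    and F: "\<And>X. X \<in> Obj C \<Longrightarrow> F X \<in> Obj D" and G: "\<And>Y. Y \<in> Obj D \<Longrightarrow> G Y \<in> Obj C"
    and GF: "\<And>X. X \<in> Obj C \<Longrightarrow> G (F X) = X" and FG: "\<And>Y. Y \<in> Obj D \<Longrightarrow> F (G Y) = Y"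
    and Hom: "\<And>X Y. \<lbrakk>X \<in> Obj C; Y \<in> Obj C\<rbrakk> \<Longrightarrow> Hom D (F X) (F Y) = Hom C X Y"
    and Id: "\<And>X. X \<in> Obj C \<Longrightarrow> Id D (F X) = Id C X"
    and Comp: "\<And>X Y Z. \<lbrakk>X \<in> Obj C; Y \<in> Obj C; Z \<in> Obj C\<rbrakk> \<Longrightarrow> Comp D (F X) (F Y) (F Z) = Comp C X Y Z"
  shows "isomorphic_categories C D"
proof -
  interpret C: category C by fact
  have Hom': "Hom D X Y = Hom C (G X) (G Y)" if "X \<in> Obj D" "Y \<in> Obj D" for X Y
    using Hom [of "G X" "G Y"] that by (simp add: G FG)
  have Id': "Id D X = Id C (G X)" if "X \<in> Obj D" for X
    using Id [of "G X"] that by (simp add: G FG)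
  have Comp': "Comp D X Y Z = Comp C (G X) (G Y) (G Z)" if "X \<in> Obj D" "Y \<in> Obj D" "Z \<in> Obj D" for X Y Z
    using Comp [of "G X" "G Y" "G Z"] that by (simp add: G FG)
  interpret D: category D
  proof
    show "Id D X \<in> Hom D X X" if "X \<in> Obj D" for X
      using that by (simp add: Hom' Id' G C.Id_in_Hom)
    show "Comp D X Y Z g f \<in> Hom D X Z"
      if "X \<in> Obj D" "Y \<in> Obj D" "Z \<in> Obj D" "f \<in> Hom D X Y" "g \<in> Hom D Y Z" for X Y Z f g
      using that C.Comp_in_Hom [of "G X" "G Y" "G Z" f g] by (simp add: Hom' Comp' G)
    show "Comp D X X Y f (Id D X) = f" if "X \<in> Obj D" "Y \<in> Obj D" "f \<in> Hom D X Y" for X Y f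
      using that C.Comp_Id_right [of "G X" "G Y" f] by (simp add: Hom' Comp' Id' G)
    show "Comp D X Y Y (Id D Y) f = f" if "X \<in> Obj D" "Y \<in> Obj D" "f \<in> Hom D X Y" for X Y f
      using that C.Comp_Id_left [of "G X" "G Y" f] by (simp add: Hom' Comp' Id' G)
    show "Comp D W X Z (Comp D X Y Z h g) f = Comp D W Y Z h (Comp D W X Y g f)"
      if "W \<in> Obj D" "X \<in> Obj D" "Y \<in> Obj D" "Z \<in> Obj D" "f \<in> Hom D W X" "g \<in> Hom D X Y" "h \<in> Hom D Y Z"
      for W X Y Z f g h
      using that C.Comp_assoc [of "G W" "G X" "G Y" "G Z" f g h] by (simp add: Hom' Comp' G)
  qed
  have "cat_functor C D F (\<lambda>_ _ f. f)"
    by unfold_locales (simp_all add: F Hom Id Comp)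
  moreover have "cat_functor D C G (\<lambda>_ _ f. f)"
    by unfold_locales (simp_all add: G Hom' Id' Comp')
  ultimately show ?thesis
    unfolding isomorphic_categories_def
    by (intro exI [of _ F] exI [of _ G] exI [of _ "\<lambda>_ _ f. f"]) (simp add: GF FG)
qed

lemma left_module_category_is_category:
  assumes "ring R"
  shows "category (left_module_category R :: (('r, 'm) module, 'm \<Rightarrow> 'm) cat)"
proof -
  have add_closed: "x \<oplus>\<^bsub>M\<^esub> y \<in> carrier M"
    if "left_module R M" "x \<in> carrier M" "y \<in> carrier M" for M :: "('r, 'm) module" and x y
    using that by (simp add: left_module_iff abelian_group_def abelian_monoid.a_closed)
  have smult_closed: "r \<odot>\<^bsub>M\<^esub> x \<in> carrier M"
    if "left_module R M" "r \<in> carrier R" "x \<in> carrier M" for M :: "('r, 'm) module" and r x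
    using that by (simp add: left_module.smult_closed)
  have module_hom_compose: "compose (carrier X) g f \<in> module_hom R X Z"
    if X: "left_module R X" and f: "f \<in> module_hom R X Y" and g: "g \<in> module_hom R Y Z"
    for X Y Z :: "('r, 'm) module" and f g
  proof -
    have fc: "f x \<in> carrier Y" if "x \<in> carrier X" for x
      using f that by (auto simp: module_hom_def)
    have gc: "g y \<in> carrier Z" if "y \<in> carrier Y" for y
      using g that by (auto simp: module_hom_def)
    have 1: "compose (carrier X) g f \<in> carrier X \<rightarrow>\<^sub>E carrier Z"
      using fc gc by (auto simp: compose_def)
    have 2: "compose (carrier X) g f (x \<oplus>\<^bsub>X\<^esub> y) = compose (carrier X) g f x \<oplus>\<^bsub>Z\<^esub> compose (carrier X) g f y"
      if "x \<in> carrier X" "y \<in> carrier X" for x y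
      using add_closed [OF X that] f g fc that by (simp add: compose_eq module_hom_def)
    have 3: "compose (carrier X) g f (r \<odot>\<^bsub>X\<^esub> x) = r \<odot>\<^bsub>Z\<^esub> compose (carrier X) g f x"
      if "r \<in> carrier R" "x \<in> carrier X" for r x
      using smult_closed [OF X that] f g fc that by (simp add: compose_eq module_hom_def)
    show ?thesis
      unfolding module_hom_def by (intro CollectI conjI ballI 1 2 3)
  qed
  show ?thesis
  proof
    fix W X Y Z :: "('r, 'm) module" and f g h
    let ?C = "left_module_category R :: (('r, 'm) module, 'm \<Rightarrow> 'm) cat"
    show "Id ?C X \<in> Hom ?C X X" if "X \<in> Obj ?C"
      using that by (simp add: left_module_category_def module_hom_def add_closed smult_closed)
    show "Comp ?C X Y Z g f \<in> Hom ?C X Z"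
      if "X \<in> Obj ?C" "Y \<in> Obj ?C" "Z \<in> Obj ?C" "f \<in> Hom ?C X Y" "g \<in> Hom ?C Y Z"
      using module_hom_compose [of X f Y g Z] that by (simp add: left_module_category_def)
    show "Comp ?C X X Y f (Id ?C X) = f" if "X \<in> Obj ?C" "Y \<in> Obj ?C" "f \<in> Hom ?C X Y"
      using that compose_Id [of f "carrier X" "carrier Y"]
      by (simp add: left_module_category_def module_hom_def PiE_def)
    show "Comp ?C X Y Y (Id ?C Y) f = f" if "X \<in> Obj ?C" "Y \<in> Obj ?C" "f \<in> Hom ?C X Y"
      using that Id_compose [of f "carrier X" "carrier Y"]
      by (simp add: left_module_category_def module_hom_def PiE_def)
    show "Comp ?C W X Z (Comp ?C X Y Z h g) f = Comp ?C W Y Z h (Comp ?C W X Y g f)"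
      if "W \<in> Obj ?C" "X \<in> Obj ?C" "Y \<in> Obj ?C" "Z \<in> Obj ?C"
        "f \<in> Hom ?C W X" "g \<in> Hom ?C X Y" "h \<in> Hom ?C Y Z"
      using that compose_assoc [of f "carrier W" "carrier X" h g]
      by (simp add: left_module_category_def module_hom_def PiE_def)
  qed
qed

text \<open>Fixes scalar multiplication off the carriers, where the algebra says nothing; both round
  trips need it for equality of records.\<close>

lemma strict_module_undefined:
  assumes "strict_module R M" "\<not> (r \<in> carrier R \<and> m \<in> carrier M)"
  shows "r \<odot>\<^bsub>M\<^esub> m = undefined"
  using extensional_arb [of "\<lambda>(r, m). r \<odot>\<^bsub>M\<^esub> m" "carrier R \<times> carrier M" "(r, m)"] assms
  by (auto simp: strict_module_def)

section \<open>The two constructions on objects and their agreement on morphisms\<close>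

locale B_module_setting = dual_basis_setting K A \<Omega> S e
  for K :: "('k, 'x) ring_scheme" and A :: "('k, 'a, 'y) module_scheme"
    and \<Omega> :: "('a, 'w) bimodule" and S e
begin

text \<open>An element \<open>a\<close> acts on the left through the first factor of the enveloping
  algebra and on the right through the second. The guards make the result strict, so that equality
  with a given bimodule is possible.\<close>

definition bimodule_of :: "(_, 'm) module \<Rightarrow> ('a, 'm) bimodule" where
  "bimodule_of N = \<lparr>carrier = carrier N, mult = undefined, one = undefined,
     ring.zero = \<zero>\<^bsub>N\<^esub>, add = add N,
     smult = (\<lambda>a m. if a \<in> carrier A \<and> m \<in> carrier N then bielt a \<one>\<^bsub>A\<^esub> \<odot>\<^bsub>N\<^esub> m else undefined),
     rsmult = (\<lambda>m a. if a \<in> carrier A \<and> m \<in> carrier N then bielt \<one>\<^bsub>A\<^esub> a \<odot>\<^bsub>N\<^esub> m else undefined)\<rparr>"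

definition pair_op :: "(_, 'm) module \<Rightarrow> ('w \<Rightarrow> 'a) \<Rightarrow> 'w \<Rightarrow> 'm \<Rightarrow> 'm" where
  "pair_op N x w m = bipair x w \<odot>\<^bsub>N\<^esub> m"

definition intertwined_of where
  "intertwined_of N = (bimodule_of N, bimodule_over.intertwiner_of A \<Omega> S e (bimodule_of N) (pair_op N))"

text \<open>The locale constants carry explicit arguments because the bimodule varies with the
  object. As before, the guards produce a strict module.\<close>

definition B_module_of :: "('a, 'm) bimodule \<times> _ \<Rightarrow> (_, 'm) module" where
  "B_module_of = (\<lambda>(M, \<sigma>). \<lparr>carrier = carrier M, mult = undefined, one = undefined,
     ring.zero = \<zero>\<^bsub>M\<^esub>, add = add M,
     smult = (\<lambda>b m. if b \<in> carrier BB \<and> m \<in> carrier M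
       then bimodule_over.B_action K A \<Omega> M (bimodule_over.pairing_of A \<Omega> M \<sigma>) b m else undefined)\<rparr>)"

lemma bimodule_of_simps:
  "carrier (bimodule_of N) = carrier N" "add (bimodule_of N) = add N" "\<zero>\<^bsub>bimodule_of N\<^esub> = \<zero>\<^bsub>N\<^esub>"
  "\<lbrakk>a \<in> carrier A; m \<in> carrier N\<rbrakk> \<Longrightarrow> a \<odot>\<^bsub>bimodule_of N\<^esub> m = bielt a \<one>\<^bsub>A\<^esub> \<odot>\<^bsub>N\<^esub> m"
  "\<lbrakk>a \<in> carrier A; m \<in> carrier N\<rbrakk> \<Longrightarrow> m \<triangleleft>\<^bsub>bimodule_of N\<^esub> a = bielt \<one>\<^bsub>A\<^esub> a \<odot>\<^bsub>N\<^esub> m"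
  by (simp_all add: bimodule_of_def)

lemma B_module_of_simps:
  "carrier (B_module_of (M, \<sigma>)) = carrier M" "add (B_module_of (M, \<sigma>)) = add M" "\<zero>\<^bsub>B_module_of (M, \<sigma>)\<^esub> = \<zero>\<^bsub>M\<^esub>"
  "\<lbrakk>b \<in> carrier BB; m \<in> carrier M\<rbrakk> \<Longrightarrow> b \<odot>\<^bsub>B_module_of (M, \<sigma>)\<^esub> m =
     bimodule_over.B_action K A \<Omega> M (bimodule_over.pairing_of A \<Omega> M \<sigma>) b m"
  by (simp_all add: B_module_of_def)

lemma bimodule_over:
  "algebra_bimodule K A M \<Longrightarrow> bimodule_over K A \<Omega> S e M"
  by (intro bimodule_over.intro dual_basis_setting_axioms)

context
  fixes N :: "(_, 'm) module" assumes N: "left_module BB N"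
begin

lemma
  shows N_group: "abelian_group N" and N_action: "is_action BB N (smult N)"
  using N by (simp_all add: left_module_iff)

lemmas N_biadd = is_action_simps(1) [OF N_action]
lemmas N_closed = biadditive_closed [OF N_biadd]
lemmas N_mult = is_action_simps(2) [OF N_action, symmetric]

text \<open>The right action law comes out in the correct order because \<open>bielt_mult\<close>
  reverses the second factors; the two actions commute as both composites are given by the same
  \<open>bielt r s\<close>.\<close>

lemma bimodule_of_ring_bimodule: "ring_bimodule A (bimodule_of N)"
proof (intro ring_bimodule.intro ring_bimodule_axioms.intro A.ring_axioms)
  note act = bimodule_of_simps N_closed bielt_closed
  note be = biadditive_left [OF bielt_biadditive] biadditive_right [OF bielt_biadditive]
  note Nd = biadditive_left [OF N_biadd] biadditive_right [OF N_biadd]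
  note Na = abelian_monoid.a_closed [OF abelian_group.axioms(1) [OF N_group]]
  show "abelian_group (bimodule_of N)"
    by (rule abelian_group_cong [OF _ _ _ N_group]) (simp_all add: bimodule_of_simps)
  show "biadditive A (bimodule_of N) (bimodule_of N) (smult (bimodule_of N))"
    by (rule biadditiveI) (simp_all add: act be Nd Na)
  show "biadditive (bimodule_of N) A (bimodule_of N) (rsmult (bimodule_of N))"
    by (rule biadditiveI) (simp_all add: act be Nd Na)
  fix r s v assume r: "r \<in> carrier A" and s: "s \<in> carrier A" and v: "v \<in> carrier (bimodule_of N)"
  show "(r \<otimes>\<^bsub>A\<^esub> s) \<odot>\<^bsub>bimodule_of N\<^esub> v = r \<odot>\<^bsub>bimodule_of N\<^esub> (s \<odot>\<^bsub>bimodule_of N\<^esub> v)"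
    using r s v by (simp add: act N_mult bielt_mult)
  show "(v \<triangleleft>\<^bsub>bimodule_of N\<^esub> r) \<triangleleft>\<^bsub>bimodule_of N\<^esub> s = v \<triangleleft>\<^bsub>bimodule_of N\<^esub> (r \<otimes>\<^bsub>A\<^esub> s)"
    using r s v by (simp add: act N_mult bielt_mult)
  show "(r \<odot>\<^bsub>bimodule_of N\<^esub> v) \<triangleleft>\<^bsub>bimodule_of N\<^esub> s = r \<odot>\<^bsub>bimodule_of N\<^esub> (v \<triangleleft>\<^bsub>bimodule_of N\<^esub> s)"
    using r s v by (simp add: act N_mult bielt_mult)
next
  fix v assume v: "v \<in> carrier (bimodule_of N)"
  show "\<one>\<^bsub>A\<^esub> \<odot>\<^bsub>bimodule_of N\<^esub> v = v" "v \<triangleleft>\<^bsub>bimodule_of N\<^esub> \<one>\<^bsub>A\<^esub> = v"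
    using v by (simp_all add: bimodule_of_simps bielt_one is_action_simps(3) [OF N_action])
qed

lemma bimodule_of_algebra_bimodule: "algebra_bimodule K A (bimodule_of N)"
  by (rule algebra_bimoduleI [OF assoc_algebra_axioms bimodule_of_ring_bimodule])
    (simp add: bimodule_of_simps bielt_central)

text \<open>The element \<open>bielt a b\<close> factors as \<open>bielt \<one> b\<close> times
  \<open>bielt a \<one>\<close>, so the action of degree zero is recovered from the two one-sided
  actions.\<close>

lemma bielt_smult:
  "\<lbrakk>a \<in> carrier A; b \<in> carrier A; m \<in> carrier N\<rbrakk>
    \<Longrightarrow> bielt a b \<odot>\<^bsub>N\<^esub> m = (a \<odot>\<^bsub>bimodule_of N\<^esub> m) \<triangleleft>\<^bsub>bimodule_of N\<^esub> b"
  by (simp add: bimodule_of_simps N_closed bielt_closed N_mult bielt_mult)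

interpretation M: bimodule_over K A \<Omega> S e "bimodule_of N"
  by (rule bimodule_over [OF bimodule_of_algebra_bimodule])

text \<open>The four relations are \<open>bielt_bipair\<close> and \<open>bipair_bielt\<close> with
  one of the two coordinates equal to the unit.\<close>

lemma pair_op_pairing: "M.pairing (pair_op N)"
  unfolding M.pairing_def pair_op_def
proof (intro conjI ballI)
  show "biadditive D \<Omega> (bimodule_of N) (\<lambda>x w. bipair x w \<odot>\<^bsub>N\<^esub> m)" if m: "m \<in> carrier (bimodule_of N)" for m
    using biadditive_post [OF bipair_biadditive biadditive_hom_left [OF N_biadd]] m
    by (simp add: bimodule_of_simps biadditive_def add_hom_def)
  fix x w assume x: "x \<in> carrier D" and w: "w \<in> carrier \<Omega>"
  note b = bipair_closed [OF x w]
  show "smult N (bipair x w) \<in> add_hom (bimodule_of N) (bimodule_of N)"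
    using biadditive_hom_right [OF N_biadd b] by (simp add: add_hom_def bimodule_of_simps)
  fix m a assume "m \<in> carrier (bimodule_of N)" and a: "a \<in> carrier A"
  then have m: "m \<in> carrier N" by (simp add: bimodule_of_simps)
  note simps = bimodule_of_simps N_closed bielt_closed b N_mult bielt_bipair bipair_bielt DB.l_one DB.r_one
    O.l_one O.r_one
  show "bipair (a \<odot>\<^bsub>D\<^esub> x) w \<odot>\<^bsub>N\<^esub> m = a \<odot>\<^bsub>bimodule_of N\<^esub> (bipair x w \<odot>\<^bsub>N\<^esub> m)"
    using x w m a by (simp add: simps)
  show "bipair x (w \<triangleleft>\<^bsub>\<Omega>\<^esub> a) \<odot>\<^bsub>N\<^esub> m = (bipair x w \<odot>\<^bsub>N\<^esub> m) \<triangleleft>\<^bsub>bimodule_of N\<^esub> a"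
    using x w m a by (simp add: simps)
  show "bipair (x \<triangleleft>\<^bsub>D\<^esub> a) w \<odot>\<^bsub>N\<^esub> m = bipair x w \<odot>\<^bsub>N\<^esub> (a \<odot>\<^bsub>bimodule_of N\<^esub> m)"
    using x w m a by (simp add: simps)
  show "bipair x (a \<odot>\<^bsub>\<Omega>\<^esub> w) \<odot>\<^bsub>N\<^esub> m = bipair x w \<odot>\<^bsub>N\<^esub> (m \<triangleleft>\<^bsub>bimodule_of N\<^esub> a)"
    using x w m a by (simp add: simps)
qed

lemma intertwined_of_closed:
  assumes "strict_module BB N"
  shows "intertwined_of N \<in> intertwined_bimodules K A \<Omega>"
proof -
  have "strict_module A (bimodule_of N)"
    "(\<lambda>(x, r). x \<triangleleft>\<^bsub>bimodule_of N\<^esub> r) \<in> extensional (carrier (bimodule_of N) \<times> carrier A)"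
    using assms by (auto simp: strict_module_def bimodule_of_def extensional_def)
  then show ?thesis
    using bimodule_of_algebra_bimodule M.intertwiner_of_hom [OF pair_op_pairing]
    by (simp add: intertwined_of_def intertwined_bimodules_def)
qed

lemma intertwined_of_pairing:
  "\<lbrakk>x \<in> carrier D; w \<in> carrier \<Omega>; m \<in> carrier N\<rbrakk> \<Longrightarrow> M.pairing_of (snd (intertwined_of N)) x w m = pair_op N x w m"
  using M.pairing_of_intertwiner_of [OF pair_op_pairing, of x w m]
  by (simp add: intertwined_of_def bimodule_of_simps)

text \<open>On carriers the rebuilt action and the original one agree on generators, hence
  everywhere; off the carriers both are \<open>undefined\<close>.\<close>

lemma B_module_of_intertwined_of:
  assumes strict: "strict_module BB N"
  shows "B_module_of (intertwined_of N) = N"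
proof -
  define \<sigma> where "\<sigma> = snd (intertwined_of N)"
  have io: "intertwined_of N = (bimodule_of N, \<sigma>)" by (simp add: \<sigma>_def intertwined_of_def)
  have \<sigma>: "\<sigma> \<in> bimodule_hom A M.MO M.OM"
    using M.intertwiner_of_hom [OF pair_op_pairing] by (simp add: \<sigma>_def intertwined_of_def)
  note p = M.pairing_of_pairing [OF \<sigma>]
  have eq: "M.B_action (M.pairing_of \<sigma>) b m = b \<odot>\<^bsub>N\<^esub> m" if "b \<in> carrier BB" "m \<in> carrier N" for b m
  \<comment> \<open>The identity map is shown to commute with the two actions, which is their
    equality.\<close>
  proof (rule B_action_hom [where h = "\<lambda>x. x", OF M.M_group N_group M.B_action [OF p] N_action])
    show "(\<lambda>x. x) \<in> add_hom (bimodule_of N) N" by (simp add: add_hom_def bimodule_of_simps)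
  qed (use that in \<open>simp_all add: M.B_action_bielt [OF p] M.B_action_bipair [OF p] bimodule_of_simps(1)
      bielt_smult intertwined_of_pairing [folded \<sigma>_def] pair_op_def\<close>)
  have undef: "b \<odot>\<^bsub>N\<^esub> m = undefined" if "\<not> (b \<in> carrier BB \<and> m \<in> carrier N)" for b m
    using strict that by (rule strict_module_undefined)
  have "smult (B_module_of (intertwined_of N)) = smult N"
    unfolding io by (intro ext) (simp add: B_module_of_def bimodule_of_simps(1) eq undef)
  then show ?thesis
    using strict unfolding io
    by (intro module.equality) (simp_all add: B_module_of_def bimodule_of_simps strict_module_def)
qed

end

text \<open>Both sides are compared with a third set, the bimodule maps commuting with all operators
  of dual pairs: \<open>intertwining_iff\<close> handles the intertwined side, generation by pure
  elements the module side.\<close>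

lemma intertwined_of_Hom:
  fixes N N' :: "(_, 'm) module"
  assumes N: "left_module BB N" and N': "left_module BB N'"
  shows "intertwined_hom A \<Omega> (intertwined_of N) (intertwined_of N') = module_hom BB N N'"
proof -
  interpret T: two_bimodules K A \<Omega> S e "bimodule_of N" "bimodule_of N'"
    by (intro two_bimodules.intro bimodule_over bimodule_of_algebra_bimodule N N')
  let ?\<sigma> = "snd (intertwined_of N)" and ?\<sigma>' = "snd (intertwined_of N')"
  have \<sigma>: "?\<sigma> \<in> bimodule_hom A T.M.MO T.M.OM" and \<sigma>': "?\<sigma>' \<in> bimodule_hom A T.M'.MO T.M'.OM"
    using T.M.intertwiner_of_hom [OF pair_op_pairing [OF N]]
      T.M'.intertwiner_of_hom [OF pair_op_pairing [OF N']]
    by (simp_all add: intertwined_of_def)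
  have iff: "f \<in> intertwined_hom A \<Omega> (intertwined_of N) (intertwined_of N') \<longleftrightarrow>
      f \<in> bimodule_hom A (bimodule_of N) (bimodule_of N') \<and>
      (\<forall>x \<in> carrier D. \<forall>w \<in> carrier \<Omega>. \<forall>m \<in> carrier N. f (pair_op N x w m) = pair_op N' x w (f m))" for f
  proof -
    have "f \<in> intertwined_hom A \<Omega> (intertwined_of N) (intertwined_of N') \<longleftrightarrow>
      f \<in> bimodule_hom A (bimodule_of N) (bimodule_of N') \<and>
      (\<forall>t \<in> carrier T.M.MO. ?\<sigma>' (tensor_map A (bimodule_of N') \<Omega> f id t) = tensor_map A \<Omega> (bimodule_of N') id f (?\<sigma> t))"
      by (simp add: intertwined_hom_def intertwined_of_def)
    also have "\<dots> \<longleftrightarrow> f \<in> bimodule_hom A (bimodule_of N) (bimodule_of N') \<and>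
      (\<forall>x \<in> carrier D. \<forall>w \<in> carrier \<Omega>. \<forall>m \<in> carrier N. f (pair_op N x w m) = pair_op N' x w (f m))"
    proof (rule conj_cong [OF refl])
      assume f: "f \<in> bimodule_hom A (bimodule_of N) (bimodule_of N')"
      then have "f m \<in> carrier N'" if "m \<in> carrier N" for m
        using that by (auto simp: bimodule_hom_def module_hom_def bimodule_of_simps)
      then show "(\<forall>t \<in> carrier T.M.MO. ?\<sigma>' (tensor_map A (bimodule_of N') \<Omega> f id t) =
          tensor_map A \<Omega> (bimodule_of N') id f (?\<sigma> t)) \<longleftrightarrow>
        (\<forall>x \<in> carrier D. \<forall>w \<in> carrier \<Omega>. \<forall>m \<in> carrier N. f (pair_op N x w m) = pair_op N' x w (f m))"
        unfolding T.intertwining_iff [OF f \<sigma> \<sigma>'] bimodule_of_simps(1)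
        by (intro ball_cong refl) (simp add: intertwined_of_pairing [OF N] intertwined_of_pairing [OF N'])
    qed
    finally show ?thesis .
  qed
  have "f \<in> module_hom BB N N' \<longleftrightarrow>
      f \<in> bimodule_hom A (bimodule_of N) (bimodule_of N') \<and>
      (\<forall>x \<in> carrier D. \<forall>w \<in> carrier \<Omega>. \<forall>m \<in> carrier N. f (pair_op N x w m) = pair_op N' x w (f m))" (is "?L \<longleftrightarrow> ?R") for f
  proof
    assume f: ?L
    then have fc: "f m \<in> carrier N'" if "m \<in> carrier N" for m
      using that by (auto simp: module_hom_def)
    have fs: "f (b \<odot>\<^bsub>N\<^esub> m) = b \<odot>\<^bsub>N'\<^esub> f m" if "b \<in> carrier BB" "m \<in> carrier N" for b m
      using f that by (auto simp: module_hom_def)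
    show ?R
      using f by (simp add: bimodule_hom_def module_hom_def [of A] bimodule_of_simps fs fc bielt_closed
          pair_op_def bipair_closed) (simp add: module_hom_def)
  next
    assume f: ?R
    then have fE: "f \<in> carrier N \<rightarrow>\<^sub>E carrier N'"
      and fa: "\<And>x y. \<lbrakk>x \<in> carrier N; y \<in> carrier N\<rbrakk> \<Longrightarrow> f (x \<oplus>\<^bsub>N\<^esub> y) = f x \<oplus>\<^bsub>N'\<^esub> f y"
      and fl: "\<And>a m. \<lbrakk>a \<in> carrier A; m \<in> carrier N\<rbrakk> \<Longrightarrow> f (a \<odot>\<^bsub>bimodule_of N\<^esub> m) = a \<odot>\<^bsub>bimodule_of N'\<^esub> f m"
      and fr: "\<And>a m. \<lbrakk>a \<in> carrier A; m \<in> carrier N\<rbrakk> \<Longrightarrow> f (m \<triangleleft>\<^bsub>bimodule_of N\<^esub> a) = f m \<triangleleft>\<^bsub>bimodule_of N'\<^esub> a"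
      and fp: "\<And>x w m. \<lbrakk>x \<in> carrier D; w \<in> carrier \<Omega>; m \<in> carrier N\<rbrakk> \<Longrightarrow> f (pair_op N x w m) = pair_op N' x w (f m)"
      by (simp_all add: bimodule_hom_def module_hom_def bimodule_of_simps(1,2))
    have fh: "f \<in> add_hom N N'"
      using fE fa by (auto simp: add_hom_def)
    note fc = add_hom_closed [OF fh]
    have "f (b \<odot>\<^bsub>N\<^esub> m) = b \<odot>\<^bsub>N'\<^esub> f m" if "b \<in> carrier BB" "m \<in> carrier N" for b m
    proof (rule B_action_hom [OF N_group [OF N] N_group [OF N'] N_action [OF N] N_action [OF N'] fh _ _ that])
      fix a b n assume *: "a \<in> carrier A" "b \<in> carrier A" "n \<in> carrier N"
      have "a \<odot>\<^bsub>bimodule_of N\<^esub> n \<in> carrier N"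
        using T.M.MB.l_closed [of a n] * by (simp add: bimodule_of_simps(1))
      with * show "f (bielt a b \<odot>\<^bsub>N\<^esub> n) = bielt a b \<odot>\<^bsub>N'\<^esub> f n"
        by (simp add: bielt_smult [OF N] bielt_smult [OF N'] fl fr fc)
    next
      show "f (bipair x w \<odot>\<^bsub>N\<^esub> n) = bipair x w \<odot>\<^bsub>N'\<^esub> f n"
        if "x \<in> carrier D" "w \<in> carrier \<Omega>" "n \<in> carrier N" for x w n
        using fp [OF that] by (simp add: pair_op_def)
    qed
    then show ?L
      using fE fa by (simp add: module_hom_def)
  qed
  with iff show ?thesis by blast
qed

context
  fixes M :: "('a, 'm) bimodule" and \<sigma>
  assumes obj: "(M, \<sigma>) \<in> intertwined_bimodules K A \<Omega>"
begin

interpretation M: bimodule_over K A \<Omega> S e M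
  by (rule bimodule_over) (use obj in \<open>simp add: intertwined_bimodules_def\<close>)

lemma \<sigma>_hom: "\<sigma> \<in> bimodule_hom A M.MO M.OM"
  using obj by (simp add: intertwined_bimodules_def)

lemmas p_pairing = M.pairing_of_pairing [OF \<sigma>_hom]

lemma B_module_of_left_module: "left_module BB (B_module_of (M, \<sigma>))"
proof -
  let ?N = "B_module_of (M, \<sigma>)" and ?f = "M.B_action (M.pairing_of \<sigma>)"
  note act = M.B_action [OF p_pairing]
  note b = is_action_simps(1) [OF act]
  interpret B: ring BB by (rule PB.B_ring)
  note ac = abelian_monoid.a_closed [OF abelian_group.axioms(1) [OF M.M_group]]
  have "biadditive BB ?N ?N (smult ?N)"
    by (rule biadditiveI)
      (simp_all add: B_module_of_simps biadditive_closed [OF b] biadditive_left [OF b] biadditive_right [OF b] ac)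
  then have "is_action BB ?N (smult ?N)"
    by (simp add: is_action_def B_module_of_simps biadditive_closed [OF b]
        is_action_simps(2) [OF act] is_action_simps(3) [OF act])
  moreover have "abelian_group ?N"
    by (rule abelian_group_cong [OF _ _ _ M.M_group]) (simp_all add: B_module_of_simps)
  ultimately show ?thesis
    by (simp add: left_module_iff PB.B_ring)
qed

lemma B_module_of_strict: "strict_module BB (B_module_of (M, \<sigma>))"
  using obj by (auto simp: strict_module_def intertwined_bimodules_def B_module_of_def extensional_def)

text \<open>The rebuilt one-sided actions are those of \<open>bielt a \<one>\<close> and
  \<open>bielt \<one> a\<close>, which give back a m and m a because the unit acts trivially from
  the other side.\<close>

lemma bimodule_of_B_module_of: "bimodule_of (B_module_of (M, \<sigma>)) = M"
proof -
  have s: "strict_module A M" "(\<lambda>(x, r). x \<triangleleft>\<^bsub>M\<^esub> r) \<in> extensional (carrier M \<times> carrier A)"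
    using obj by (simp_all add: intertwined_bimodules_def)
  have l: "a \<odot>\<^bsub>M\<^esub> m = undefined" and r: "m \<triangleleft>\<^bsub>M\<^esub> a = undefined" if "\<not> (a \<in> carrier A \<and> m \<in> carrier M)" for a m
    using strict_module_undefined [OF s(1) that] extensional_arb [OF s(2), of "(m, a)"] that by auto
  note simps = bimodule_of_def B_module_of_simps(1-3) B_module_of_simps(4) [OF bielt_closed]
    M.B_action_bielt [OF p_pairing] M.MB.l_one M.MB.r_one M.MB.l_closed
  have "smult (bimodule_of (B_module_of (M, \<sigma>))) = smult M"
    by (intro ext) (simp add: simps l)
  moreover have "rsmult (bimodule_of (B_module_of (M, \<sigma>))) = rsmult M"
    by (intro ext) (simp add: simps r)
  ultimately show ?thesis
    using s by (intro bimodule.equality) (simp_all add: bimodule_of_simps(1-3) B_module_of_simps(1-3)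
        strict_module_def, simp_all add: bimodule_of_def)
qed

text \<open>The underlying bimodule is already restored, and the operators read off from the module
  are those of \<sigma> on carriers; \<open>intertwiner_of_eqI\<close> returns \<sigma>
  itself.\<close>

lemma intertwined_of_B_module_of: "intertwined_of (B_module_of (M, \<sigma>)) = (M, \<sigma>)"
proof -
  let ?N = "B_module_of (M, \<sigma>)"
  have p: "M.pairing (pair_op ?N)"
    using pair_op_pairing [OF B_module_of_left_module] by (simp add: bimodule_of_B_module_of)
  have "M.intertwiner_of (pair_op ?N) = \<sigma>"
    by (rule M.intertwiner_of_eqI [OF \<sigma>_hom p])
      (simp add: pair_op_def B_module_of_simps bipair_closed M.B_action_bipair [OF p_pairing])
  then show ?thesis
    by (simp add: intertwined_of_def bimodule_of_B_module_of)
qed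

end

text \<open>Since both constructions keep the carrier, one type of elements serves the objects of
  both categories and morphisms are the same functions.\<close>

theorem B_modules_isomorphic_intertwined_bimodules:
  "isomorphic_categories (left_module_category (B_algebra K A \<Omega>) :: (_, 'm \<Rightarrow> 'm) cat)
    (intertwined_category K A \<Omega> :: (_, 'm \<Rightarrow> 'm) cat)"
  unfolding B_algebra_def
proof (rule isomorphic_categoriesI [where F = intertwined_of and G = B_module_of])
  let ?C = "left_module_category BB :: (_, 'm \<Rightarrow> 'm) cat"
  let ?D = "intertwined_category K A \<Omega> :: (_, 'm \<Rightarrow> 'm) cat"
  have C: "X \<in> Obj ?C \<longleftrightarrow> left_module BB X \<and> strict_module BB X" for X
    by (simp add: left_module_category_def)
  have D: "Obj ?D = intertwined_bimodules K A \<Omega>"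
    by (simp add: intertwined_category_def)
  show "category ?C"
    by (rule left_module_category_is_category [OF PB.B_ring])
  show "intertwined_of X \<in> Obj ?D" if "X \<in> Obj ?C" for X
    using that unfolding C D by (intro intertwined_of_closed) auto
  show "B_module_of Y \<in> Obj ?C" if "Y \<in> Obj ?D" for Y
    using that unfolding C D
    by (cases Y) (auto intro: B_module_of_left_module B_module_of_strict)
  show "B_module_of (intertwined_of X) = X" if "X \<in> Obj ?C" for X
    using that unfolding C by (intro B_module_of_intertwined_of) auto
  show "intertwined_of (B_module_of Y) = Y" if "Y \<in> Obj ?D" for Y
    using that unfolding D by (cases Y) (auto intro: intertwined_of_B_module_of)
  show "Hom ?D (intertwined_of X) (intertwined_of Y) = Hom ?C X Y" if "X \<in> Obj ?C" "Y \<in> Obj ?C" for X Y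
  proof -
    have "intertwined_hom A \<Omega> (intertwined_of X) (intertwined_of Y) = module_hom BB X Y"
      using that unfolding C by (intro intertwined_of_Hom) auto
    then show ?thesis
      by (simp add: intertwined_category_def left_module_category_def)
  qed
  show "Id ?D (intertwined_of X) = Id ?C X" for X
    by (simp add: intertwined_category_def left_module_category_def intertwined_of_def bimodule_of_simps)
  show "Comp ?D (intertwined_of X) (intertwined_of Y) (intertwined_of Z) = Comp ?C X Y Z" for X Y Z
    by (simp add: intertwined_category_def left_module_category_def intertwined_of_def bimodule_of_simps)
qed

end

theorem theorem3p3:
  fixes K :: "'k ring" and A :: "('k, 'a) module" and \<Omega> :: "('a, 'w) bimodule"
  assumes "field K"
    and "assoc_algebra K A"
    and "algebra_bimodule K A \<Omega>"
    and "finitely_generated (op_ring A) (right_part \<Omega>)"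
    and "projective_module (op_ring A) (right_part \<Omega>)"
  shows "isomorphic_categories
    (left_module_category (B_algebra K A \<Omega>) :: (_, 'm \<Rightarrow> 'm) cat)
    (intertwined_category K A \<Omega> :: (_, 'm \<Rightarrow> 'm) cat)"
proof -
  interpret bimodule_setting K A \<Omega>
    by (intro bimodule_setting.intro assms(2,3))
  \<comment> \<open>The opposite ring turns left linear coordinates into right linear functionals on
    \<Omega>, as membership in the dual demands.\<close>
  obtain S c where S: "finite S" "S \<subseteq> carrier (right_part \<Omega>)"
    and c: "\<forall>s \<in> S. c s \<in> add_hom (right_part \<Omega>) (op_ring A)"
      "\<forall>s \<in> S. \<forall>r \<in> carrier (op_ring A). \<forall>x \<in> carrier (right_part \<Omega>).
        c s (r \<odot>\<^bsub>right_part \<Omega>\<^esub> x) = r \<otimes>\<^bsub>op_ring A\<^esub> c s x"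
      "\<forall>x \<in> carrier (right_part \<Omega>). x = (\<Oplus>\<^bsub>right_part \<Omega>\<^esub>s\<in>S. c s x \<odot>\<^bsub>right_part \<Omega>\<^esub> s)"
    using finitely_generated_projective_dual_basis [OF assms(4,5)] by (elim exE conjE) (rule that)
  have O_group: "abelian_group \<Omega>"
    by (rule ring_bimodule.axioms(2) [OF O.ring_bimodule_axioms])
  have right_group: "abelian_group (right_part \<Omega>)"
    by (rule abelian_group_cong [OF _ _ _ O_group]) simp_all
  \<comment> \<open>Members of the dual are extensional, whereas the coordinate functions obtained
    above are unconstrained off the carrier.\<close>
  define e where "e s = restrict (c s) (carrier \<Omega>)" for s
  have c_closed: "c s w \<in> carrier A" if "s \<in> S" "w \<in> carrier \<Omega>" for s w
    using add_hom_closed [OF bspec [OF c(1) that(1)]] that(2) by simp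
  interpret B_module_setting K A \<Omega> S e
  proof
    show "finite S" "S \<subseteq> carrier \<Omega>" using S by simp_all
    show "e s \<in> carrier D" if s: "s \<in> S" for s
      using bspec [OF c(1) s] bspec [OF c(2) s]
      by (intro O.X_carrierI)
        (simp_all add: e_def c_closed s add_hom_def O.r_closed abelian_monoid.a_closed [OF abelian_group.axioms(1) [OF O_group]])
    fix w assume w: "w \<in> carrier \<Omega>"
    then have "w = (\<Oplus>\<^bsub>right_part \<Omega>\<^esub>s\<in>S. s \<triangleleft>\<^bsub>\<Omega>\<^esub> c s w)"
      using c(3) by simp
    \<comment> \<open>The sums are formed in two different records with equal addition; the
      identity, as an additive map between them, carries one to the other.\<close>
    also have "\<dots> = (\<Oplus>\<^bsub>\<Omega>\<^esub>s\<in>S. s \<triangleleft>\<^bsub>\<Omega>\<^esub> c s w)"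
      using S w c_closed
      by (intro finsum_add_hom [where f = "\<lambda>x. x", OF right_group O_group]) (auto simp: add_hom_def O.r_closed)
    also have "\<dots> = (\<Oplus>\<^bsub>\<Omega>\<^esub>s\<in>S. s \<triangleleft>\<^bsub>\<Omega>\<^esub> e s w)"
      using w by (simp add: e_def)
    finally show "w = (\<Oplus>\<^bsub>\<Omega>\<^esub>s\<in>S. s \<triangleleft>\<^bsub>\<Omega>\<^esub> e s w)" .
  qed
  show ?thesis
    by (rule B_modules_isomorphic_intertwined_bimodules)
qed

end
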